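(* For each of the following eight cases there exists a finite simple connected graph $G$ satisfying it, and for each case other than (v) there is an infinite family of finite simple connected graphs satisfying it (writing $i = \operatorname{ind-match}(G)$, $c = \operatorname{reg}(S/I(G))$, $q = \operatorname{min-match}(G)$, $r = \operatorname{match}(G)$): (i) $i = c = q = r$; (ii) $i = c = q < r$; (iii) $i = c < q = r$; (iv) $i = c < q < r$; (v) $i < c = q = r$; (vi) $i < c = q < r$; (vii) $i < c < q = r$; (viii) $i < c < q < r$.
   Context: For a finite simple graph $G$ on vertex set $V$, $S = K[V]$ is the standard graded polynomial ring over a field $K$ with one variable per vertex, and $I(G)$ is the ideal generated by the monomials $xy$ with $\{x,y\} \in E(G)$. $\operatorname{reg}(N) = \max\{ j - i : \beta_{ij}(N) \neq 0 \}$ where $\beta_{ij}(N) = \dim_K[\operatorname{Tor}_i^S(K, N)]_j$. A matching is a set of pairwise disjoint edges; maximal if no edge can be added; $\operatorname{match}(G)$ is the maximum cardinality of a matching, $\operatorname{min-match}(G)$ the minimum cardinality of a maximal matching. Two edges are $3$-disjoint if they are disjoint and no edge meets both; an induced matching is a set of pairwise $3$-disjoint edges; $\operatorname{ind-match}(G)$ is the maximum cardinality of an induced matching. *)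

theory Defs
  imports Complex_Main "HOL-Library.Function_Algebras" "HOL-Library.Poly_Mapping" "HOL-Library.Disjoint_Sets" "HOL-Algebra.Ideal"
begin

section \<open>Finite simple graphs\<close>

record 'v graph =
  verts :: "'v set"
  edges :: "'v set set"

definition simple_graph :: "'v graph \<Rightarrow> bool" where
  "simple_graph G \<longleftrightarrow> finite (verts G) \<and> (\<forall>e\<in>edges G. e \<subseteq> verts G \<and> card e = 2)"

definition connected_graph :: "'v graph \<Rightarrow> bool" where
  "connected_graph G \<longleftrightarrow> verts G \<noteq> {} \<and>
     (\<forall>u\<in>verts G. \<forall>v\<in>verts G. (u, v) \<in> {(x, y). {x, y} \<in> edges G}\<^sup>*)"

definition graph_iso :: "'v graph \<Rightarrow> 'v graph \<Rightarrow> bool" where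
  "graph_iso G H \<longleftrightarrow> (\<exists>f. bij_betw f (verts G) (verts H) \<and>
     (\<forall>x\<in>verts G. \<forall>y\<in>verts G. {x, y} \<in> edges G \<longleftrightarrow> {f x, f y} \<in> edges H))"

definition matching :: "'v graph \<Rightarrow> 'v set set \<Rightarrow> bool" where
  "matching G M \<longleftrightarrow> M \<subseteq> edges G \<and> pairwise disjnt M"

definition maximal_matching :: "'v graph \<Rightarrow> 'v set set \<Rightarrow> bool" where
  "maximal_matching G M \<longleftrightarrow> matching G M \<and> (\<forall>e\<in>edges G - M. \<not> matching G (insert e M))"

definition three_disjoint :: "'v graph \<Rightarrow> 'v set \<Rightarrow> 'v set \<Rightarrow> bool" where
  "three_disjoint G e f \<longleftrightarrow> disjnt e f \<and> \<not> (\<exists>g\<in>edges G. g \<inter> e \<noteq> {} \<and> g \<inter> f \<noteq> {})"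

definition induced_matching :: "'v graph \<Rightarrow> 'v set set \<Rightarrow> bool" where
  "induced_matching G M \<longleftrightarrow> M \<subseteq> edges G \<and> pairwise (three_disjoint G) M"

definition match_number :: "'v graph \<Rightarrow> nat" where
  "match_number G = Max (card ` {M. matching G M})"

definition min_match_number :: "'v graph \<Rightarrow> nat" where
  "min_match_number G = Min (card ` {M. maximal_matching G M})"

definition ind_match_number :: "'v graph \<Rightarrow> nat" where
  "ind_match_number G = Max (card ` {M. induced_matching G M})"


section \<open>The graded polynomial ring \<open>S = K[V]\<close>\<close>

text \<open>Polynomials are finitely supported functions from exponent vectors to coefficients;
  \<open>K[V]\<close> is the subring of those polynomials in which only variables from \<open>V\<close> occur.\<close>

type_synonym ('v, 'k) mpoly = "('v \<Rightarrow>\<^sub>0 nat) \<Rightarrow>\<^sub>0 'k"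

definition polys :: "'v set \<Rightarrow> ('v, 'k::field) mpoly set" where
  "polys V = {p. \<forall>m\<in>Poly_Mapping.keys p. Poly_Mapping.keys m \<subseteq> V}"

definition poly_ring :: "'v set \<Rightarrow> ('v, 'k::field) mpoly ring" where
  "poly_ring V = \<lparr>carrier = polys V, mult = (*), one = 1, zero = 0, add = (+)\<rparr>"

definition const :: "'k::field \<Rightarrow> ('v, 'k) mpoly" where
  "const c = Poly_Mapping.single 0 c"

definition var :: "'v \<Rightarrow> ('v, 'k::field) mpoly" where
  "var x = Poly_Mapping.single (Poly_Mapping.single x 1) 1"

definition mdeg :: "('v \<Rightarrow>\<^sub>0 nat) \<Rightarrow> nat" where
  "mdeg m = (\<Sum>x\<in>Poly_Mapping.keys m. Poly_Mapping.lookup m x)"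

text \<open>The zero polynomial is homogeneous of every degree, and the only one that is homogeneous
  of a negative degree.\<close>

definition homogeneous :: "int \<Rightarrow> ('v, 'k::field) mpoly \<Rightarrow> bool" where
  "homogeneous j p \<longleftrightarrow> (\<forall>m\<in>Poly_Mapping.keys p. int (mdeg m) = j)"

text \<open>The ideal generated by the variables; \<open>K\<close> is the \<open>S\<close>-module \<open>S / irrelevant V\<close>.\<close>

definition irrelevant :: "'v set \<Rightarrow> ('v, 'k::field) mpoly set" where
  "irrelevant V = genideal (poly_ring V) (var ` V)"

definition edge_ideal :: "'v graph \<Rightarrow> ('v, 'k::field) mpoly set" where
  "edge_ideal G = genideal (poly_ring (verts G)) {var x * var y | x y. {x, y} \<in> edges G}"

lemma cring_poly_ring: "cring (poly_ring V :: ('v, 'k::field) mpoly ring)"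
proof -
  have add: "p + q \<in> polys V" if "p \<in> polys V" "q \<in> polys V" for p q :: "('v, 'k) mpoly"
    using that Poly_Mapping.keys_add[of p q] unfolding polys_def by blast
  have mult: "p * q \<in> polys V" if "p \<in> polys V" "q \<in> polys V" for p q :: "('v, 'k) mpoly"
  proof -
    have "Poly_Mapping.keys m \<subseteq> V" if m: "m \<in> Poly_Mapping.keys (p * q)" for m
    proof -
      obtain a b where "a \<in> Poly_Mapping.keys p" "b \<in> Poly_Mapping.keys q" "m = a + b"
        using m keys_mult[of p q] by blast
      then show ?thesis
        using \<open>p \<in> polys V\<close> \<open>q \<in> polys V\<close> Poly_Mapping.keys_add[of a b]
        unfolding polys_def by blast
    qed
    then show ?thesis unfolding polys_def by blast
  qed
  have uminus: "- p \<in> polys V" if "p \<in> polys V" for p :: "('v, 'k) mpoly"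
    using that unfolding polys_def by simp
  have one: "(1 :: ('v, 'k) mpoly) \<in> polys V" and zero: "(0 :: ('v, 'k) mpoly) \<in> polys V"
    unfolding polys_def by (simp_all flip: single_one)
  show ?thesis
  proof (rule cringI)
    show "abelian_group (poly_ring V :: ('v, 'k) mpoly ring)"
    proof (rule abelian_groupI)
      fix p :: "('v, 'k) mpoly" assume "p \<in> carrier (poly_ring V)"
      then show "\<exists>q\<in>carrier (poly_ring V). q \<oplus>\<^bsub>poly_ring V\<^esub> p = \<zero>\<^bsub>poly_ring V\<^esub>"
        by (intro bexI[of _ "- p"]) (auto simp: poly_ring_def uminus)
    qed (auto simp: poly_ring_def add zero algebra_simps)
    show "Group.comm_monoid (poly_ring V :: ('v, 'k) mpoly ring)"
      by (rule Group.comm_monoidI) (auto simp: poly_ring_def mult one algebra_simps)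
  qed (auto simp: poly_ring_def algebra_simps)
qed


section \<open>Graded free resolutions, Tor and regularity of \<open>S/I\<close>\<close>

text \<open>
  The data of a complex of finitely generated graded free \<open>S\<close>-modules
  \<open>\<dots> \<rightarrow> F\<^sub>2 \<rightarrow> F\<^sub>1 \<rightarrow> F\<^sub>0 \<rightarrow> S/I\<close>: \<open>F\<^sub>i\<close> has basis \<open>0, \<dots>, rank i - 1\<close>, with basis element \<open>k\<close>
  in degree \<open>shift i k\<close>; \<open>mat i\<close> is the matrix of \<open>F\<^sub>i\<^sub>+\<^sub>1 \<rightarrow> F\<^sub>i\<close> (the first index is the row);
  and \<open>aug k\<close> is a representative in \<open>S\<close> of the image of basis element \<open>k\<close> of \<open>F\<^sub>0\<close> in \<open>S/I\<close>.
\<close>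

record (overloaded) ('v, 'k) free_complex =
  rank :: "nat \<Rightarrow> nat"
  shift :: "nat \<Rightarrow> nat \<Rightarrow> int"
  mat :: "nat \<Rightarrow> nat \<Rightarrow> nat \<Rightarrow> ('v, 'k) mpoly"
  aug :: "nat \<Rightarrow> ('v, 'k) mpoly"

text \<open>Vectors over a subset \<open>A\<close> of \<open>S\<close>, in the coordinates of \<open>F\<^sub>i\<close>; for \<open>A = S\<close> this is \<open>F\<^sub>i\<close>
  itself, and for an ideal \<open>A\<close> it is the submodule \<open>A F\<^sub>i\<close>.\<close>

definition vectors ::
  "('v, 'k::field) free_complex \<Rightarrow> nat \<Rightarrow> ('v, 'k) mpoly set \<Rightarrow> (nat \<Rightarrow> ('v, 'k) mpoly) set" where
  "vectors F i A = {v. (\<forall>k<rank F i. v k \<in> A) \<and> (\<forall>k\<ge>rank F i. v k = 0)}"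

definition component ::
  "'v set \<Rightarrow> ('v, 'k::field) free_complex \<Rightarrow> nat \<Rightarrow> int \<Rightarrow> (nat \<Rightarrow> ('v, 'k) mpoly) set" where
  "component V F i j =
     {v \<in> vectors F i (polys V). \<forall>k<rank F i. homogeneous (j - shift F i k) (v k)}"

definition diff ::
  "('v, 'k::field) free_complex \<Rightarrow> nat \<Rightarrow> (nat \<Rightarrow> ('v, 'k) mpoly) \<Rightarrow> nat \<Rightarrow> ('v, 'k) mpoly" where
  "diff F i v = (\<lambda>l. if l < rank F i then \<Sum>k<rank F (Suc i). mat F i l k * v k else 0)"

definition augment :: "('v, 'k::field) free_complex \<Rightarrow> (nat \<Rightarrow> ('v, 'k) mpoly) \<Rightarrow> ('v, 'k) mpoly"
  where "augment F v = (\<Sum>k<rank F 0. aug F k * v k)"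

definition graded_free_resolution ::
  "'v set \<Rightarrow> ('v, 'k::field) mpoly set \<Rightarrow> ('v, 'k) free_complex \<Rightarrow> bool" where
  "graded_free_resolution V I F \<longleftrightarrow>
     \<comment> \<open>the maps are homogeneous of degree 0 and defined over \<open>S\<close>\<close>
     (\<forall>i. \<forall>l<rank F i. \<forall>k<rank F (Suc i).
        mat F i l k \<in> polys V \<and> homogeneous (shift F (Suc i) k - shift F i l) (mat F i l k)) \<and>
     (\<forall>k<rank F 0. aug F k \<in> polys V \<and> homogeneous (shift F 0 k) (aug F k)) \<and>
     \<comment> \<open>exactness at \<open>S/I\<close>, at \<open>F\<^sub>0\<close>, and at \<open>F\<^sub>i\<^sub>+\<^sub>1\<close>\<close>
     (\<forall>f\<in>polys V. \<exists>v\<in>vectors F 0 (polys V). f - augment F v \<in> I) \<and>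
     (\<forall>v\<in>vectors F 0 (polys V).
        augment F v \<in> I \<longleftrightarrow> v \<in> diff F 0 ` vectors F 1 (polys V)) \<and>
     (\<forall>i. \<forall>v\<in>vectors F (Suc i) (polys V).
        diff F i v = 0 \<longleftrightarrow> v \<in> diff F (Suc i) ` vectors F (Suc (Suc i)) (polys V))"

text \<open>
  Writing \<open>m\<close> for the irrelevant ideal, \<open>K \<otimes> F\<^sub>i = F\<^sub>i / m F\<^sub>i\<close>.  The following are the preimages
  in the degree \<open>j\<close> part of \<open>F\<^sub>i\<close> of the cycles and of the boundaries of the complex \<open>K \<otimes> F\<close>;
  both contain the degree \<open>j\<close> part of \<open>m F\<^sub>i\<close>.
\<close>

definition tor_cycles ::
  "'v set \<Rightarrow> ('v, 'k::field) free_complex \<Rightarrow> nat \<Rightarrow> int \<Rightarrow> (nat \<Rightarrow> ('v, 'k) mpoly) set" where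
  "tor_cycles V F i j =
     {v \<in> component V F i j. i = 0 \<or> diff F (i - 1) v \<in> vectors F (i - 1) (irrelevant V)}"

definition tor_boundaries ::
  "'v set \<Rightarrow> ('v, 'k::field) free_complex \<Rightarrow> nat \<Rightarrow> int \<Rightarrow> (nat \<Rightarrow> ('v, 'k) mpoly) set" where
  "tor_boundaries V F i j =
     {v \<in> component V F i j. \<exists>w\<in>vectors F (Suc i) (polys V). \<exists>u\<in>vectors F i (irrelevant V).
        v = diff F i w + u}"

definition vscale :: "'k::field \<Rightarrow> (nat \<Rightarrow> ('v, 'k) mpoly) \<Rightarrow> nat \<Rightarrow> ('v, 'k) mpoly" where
  "vscale c v = (\<lambda>k. const c * v k)"

lemma vector_space_vscale:
  "vector_space (vscale :: 'k::field \<Rightarrow> (nat \<Rightarrow> ('v, 'k) mpoly) \<Rightarrow> nat \<Rightarrow> ('v, 'k) mpoly)"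
proof
  show "vscale 1 v = v" for v :: "nat \<Rightarrow> ('v, 'k) mpoly"
    by (simp add: vscale_def const_def single_one)
qed (auto simp: vscale_def const_def fun_eq_iff distrib_left distrib_right single_add
       mult_single mult.assoc[symmetric])

text \<open>The dimension over \<open>K\<close> of \<open>[Tor\<^sub>i(K, S/I)]\<^sub>j\<close>, for \<open>V\<close> finite and \<open>I\<close> homogeneous.  As for
  any derived functor a resolution is chosen, and the result does not depend on the choice.
  The dimension of the quotient (cycles modulo boundaries) is the difference of two dimensions:
  the boundaries form a subspace of the cycles, and both are finite-dimensional.\<close>

definition betti :: "'v set \<Rightarrow> ('v, 'k::field) mpoly set \<Rightarrow> nat \<Rightarrow> int \<Rightarrow> nat" where
  "betti V I i j =
     (let F = (SOME F. graded_free_resolution V I F) in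
        vector_space.dim vscale (tor_cycles V F i j) -
        vector_space.dim vscale (tor_boundaries V F i j))"

definition regularity :: "'v set \<Rightarrow> ('v, 'k::field) mpoly set \<Rightarrow> int" where
  "regularity V I = Max {j - int i | i j. betti V I i j \<noteq> 0}"

definition edge_reg :: "'k::field itself \<Rightarrow> 'v graph \<Rightarrow> int" where
  "edge_reg K G = regularity (verts G) (edge_ideal G :: ('v, 'k) mpoly set)"


section \<open>Realizing a relation between the four invariants\<close>

text \<open>A relation is a predicate on
  \<open>(ind-match(G), reg(S/I(G)), min-match(G), match(G))\<close>, as integers.\<close>

definition satisfies ::
  "'k::field itself \<Rightarrow> (int \<Rightarrow> int \<Rightarrow> int \<Rightarrow> int \<Rightarrow> bool) \<Rightarrow> 'v graph \<Rightarrow> bool" where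
  "satisfies K P G \<longleftrightarrow>
     P (int (ind_match_number G)) (edge_reg K G) (int (min_match_number G)) (int (match_number G))"

text \<open>Up to isomorphism every finite graph has vertices in \<^typ>\<open>nat\<close>.  The members of an infinite
  family have to be pairwise non-isomorphic, since relabelling the vertices of a single graph
  already produces infinitely many graphs.\<close>

definition realizable :: "'k::field itself \<Rightarrow> (int \<Rightarrow> int \<Rightarrow> int \<Rightarrow> int \<Rightarrow> bool) \<Rightarrow> bool" where
  "realizable K P \<longleftrightarrow>
     (\<exists>G :: nat graph. simple_graph G \<and> connected_graph G \<and> satisfies K P G)"

definition infinitely_realizable ::
  "'k::field itself \<Rightarrow> (int \<Rightarrow> int \<Rightarrow> int \<Rightarrow> int \<Rightarrow> bool) \<Rightarrow> bool" where
  "infinitely_realizable K P \<longleftrightarrow>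
     (\<exists>\<G> :: nat graph set. infinite \<G> \<and> pairwise (\<lambda>G H. \<not> graph_iso G H) \<G> \<and>
        (\<forall>G\<in>\<G>. simple_graph G \<and> connected_graph G \<and> satisfies K P G))"

end

theory Submission
  imports Defs
begin

text \<open>
  Chain maps and homotopies between resolutions show that the vanishing of Tor can be read off
  any graded free resolution of \<open>S/I\<close>.  Resolutions are obtained by adding one edge \<open>xy\<close> at a time:
  the cone of multiplication by \<open>xy\<close> from \<open>S/(I : xy)\<close> to \<open>S/I\<close> resolves \<open>S/(I + (xy))\<close>, and for a
  suitable order of the edges every colon ideal is generated by variables, up to one further
  edge.  In the last position of the resulting resolutions there is a basis element whose degree
  exceeds its position by the maximal amount, and it gives the regularity.

  All the graphs have \<open>ind-match = 1\<close>.  Joins of a complete graph with an independent set have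
  regularity 1 and settle (i)--(iv); complements of cycles in which one vertex is multiplied
  have regularity 2 and settle (v)--(viii).
\<close>

section \<open>Polynomials and squarefree monomial ideals\<close>

text \<open>The obstacle is that \<open>betti\<close> uses a resolution picked by
  \<open>SOME\<close>, of which only the defining property is known, and subtracts two dimensions in
  \<open>nat\<close>. Regularity, however, only asks which Betti numbers are nonzero, and vanishing
  amounts to an inclusion of cycles in boundaries. This inclusion passes from one resolution to
  another, so no dimension has to be computed and no minimal resolution is required. The values 1
  and 2 come from one count: a cone moves a basis element up one position and, for an edge, up two
  degrees, so it adds 1 to degree minus position. Colon ideals generated by variables have value 0
  and lead to 1; a colon ideal with one further edge has value 1 and leads to 2. With
  \<open>ind-match\<close> fixed at 1 and the regularity at 1 or 2, the other two invariants are
  tuned by size: the complete part or the cycle controls \<open>min-match\<close>, and additional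
  independent vertices leave room for larger matchings.\<close>

lemma polys_0 [simp]: "0 \<in> polys V"
  and polys_1 [simp]: "1 \<in> polys V"
  by (simp_all add: polys_def flip: single_one)

lemma polys_add: "p \<in> polys V \<Longrightarrow> q \<in> polys V \<Longrightarrow> p + q \<in> polys V"
  using Poly_Mapping.keys_add[of p q] unfolding polys_def by blast

lemma polys_uminus: "p \<in> polys V \<Longrightarrow> - p \<in> polys V"
  unfolding polys_def by simp

lemma polys_diff: "p \<in> polys V \<Longrightarrow> q \<in> polys V \<Longrightarrow> p - q \<in> polys V"
  using polys_add[of p V "- q"] polys_uminus[of q V] by simp

lemma polys_mult: "p \<in> polys V \<Longrightarrow> q \<in> polys V \<Longrightarrow> p * q \<in> polys V"
proof -
  assume "p \<in> polys V" "q \<in> polys V"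
  then show ?thesis
    using cring.cring_simprules(5)[OF cring_poly_ring[of V], of p q] by (simp add: poly_ring_def)
qed

lemma polys_sum: "(\<And>x. x \<in> X \<Longrightarrow> f x \<in> polys V) \<Longrightarrow> sum f X \<in> polys V"
  by (induction X rule: infinite_finite_induct) (auto simp: polys_add)

section \<open>Degrees of monomials and homogeneous polynomials\<close>

lemma mdeg_eq_sum:
  assumes "finite A" "Poly_Mapping.keys m \<subseteq> A"
  shows "mdeg m = (\<Sum>x\<in>A. Poly_Mapping.lookup m x)"
  unfolding mdeg_def using assms by (intro sum.mono_neutral_left) (auto simp: in_keys_iff)

lemma keys_add_nat:
  "Poly_Mapping.keys (a + b :: 'v \<Rightarrow>\<^sub>0 nat) = Poly_Mapping.keys a \<union> Poly_Mapping.keys b"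
  by (auto simp: in_keys_iff lookup_add)

lemma mdeg_add: "mdeg (a + b) = mdeg a + mdeg b"
proof -
  let ?A = "Poly_Mapping.keys a \<union> Poly_Mapping.keys b"
  have "mdeg m = (\<Sum>x\<in>?A. Poly_Mapping.lookup m x)" if "Poly_Mapping.keys m \<subseteq> ?A" for m
    using that by (intro mdeg_eq_sum) auto
  then show ?thesis
    by (simp add: keys_add_nat lookup_add sum.distrib)
qed

lemma mdeg_0 [simp]: "mdeg 0 = 0"
  by (simp add: mdeg_def)

lemma mdeg_eq_0_iff: "mdeg m = 0 \<longleftrightarrow> m = 0"
  by (auto simp: mdeg_def in_keys_iff intro!: poly_mapping_eqI)

lemma homogeneous_0 [simp]: "homogeneous j 0"
  by (simp add: homogeneous_def)

lemma homogeneous_1 [simp]: "homogeneous 0 1"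
  by (simp add: homogeneous_def flip: single_one)

lemma homogeneous_add: "homogeneous j p \<Longrightarrow> homogeneous j q \<Longrightarrow> homogeneous j (p + q)"
  using Poly_Mapping.keys_add[of p q] unfolding homogeneous_def by blast

lemma homogeneous_uminus: "homogeneous j p \<Longrightarrow> homogeneous j (- p)"
  unfolding homogeneous_def by simp

lemma homogeneous_mult:
  assumes "homogeneous i p" "homogeneous j q" "k = i + j"
  shows "homogeneous k (p * q)"
  unfolding homogeneous_def
proof
  fix m assume "m \<in> Poly_Mapping.keys (p * q)"
  then obtain a b where "a \<in> Poly_Mapping.keys p" "b \<in> Poly_Mapping.keys q" "m = a + b"
    using keys_mult[of p q] by blast
  then show "int (mdeg m) = k"
    using assms by (simp add: homogeneous_def mdeg_add)
qed

lemma homogeneous_sum: "(\<And>x. x \<in> X \<Longrightarrow> homogeneous j (f x)) \<Longrightarrow> homogeneous j (sum f X)"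
  by (induction X rule: infinite_finite_induct) (auto simp: homogeneous_add)

text \<open>One operator for two uses: splitting by degree (\<open>hom_part\<close>) and splitting
  by divisibility of the monomials (\<open>sqfree_ideal_insertE\<close>).\<close>

definition restr :: "('m \<Rightarrow> bool) \<Rightarrow> ('m \<Rightarrow>\<^sub>0 'k::comm_monoid_add) \<Rightarrow> 'm \<Rightarrow>\<^sub>0 'k" where
  "restr P p = (\<Sum>m | m \<in> Poly_Mapping.keys p \<and> P m. Poly_Mapping.single m (Poly_Mapping.lookup p m))"

lemma lookup_restr:
  "Poly_Mapping.lookup (restr P p) m = (if P m then Poly_Mapping.lookup p m else 0)"
  by (auto simp: restr_def lookup_sum lookup_single when_def in_keys_iff sum.delta)

lemma keys_restr: "Poly_Mapping.keys (restr P p) = {m \<in> Poly_Mapping.keys p. P m}"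
  by (auto simp: in_keys_iff lookup_restr split: if_splits)

lemma restr_True [simp]: "restr (\<lambda>_. True) p = p"
  by (rule poly_mapping_eqI) (simp add: lookup_restr)

lemma restr_add: "restr P (p + q) = restr P p + restr P q"
  by (rule poly_mapping_eqI) (simp add: lookup_restr lookup_add)

lemma restr_sum: "restr P (\<Sum>x\<in>X. f x) = (\<Sum>x\<in>X. restr P (f x))"
  by (rule poly_mapping_eqI) (simp add: lookup_restr lookup_sum)

lemma restr_split: "restr P p + restr (\<lambda>m. \<not> P m) p = (p :: 'm \<Rightarrow>\<^sub>0 'k::comm_monoid_add)"
  by (rule poly_mapping_eqI) (simp add: lookup_restr lookup_add)

lemma restr_eq_self: "(\<And>m. m \<in> Poly_Mapping.keys p \<Longrightarrow> P m) \<Longrightarrow> restr P p = p"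
  by (rule poly_mapping_eqI) (auto simp: lookup_restr in_keys_iff)

lemma restr_eq_0: "(\<And>m. m \<in> Poly_Mapping.keys p \<Longrightarrow> \<not> P m) \<Longrightarrow> restr P p = 0"
  by (rule poly_mapping_eqI) (auto simp: lookup_restr in_keys_iff)

definition hom_part :: "int \<Rightarrow> ('v, 'k::field) mpoly \<Rightarrow> ('v, 'k) mpoly" where
  "hom_part j = restr (\<lambda>m. int (mdeg m) = j)"

lemma hom_part_sum: "hom_part j (\<Sum>x\<in>X. f x) = (\<Sum>x\<in>X. hom_part j (f x))"
  by (simp add: hom_part_def restr_sum)

lemma hom_part_diff: "hom_part j (p - q) = hom_part j p - hom_part j q"
  by (rule poly_mapping_eqI) (simp add: hom_part_def lookup_restr lookup_minus)

lemma homogeneous_hom_part: "homogeneous j (hom_part j p)"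
  by (simp add: homogeneous_def hom_part_def keys_restr)

lemma hom_part_eq_self: "homogeneous j p \<Longrightarrow> hom_part j p = p"
  unfolding hom_part_def by (rule restr_eq_self) (simp add: homogeneous_def)

lemma hom_part_polys: "p \<in> polys V \<Longrightarrow> hom_part j p \<in> polys V"
  by (auto simp: polys_def hom_part_def keys_restr)

text \<open>The part of \<open>q\<close> outside degree \<open>j - e\<close> contributes nothing to
  degree \<open>j\<close>. This moves homogeneous parts through matrix entries and augmentations,
  and so makes preimages homogeneous.\<close>

lemma hom_part_mult:
  assumes "homogeneous e p"
  shows "hom_part j (p * q) = p * hom_part (j - e) q"
proof -
  let ?r = "restr (\<lambda>m. int (mdeg m) \<noteq> j - e) q"
  have "hom_part j (p * ?r) = 0"
    unfolding hom_part_def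
  proof (rule restr_eq_0)
    fix m assume "m \<in> Poly_Mapping.keys (p * ?r)"
    then obtain a b where "a \<in> Poly_Mapping.keys p" "b \<in> Poly_Mapping.keys ?r" "m = a + b"
      using keys_mult[of p ?r] by blast
    then show "int (mdeg m) \<noteq> j"
      using assms by (auto simp: homogeneous_def keys_restr mdeg_add)
  qed
  moreover have "q = hom_part (j - e) q + ?r"
    by (simp add: hom_part_def restr_split)
  then have "p * q = p * hom_part (j - e) q + p * ?r"
    by (metis distrib_left)
  then have "hom_part j (p * q) = hom_part j (p * hom_part (j - e) q) + hom_part j (p * ?r)"
    by (simp add: hom_part_def restr_add)
  moreover have "homogeneous j (p * hom_part (j - e) q)"
    using assms homogeneous_hom_part by (rule homogeneous_mult) simp
  ultimately show ?thesis
    by (simp add: hom_part_eq_self)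
qed

text \<open>Ideal membership as a test on the support of each monomial separately. In this form
  colon ideals become a question about sets of vertices.\<close>

definition sqfree_ideal :: "'v set \<Rightarrow> 'v set set \<Rightarrow> ('v, 'k::field) mpoly set" where
  "sqfree_ideal V E = {p \<in> polys V. \<forall>m\<in>Poly_Mapping.keys p. \<exists>e\<in>E. e \<subseteq> Poly_Mapping.keys m}"

lemma sqfree_ideal_polys: "p \<in> sqfree_ideal V E \<Longrightarrow> p \<in> polys V"
  by (simp add: sqfree_ideal_def)

lemma sqfree_ideal_0 [simp]: "0 \<in> sqfree_ideal V E"
  by (simp add: sqfree_ideal_def)

lemma sqfree_ideal_add:
  "p \<in> sqfree_ideal V E \<Longrightarrow> q \<in> sqfree_ideal V E \<Longrightarrow> p + q \<in> sqfree_ideal V E"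
  using Poly_Mapping.keys_add[of p q] polys_add[of p V q] unfolding sqfree_ideal_def by blast

lemma sqfree_ideal_uminus: "p \<in> sqfree_ideal V E \<Longrightarrow> - p \<in> sqfree_ideal V E"
  by (simp add: sqfree_ideal_def polys_uminus)

lemma sqfree_ideal_diff:
  "p \<in> sqfree_ideal V E \<Longrightarrow> q \<in> sqfree_ideal V E \<Longrightarrow> p - q \<in> sqfree_ideal V E"
  using sqfree_ideal_add[of p V E "- q"] sqfree_ideal_uminus[of q V E] by simp

lemma sqfree_ideal_mult:
  assumes "p \<in> sqfree_ideal V E" "q \<in> polys V"
  shows "p * q \<in> sqfree_ideal V E"
  unfolding sqfree_ideal_def
proof safe
  show "p * q \<in> polys V"
    using assms by (simp add: sqfree_ideal_def polys_mult)
next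
  fix m assume "m \<in> Poly_Mapping.keys (p * q)"
  then obtain a b where "a \<in> Poly_Mapping.keys p" "b \<in> Poly_Mapping.keys q" "m = a + b"
    using keys_mult[of p q] by blast
  moreover then obtain e where "e \<in> E" "e \<subseteq> Poly_Mapping.keys a"
    using assms(1) unfolding sqfree_ideal_def by blast
  ultimately show "\<exists>e\<in>E. e \<subseteq> Poly_Mapping.keys m"
    by (intro bexI[of _ e]) (auto simp: keys_add_nat)
qed

lemma sqfree_ideal_sum:
  "(\<And>x. x \<in> X \<Longrightarrow> f x \<in> sqfree_ideal V E) \<Longrightarrow> sum f X \<in> sqfree_ideal V E"
  by (induction X rule: infinite_finite_induct) (auto simp: sqfree_ideal_add)

lemma sqfree_ideal_hom_part: "p \<in> sqfree_ideal V E \<Longrightarrow> hom_part j p \<in> sqfree_ideal V E"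
  by (auto simp: sqfree_ideal_def hom_part_polys) (auto simp: hom_part_def keys_restr)

lemma sqfree_ideal_mono: "E \<subseteq> E' \<Longrightarrow> sqfree_ideal V E \<subseteq> sqfree_ideal V E'"
  unfolding sqfree_ideal_def by blast

lemma sqfree_ideal_empty: "sqfree_ideal V {} = {0}"
  by (auto simp: sqfree_ideal_def)

section \<open>Squarefree monomials as generators\<close>

definition sqmon :: "'v set \<Rightarrow> 'v \<Rightarrow>\<^sub>0 nat" where
  "sqmon e = (\<Sum>x\<in>e. Poly_Mapping.single x 1)"

definition sqvar :: "'v set \<Rightarrow> ('v, 'k::field) mpoly" where
  "sqvar e = Poly_Mapping.single (sqmon e) 1"

lemma lookup_sqmon: "finite e \<Longrightarrow> Poly_Mapping.lookup (sqmon e) x = (if x \<in> e then 1 else 0)"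
  by (simp add: sqmon_def lookup_sum lookup_single when_def sum.delta)

lemma keys_sqmon: "finite e \<Longrightarrow> Poly_Mapping.keys (sqmon e) = e"
  by (auto simp: in_keys_iff lookup_sqmon split: if_splits)

lemma mdeg_sqmon: "finite e \<Longrightarrow> mdeg (sqmon e) = card e"
  by (simp add: mdeg_def keys_sqmon lookup_sqmon)

lemma homogeneous_sqvar: "finite e \<Longrightarrow> homogeneous (int (card e)) (sqvar e)"
  by (simp add: homogeneous_def sqvar_def mdeg_sqmon)

lemma sqvar_polys: "finite e \<Longrightarrow> e \<subseteq> V \<Longrightarrow> sqvar e \<in> polys V"
  by (simp add: polys_def sqvar_def keys_sqmon)

lemma sqvar_in_sqfree_ideal:
  "finite e \<Longrightarrow> e \<subseteq> V \<Longrightarrow> e \<in> E \<Longrightarrow> sqvar e \<in> sqfree_ideal V E"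
  by (auto simp: sqfree_ideal_def sqvar_polys) (auto simp: sqvar_def keys_sqmon)

lemma sqmon_add_diff:
  assumes "finite e" "e \<subseteq> Poly_Mapping.keys m"
  shows "sqmon e + (m - sqmon e) = m"
proof (rule poly_mapping_eqI)
  fix x
  have "x \<in> e \<Longrightarrow> Poly_Mapping.lookup m x \<noteq> 0"
    using assms(2) by (auto simp: in_keys_iff)
  then show "Poly_Mapping.lookup (sqmon e + (m - sqmon e)) x = Poly_Mapping.lookup m x"
    using assms(1) by (simp add: lookup_add lookup_minus lookup_sqmon)
qed

lemma sum_single_lookup:
  "(\<Sum>m\<in>Poly_Mapping.keys p. Poly_Mapping.single m (Poly_Mapping.lookup p m)) = p"
  using restr_True[of p] unfolding restr_def by simp

lemma single_eq_sqvar_mult: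
  assumes "finite e" "e \<subseteq> Poly_Mapping.keys m"
  shows "Poly_Mapping.single m c = sqvar e * Poly_Mapping.single (m - sqmon e) c"
  using assms by (simp add: sqvar_def mult_single sqmon_add_diff)

lemma keys_minus_nat_subset:
  "Poly_Mapping.keys (a - b :: 'v \<Rightarrow>\<^sub>0 nat) \<subseteq> Poly_Mapping.keys a"
  by (auto simp: in_keys_iff lookup_minus)

lemma single_polys: "Poly_Mapping.keys m \<subseteq> V \<Longrightarrow> Poly_Mapping.single m c \<in> polys V"
  by (simp add: polys_def)

lemma sqfree_ideal_ideal:
  "ideal (sqfree_ideal V E :: ('v, 'k::field) mpoly set) (poly_ring V)"
proof (rule idealI)
  interpret cring "poly_ring V :: ('v, 'k) mpoly ring" by (rule cring_poly_ring)
  show "ring (poly_ring V :: ('v, 'k) mpoly ring)" by (rule ring_axioms)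
  show "subgroup (sqfree_ideal V E) (add_monoid (poly_ring V :: ('v, 'k) mpoly ring))"
  proof (rule group.subgroupI[OF a_group])
    fix a :: "('v, 'k) mpoly" assume a: "a \<in> sqfree_ideal V E"
    have "inv\<^bsub>add_monoid (poly_ring V)\<^esub> a = \<ominus>\<^bsub>poly_ring V\<^esub> a"
      by (simp add: a_inv_def)
    also have "\<dots> = - a"
      using a by (intro minus_equality) (auto simp: poly_ring_def sqfree_ideal_polys polys_uminus)
    finally show "inv\<^bsub>add_monoid (poly_ring V)\<^esub> a \<in> sqfree_ideal V E"
      using a by (simp add: sqfree_ideal_uminus)
  qed (auto simp: poly_ring_def sqfree_ideal_polys sqfree_ideal_add intro: sqfree_ideal_0)
qed (auto simp: poly_ring_def sqfree_ideal_mult mult.commute)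

text \<open>A polynomial is the sum of its terms, and each term here is a multiple of a generator.
  The case of singletons gives the irrelevant ideal, the case of edges the edge ideal.\<close>

lemma genideal_sqvar:
  assumes "\<And>e. e \<in> E \<Longrightarrow> finite e \<and> e \<subseteq> V"
  shows "genideal (poly_ring V) (sqvar ` E) = (sqfree_ideal V E :: ('v, 'k::field) mpoly set)"
proof
  interpret cring "poly_ring V :: ('v, 'k) mpoly ring" by (rule cring_poly_ring)
  show "genideal (poly_ring V) (sqvar ` E) \<subseteq> (sqfree_ideal V E :: ('v, 'k) mpoly set)"
    using assms by (intro genideal_minimal sqfree_ideal_ideal) (auto intro: sqvar_in_sqfree_ideal)
  have sub: "(sqvar ` E :: ('v, 'k) mpoly set) \<subseteq> carrier (poly_ring V)"
    using assms by (auto simp: poly_ring_def sqvar_polys)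
  interpret I: ideal "genideal (poly_ring V) (sqvar ` E) :: ('v, 'k) mpoly set" "poly_ring V"
    by (rule genideal_ideal[OF sub])
  let ?I = "genideal (poly_ring V) (sqvar ` E) :: ('v, 'k) mpoly set"
  have add: "p + q \<in> ?I" if "p \<in> ?I" "q \<in> ?I" for p q
    using I.a_closed[OF that] by (simp add: poly_ring_def)
  have zero: "0 \<in> ?I"
    using I.zero_closed by (simp add: poly_ring_def)
  have sum: "sum f X \<in> ?I" if "\<And>x. x \<in> X \<Longrightarrow> f x \<in> ?I" for f and X :: "('v \<Rightarrow>\<^sub>0 nat) set"
    using that by (induction X rule: infinite_finite_induct) (auto simp: add zero)
  have single: "Poly_Mapping.single m c \<in> ?I"
    if m: "Poly_Mapping.keys m \<subseteq> V" "e \<in> E" "e \<subseteq> Poly_Mapping.keys m" for m e c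
  proof -
    have "sqvar e * Poly_Mapping.single (m - sqmon e) c \<in> ?I"
    proof -
      have "sqvar e \<in> ?I"
        using genideal_self[OF sub] m(2) by blast
      moreover have "Poly_Mapping.single (m - sqmon e) c \<in> polys V"
        using keys_minus_nat_subset[of m "sqmon e"] m(1) by (intro single_polys) blast
      ultimately show ?thesis
        using I.I_r_closed by (simp add: poly_ring_def)
    qed
    then show ?thesis
      using single_eq_sqvar_mult[of e m c] assms m by simp
  qed
  show "sqfree_ideal V E \<subseteq> ?I"
  proof
    fix p :: "('v, 'k) mpoly" assume "p \<in> sqfree_ideal V E"
    then have "Poly_Mapping.single m (Poly_Mapping.lookup p m) \<in> ?I" if "m \<in> Poly_Mapping.keys p" for m
      using that single unfolding sqfree_ideal_def polys_def by blast
    then have "(\<Sum>m\<in>Poly_Mapping.keys p. Poly_Mapping.single m (Poly_Mapping.lookup p m)) \<in> ?I"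
      by (rule sum)
    then show "p \<in> ?I"
      by (simp add: sum_single_lookup)
  qed
qed

lemma irrelevant_eq:
  "irrelevant V = {p \<in> polys V. Poly_Mapping.lookup p 0 = (0 :: 'k::field)}"
proof -
  have "var ` V = (sqvar ` (\<lambda>x. {x}) ` V :: ('a, 'k) mpoly set)"
    by (auto simp: var_def sqvar_def sqmon_def image_image)
  then have "irrelevant V = (sqfree_ideal V ((\<lambda>x. {x}) ` V) :: ('a, 'k) mpoly set)"
    unfolding irrelevant_def using genideal_sqvar[of "(\<lambda>x. {x}) ` V" V] by auto
  moreover have "(\<exists>e\<in>(\<lambda>x. {x}) ` V. e \<subseteq> Poly_Mapping.keys m) \<longleftrightarrow> m \<noteq> 0"
    if "p \<in> polys V" "m \<in> Poly_Mapping.keys p" for p :: "('a, 'k) mpoly" and m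
  proof -
    have "Poly_Mapping.keys m = {} \<longleftrightarrow> m = 0"
      by (auto intro!: poly_mapping_eqI simp: in_keys_iff)
    moreover have "Poly_Mapping.keys m \<subseteq> V"
      using that by (auto simp: polys_def)
    ultimately show ?thesis by blast
  qed
  then have "sqfree_ideal V ((\<lambda>x. {x}) ` V) =
      {p \<in> polys V. \<forall>m\<in>Poly_Mapping.keys (p :: ('a, 'k) mpoly). m \<noteq> 0}"
    unfolding sqfree_ideal_def by blast
  moreover have "(\<forall>m\<in>Poly_Mapping.keys p. m \<noteq> 0) \<longleftrightarrow> Poly_Mapping.lookup p 0 = 0"
    for p :: "('a, 'k) mpoly"
    by (metis in_keys_iff)
  ultimately show ?thesis by simp
qed

lemma edge_ideal_eq:
  assumes "simple_graph G"
  shows "edge_ideal G = sqfree_ideal (verts G) (edges G)"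
proof -
  have pair: "\<exists>x y. e = {x, y} \<and> x \<noteq> y" if "e \<in> edges G" for e
    using assms that unfolding simple_graph_def card_2_iff by blast
  have var_mult: "var x * var y = (sqvar {x, y} :: ('a, 'b) mpoly)" if "x \<noteq> y" for x y
    using that by (simp add: var_def sqvar_def sqmon_def mult_single)
  have "{var x * var y | x y. {x, y} \<in> edges G} = (sqvar ` edges G :: ('a, 'b) mpoly set)"
  proof safe
    fix x y assume e: "{x, y} \<in> edges G"
    then have "x \<noteq> y" using pair[OF e] by (auto simp: doubleton_eq_iff)
    then show "var x * var y \<in> (sqvar ` edges G :: ('a, 'b) mpoly set)"
      using e var_mult by auto
  next
    fix e assume "e \<in> edges G"
    then show "\<exists>x y. sqvar e = (var x * var y :: ('a, 'b) mpoly) \<and> {x, y} \<in> edges G"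
      using pair var_mult by metis
  qed
  moreover have "finite e \<and> e \<subseteq> verts G" if "e \<in> edges G" for e
    using assms that by (auto simp: simple_graph_def intro: finite_subset)
  ultimately show ?thesis
    unfolding edge_ideal_def using genideal_sqvar by metis
qed

text \<open>Splitting off the monomials divisible by the new generator.\<close>

lemma sqfree_ideal_insertE:
  assumes "p \<in> sqfree_ideal V (insert e E)" "finite e"
  obtains g h where "g \<in> sqfree_ideal V E" "h \<in> polys V" "p = g + sqvar e * h"
proof
  let ?P = "\<lambda>m. e \<subseteq> Poly_Mapping.keys m"
  let ?h = "\<Sum>m\<in>Poly_Mapping.keys (restr ?P p).
    Poly_Mapping.single (m - sqmon e) (Poly_Mapping.lookup p m)"
  show "restr (\<lambda>m. \<not> ?P m) p \<in> sqfree_ideal V E"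
    using assms by (auto simp: sqfree_ideal_def polys_def keys_restr)
  show "?h \<in> polys V"
    using assms(1) keys_minus_nat_subset
    by (intro polys_sum single_polys) (fastforce simp: keys_restr sqfree_ideal_def polys_def)
  have "sqvar e * ?h = (\<Sum>m\<in>Poly_Mapping.keys (restr ?P p).
      Poly_Mapping.single m (Poly_Mapping.lookup (restr ?P p) m))"
    unfolding sum_distrib_left using assms(2)
    by (intro sum.cong) (auto simp: keys_restr lookup_restr simp flip: single_eq_sqvar_mult)
  then show "p = restr (\<lambda>m. \<not> ?P m) p + sqvar e * ?h"
    using restr_split[of ?P p] by (simp add: sum_single_lookup add.commute)
qed

text \<open>Multiplication by \<open>sqvar e\<close> translates exponents injectively, so no terms
  cancel and the monomials of the product are the translated ones. Only supports matter for
  divisibility by squarefree monomials, which is why \<open>colon\<close> speaks of sets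
  \<open>s\<close>.\<close>

lemma sqvar_mult_mem_iff:
  assumes "finite e" "e \<subseteq> V"
    and colon: "\<And>s. finite s \<Longrightarrow> s \<subseteq> V \<Longrightarrow> (\<exists>d\<in>E. d \<subseteq> s \<union> e) \<longleftrightarrow> (\<exists>d\<in>E'. d \<subseteq> s)"
    and "h \<in> polys V"
  shows "sqvar e * h \<in> sqfree_ideal V E \<longleftrightarrow> h \<in> sqfree_ideal V E'"
proof -
  have lk: "Poly_Mapping.lookup (sqvar e * h) (sqmon e + m) = Poly_Mapping.lookup h m" for m
  proof -
    have "sqvar e * h = (\<Sum>k\<in>Poly_Mapping.keys h.
        Poly_Mapping.single (sqmon e + k) (Poly_Mapping.lookup h k))"
      using arg_cong[OF sum_single_lookup[of h], of "(*) (sqvar e)"]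
      by (simp add: sum_distrib_left sqvar_def mult_single)
    then show ?thesis
      by (simp add: lookup_sum lookup_single when_def in_keys_iff sum.delta)
  qed
  have keys: "Poly_Mapping.keys (sqvar e * h) = (+) (sqmon e) ` Poly_Mapping.keys h"
  proof
    show "Poly_Mapping.keys (sqvar e * h) \<subseteq> (+) (sqmon e) ` Poly_Mapping.keys h"
      using keys_mult[of "sqvar e" h] by (auto simp: sqvar_def)
    show "(+) (sqmon e) ` Poly_Mapping.keys h \<subseteq> Poly_Mapping.keys (sqvar e * h)"
      using lk by (auto simp: in_keys_iff)
  qed
  have "sqvar e * h \<in> polys V"
    using assms by (simp add: polys_mult sqvar_polys)
  moreover have "(\<exists>d\<in>E. d \<subseteq> Poly_Mapping.keys (sqmon e + m)) \<longleftrightarrow> (\<exists>d\<in>E'. d \<subseteq> Poly_Mapping.keys m)"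
    if "m \<in> Poly_Mapping.keys h" for m
    using colon[of "Poly_Mapping.keys m"] that assms(1,4)
    by (auto simp: keys_add_nat keys_sqmon polys_def Un_commute)
  ultimately show ?thesis
    using assms(4) by (simp add: sqfree_ideal_def keys)
qed

section \<open>Chain maps between graded free resolutions\<close>

text \<open>A linear map is kept as the family of its columns: \<open>c k\<close> is the image of
  basis element \<open>k\<close>. Columns are what lifting arguments construct one at a
  time.\<close>

definition lin ::
  "nat \<Rightarrow> (nat \<Rightarrow> nat \<Rightarrow> ('v, 'k::field) mpoly) \<Rightarrow> (nat \<Rightarrow> ('v, 'k) mpoly) \<Rightarrow> nat \<Rightarrow> ('v, 'k) mpoly"
  where "lin n c v = (\<lambda>l. \<Sum>k<n. c k l * v k)"

definition unit_vec :: "nat \<Rightarrow> nat \<Rightarrow> ('v, 'k::field) mpoly" where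
  "unit_vec k = (\<lambda>l. if l = k then 1 else 0)"

text \<open>Cutting the column off at the rank puts it into \<open>vectors F i\<close>, whatever
  \<open>mat\<close> contains out of range.\<close>

definition dcol :: "('v, 'k::field) free_complex \<Rightarrow> nat \<Rightarrow> nat \<Rightarrow> nat \<Rightarrow> ('v, 'k) mpoly" where
  "dcol F i k = (\<lambda>l. if l < rank F i then mat F i l k else 0)"

lemma diff_eq_lin: "diff F i = lin (rank F (Suc i)) (dcol F i)"
  by (auto simp: diff_def lin_def dcol_def fun_eq_iff)

lemma lin_0 [simp]: "lin n c 0 = 0"
  by (simp add: lin_def fun_eq_iff)

lemma lin_add: "lin n c (v + w) = lin n c v + lin n c w"
  by (simp add: lin_def fun_eq_iff distrib_left sum.distrib)

lemma lin_diff: "lin n c (v - w) = lin n c v - lin n c w"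
  by (simp add: lin_def fun_eq_iff right_diff_distrib sum_subtractf)

lemma diff_minus: "diff F i (v - w) = diff F i v - diff F i w"
  by (simp add: diff_eq_lin lin_diff)

lemma diff_plus: "diff F i (v + w) = diff F i v + diff F i w"
  by (simp add: diff_eq_lin lin_add)

lemma lin_uminus: "lin n c (- v) = - lin n c v"
  by (simp add: lin_def fun_eq_iff sum_negf)

lemma lin_diff_cols: "lin n (\<lambda>k. c k - d k) v = lin n c v - lin n d v"
  by (simp add: lin_def fun_eq_iff left_diff_distrib sum_subtractf)

lemma lin_cong: "(\<And>k. k < n \<Longrightarrow> c k = d k) \<Longrightarrow> lin n c v = lin n d v"
  by (simp add: lin_def)

lemma lin_lin: "lin n c (lin m d v) = lin m (\<lambda>k. lin n c (d k)) v"
proof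
  fix l
  have "lin n c (lin m d v) l = (\<Sum>k<n. \<Sum>j<m. c k l * (d j k * v j))"
    by (simp add: lin_def sum_distrib_left)
  also have "\<dots> = (\<Sum>j<m. \<Sum>k<n. c k l * (d j k * v j))"
    by (rule sum.swap)
  finally show "lin n c (lin m d v) l = lin m (\<lambda>k. lin n c (d k)) v l"
    by (simp add: lin_def sum_distrib_right mult.assoc)
qed

lemma lin_unit_vec: "k < n \<Longrightarrow> lin n c (unit_vec k) = c k"
  by (simp add: lin_def unit_vec_def fun_eq_iff if_distrib[of "(*) _"] cong: if_cong)

lemma lin_unit_cols: "v \<in> vectors F i A \<Longrightarrow> lin (rank F i) unit_vec v = v"
  by (auto simp: lin_def unit_vec_def fun_eq_iff vectors_def if_distrib[of "\<lambda>x. x * _"] not_less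
      cong: if_cong)

lemma vectors_add:
  "v \<in> vectors F i (polys V) \<Longrightarrow> w \<in> vectors F i (polys V) \<Longrightarrow> v + w \<in> vectors F i (polys V)"
  by (simp add: vectors_def polys_add)

lemma vectors_diff:
  "v \<in> vectors F i (polys V) \<Longrightarrow> w \<in> vectors F i (polys V) \<Longrightarrow> v - w \<in> vectors F i (polys V)"
  by (simp add: vectors_def polys_diff)

lemma vectors_uminus: "v \<in> vectors F i (polys V) \<Longrightarrow> - v \<in> vectors F i (polys V)"
  by (simp add: vectors_def polys_uminus)

lemma vectors_0: "0 \<in> vectors F i (polys V)"
  by (simp add: vectors_def)

lemma unit_vec_vectors: "k < rank F i \<Longrightarrow> unit_vec k \<in> vectors F i (polys V)"
  by (auto simp: vectors_def unit_vec_def)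

lemma unit_vec_component: "k < rank F i \<Longrightarrow> unit_vec k \<in> component V F i (shift F i k)"
  by (auto simp: component_def unit_vec_vectors) (auto simp: unit_vec_def)

lemma component_vectors: "v \<in> component V F i j \<Longrightarrow> v \<in> vectors F i (polys V)"
  by (simp add: component_def)

section \<open>The irrelevant ideal, and graded maps given by columns\<close>

lemma irrelevant_0 [simp]: "0 \<in> irrelevant V"
  by (simp add: irrelevant_eq)

lemma irrelevant_add: "p \<in> irrelevant V \<Longrightarrow> q \<in> irrelevant V \<Longrightarrow> p + q \<in> irrelevant V"
  by (simp add: irrelevant_eq polys_add lookup_add)

lemma irrelevant_diff: "p \<in> irrelevant V \<Longrightarrow> q \<in> irrelevant V \<Longrightarrow> p - q \<in> irrelevant V"
  by (simp add: irrelevant_eq polys_diff lookup_minus)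

lemma homogeneous_irrelevant:
  assumes "p \<in> polys V" "homogeneous j p" "j \<noteq> 0"
  shows "p \<in> irrelevant V"
  using assms unfolding irrelevant_eq homogeneous_def by (auto simp: in_keys_iff dest: bspec[of _ _ 0])

lemma irrelevant_mult:
  assumes "p \<in> polys V" "q \<in> irrelevant V"
  shows "p * q \<in> irrelevant V"
proof -
  have "0 \<notin> Poly_Mapping.keys (p * q)"
  proof
    assume "0 \<in> Poly_Mapping.keys (p * q)"
    then obtain a b where ab: "b \<in> Poly_Mapping.keys q" "0 = a + b"
      using keys_mult[of p q] by blast
    then have "b = 0"
      using mdeg_add[of a b] by (simp add: mdeg_eq_0_iff)
    then show False
      using ab assms by (simp add: irrelevant_eq in_keys_iff)
  qed
  then show ?thesis
    using assms by (simp add: irrelevant_eq polys_mult in_keys_iff)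
qed

lemma irrelevant_sum: "(\<And>x. x \<in> X \<Longrightarrow> f x \<in> irrelevant V) \<Longrightarrow> sum f X \<in> irrelevant V"
  by (induction X rule: infinite_finite_induct) (auto simp: irrelevant_add)

lemma vectors_irrelevant_diff:
  "v \<in> vectors F i (irrelevant V) \<Longrightarrow> w \<in> vectors F i (irrelevant V) \<Longrightarrow>
    v - w \<in> vectors F i (irrelevant V)"
  by (simp add: vectors_def irrelevant_diff)

lemma lin_vectors:
  assumes "\<And>k. k < n \<Longrightarrow> c k \<in> vectors F i (polys V)" "\<And>k. k < n \<Longrightarrow> v k \<in> polys V"
  shows "lin n c v \<in> vectors F i (polys V)"
  using assms by (auto simp: vectors_def lin_def intro!: polys_sum polys_mult)

lemma lin_vectors_irrelevant:
  assumes "\<And>k. k < n \<Longrightarrow> c k \<in> vectors F i (polys V)" "\<And>k. k < n \<Longrightarrow> v k \<in> irrelevant V"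
  shows "lin n c v \<in> vectors F i (irrelevant V)"
  using assms by (auto simp: vectors_def lin_def intro!: irrelevant_sum irrelevant_mult)

text \<open>Here \<open>d\<close> is the degree of the map: 0 for differentials and comparison maps,
  the degree of the new generator for the map defining a cone.\<close>

lemma lin_component:
  assumes c: "\<And>k. k < rank F i' \<Longrightarrow> c k \<in> component V G i (shift F i' k + d)"
    and v: "v \<in> component V F i' j"
  shows "lin (rank F i') c v \<in> component V G i (j + d)"
proof -
  have "lin (rank F i') c v \<in> vectors G i (polys V)"
    using assms by (intro lin_vectors) (auto simp: component_def vectors_def)
  moreover have "homogeneous (j + d - shift G i l) (lin (rank F i') c v l)" if "l < rank G i" for l
    unfolding lin_def
  proof (rule homogeneous_sum)
    fix k assume "k \<in> {..<rank F i'}"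
    then show "homogeneous (j + d - shift G i l) (c k l * v k)"
      using c[of k] v that
      by (intro homogeneous_mult[of "shift F i' k + d - shift G i l" _ "j - shift F i' k"])
        (auto simp: component_def)
  qed
  ultimately show ?thesis by (simp add: component_def)
qed

abbreviation sqfree_res ::
  "'v set \<Rightarrow> 'v set set \<Rightarrow> ('v, 'k::field) free_complex \<Rightarrow> bool" where
  "sqfree_res V E F \<equiv> graded_free_resolution V (sqfree_ideal V E) F"

lemma augment_lin: "augment F (lin n c v) = (\<Sum>k<n. augment F (c k) * v k)"
proof -
  have "augment F (lin n c v) = (\<Sum>l<rank F 0. \<Sum>k<n. aug F l * (c k l * v k))"
    by (simp add: augment_def lin_def sum_distrib_left)
  also have "\<dots> = (\<Sum>k<n. \<Sum>l<rank F 0. aug F l * (c k l * v k))"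
    by (rule sum.swap)
  finally show ?thesis
    by (simp add: augment_def sum_distrib_right mult.assoc)
qed

lemma augment_add: "augment F (v + w) = augment F v + augment F w"
  by (simp add: augment_def distrib_left sum.distrib)

lemma augment_diff: "augment F (v - w) = augment F v - augment F w"
  by (simp add: augment_def right_diff_distrib sum_subtractf)

context
  fixes V :: "'v set" and E and F :: "('v, 'k::field) free_complex"
  assumes res: "sqfree_res V E F"
begin

lemma res_dcol_component: "k < rank F (Suc i) \<Longrightarrow> dcol F i k \<in> component V F i (shift F (Suc i) k)"
  using res by (simp add: graded_free_resolution_def component_def vectors_def dcol_def)

lemma res_dcol_vectors: "k < rank F (Suc i) \<Longrightarrow> dcol F i k \<in> vectors F i (polys V)"
  using res_dcol_component component_vectors by blast

lemma res_aug: "k < rank F 0 \<Longrightarrow> aug F k \<in> polys V \<and> homogeneous (shift F 0 k) (aug F k)"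
  using res by (simp add: graded_free_resolution_def)

lemma res_augment_polys: "v \<in> vectors F 0 (polys V) \<Longrightarrow> augment F v \<in> polys V"
  unfolding augment_def by (intro polys_sum polys_mult) (auto simp: res_aug vectors_def)

lemma res_diff_vectors: "v \<in> vectors F (Suc i) (polys V) \<Longrightarrow> diff F i v \<in> vectors F i (polys V)"
  unfolding diff_eq_lin by (intro lin_vectors res_dcol_vectors) (auto simp: vectors_def)

lemma res_diff_irrelevant:
  "v \<in> vectors F (Suc i) (irrelevant V) \<Longrightarrow> diff F i v \<in> vectors F i (irrelevant V)"
  unfolding diff_eq_lin by (intro lin_vectors_irrelevant res_dcol_vectors) (auto simp: vectors_def)

lemma res_diff_component: "v \<in> component V F (Suc i) j \<Longrightarrow> diff F i v \<in> component V F i j"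
  unfolding diff_eq_lin using lin_component[of F "Suc i" "dcol F i" V F i 0 v j]
  by (simp add: res_dcol_component)

lemma res_exact_0:
  "v \<in> vectors F 0 (polys V) \<Longrightarrow>
    augment F v \<in> sqfree_ideal V E \<longleftrightarrow> v \<in> diff F 0 ` vectors F 1 (polys V)"
  using res by (simp add: graded_free_resolution_def)

lemma res_exact:
  "v \<in> vectors F (Suc i) (polys V) \<Longrightarrow>
    diff F i v = 0 \<longleftrightarrow> v \<in> diff F (Suc i) ` vectors F (Suc (Suc i)) (polys V)"
  using res by (simp add: graded_free_resolution_def)

lemma res_diff_diff:
  "v \<in> vectors F (Suc (Suc i)) (polys V) \<Longrightarrow> diff F i (diff F (Suc i) v) = 0"
  using res_exact[of "diff F (Suc i) v" i] res_diff_vectors[of v "Suc i"] by blast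

lemma res_surj:
  assumes "p \<in> polys V" obtains v where "v \<in> vectors F 0 (polys V)" "p - augment F v \<in> sqfree_ideal V E"
proof -
  have "\<exists>v\<in>vectors F 0 (polys V). p - augment F v \<in> sqfree_ideal V E"
    using res assms by (simp add: graded_free_resolution_def)
  then show thesis using that by blast
qed

text \<open>Exactness in \<open>graded_free_resolution\<close> yields preimages without control of
  degrees. As the maps have degree 0, taking the homogeneous part of the right degree in each
  coordinate gives a preimage of the homogeneous element; \<open>res_lift_component\<close> does the
  same for the differentials.\<close>

lemma res_surj_component:
  assumes p: "p \<in> polys V" "homogeneous j p"
  obtains v where "v \<in> component V F 0 j" "p - augment F v \<in> sqfree_ideal V E"
proof -
  obtain w where w: "w \<in> vectors F 0 (polys V)" "p - augment F w \<in> sqfree_ideal V E"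
    using p(1) by (rule res_surj)
  let ?v = "\<lambda>k. hom_part (j - shift F 0 k) (w k)"
  show thesis
  proof (rule that)
    show "?v \<in> component V F 0 j"
      using w(1) by (auto simp: component_def vectors_def hom_part_polys homogeneous_hom_part
          hom_part_eq_self)
    have "aug F k * hom_part (j - shift F 0 k) (w k) = hom_part j (aug F k * w k)"
      if "k < rank F 0" for k
      using res_aug[OF that] by (intro hom_part_mult[symmetric]) simp
    then have "augment F ?v = hom_part j (augment F w)"
      unfolding augment_def hom_part_sum by (intro sum.cong) auto
    then have "p - augment F ?v = hom_part j (p - augment F w)"
      by (simp add: hom_part_diff hom_part_eq_self[OF p(2)])
    then show "p - augment F ?v \<in> sqfree_ideal V E"
      using w(2) by (simp add: sqfree_ideal_hom_part)
  qed
qed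

lemma res_lift_component:
  assumes v: "v \<in> component V F i j" "v \<in> diff F i ` vectors F (Suc i) (polys V)"
  obtains w where "w \<in> component V F (Suc i) j" "diff F i w = v"
proof -
  obtain w where w: "w \<in> vectors F (Suc i) (polys V)" "v = diff F i w"
    using v(2) by blast
  let ?w = "\<lambda>k. hom_part (j - shift F (Suc i) k) (w k)"
  show thesis
  proof (rule that)
    show "?w \<in> component V F (Suc i) j"
      using w(1) by (auto simp: component_def vectors_def hom_part_polys homogeneous_hom_part
          hom_part_eq_self)
    have "diff F i ?w l = v l" for l
    proof (cases "l < rank F i")
      case True
      have "mat F i l k * hom_part (j - shift F (Suc i) k) (w k)
          = hom_part (j - shift F i l) (mat F i l k * w k)" if "k < rank F (Suc i)" for k
        using res True that
        by (subst hom_part_mult[of "shift F (Suc i) k - shift F i l"])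
          (auto simp: graded_free_resolution_def)
      then have "diff F i ?w l = hom_part (j - shift F i l) (diff F i w l)"
        using True by (simp add: diff_def hom_part_sum)
      then show ?thesis
        using v(1) w(2) True by (simp add: component_def hom_part_eq_self)
    qed (simp add: w(2) diff_def)
    then show "diff F i ?w = v" by blast
  qed
qed

end

text \<open>Comparison theorem, lifting multiplication by \<open>f\<close> between the two quotient
  rings. It is applied with \<open>f = 1\<close> to compare resolutions of the same ring, and with a
  squarefree monomial to obtain the map whose cone is taken.\<close>

lemma chain_map_exists:
  fixes F G :: "('v, 'k::field) free_complex"
  assumes F: "sqfree_res V D F" and G: "sqfree_res V E G"
    and f: "f \<in> polys V" "homogeneous d f"
    and mult: "\<And>p. p \<in> sqfree_ideal V D \<Longrightarrow> f * p \<in> sqfree_ideal V E"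
  obtains c where
    "\<And>i k. k < rank F i \<Longrightarrow> c i k \<in> component V G i (shift F i k + d)"
    "\<And>v. v \<in> vectors F 0 (polys V) \<Longrightarrow>
      f * augment F v - augment G (lin (rank F 0) (c 0) v) \<in> sqfree_ideal V E"
    "\<And>i v. diff G i (lin (rank F (Suc i)) (c (Suc i)) v) = lin (rank F i) (c i) (diff F i v)"
proof -
  \<comment> \<open>The clause on \<open>z\<close> says that boundaries of \<open>F\<close> go to
    boundaries of \<open>G\<close>, which is exactly what lifting the next columns requires. It
    hides whether exactness at position 0 or at a later position was used, so one induction step
    serves all \<open>i\<close>.\<close>
  define P where "P i c \<longleftrightarrow> (\<forall>k<rank F i. c k \<in> component V G i (shift F i k + d)) \<and>
      (\<forall>z\<in>vectors F (Suc i) (polys V).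
        lin (rank F i) c (diff F i z) \<in> diff G i ` vectors G (Suc i) (polys V))
      \<and> (i = 0 \<longrightarrow> (\<forall>k<rank F 0. f * aug F k - augment G (c k) \<in> sqfree_ideal V E))"
    for i and c :: "nat \<Rightarrow> nat \<Rightarrow> ('v, 'k) mpoly"
  define Q where "Q i c c' \<longleftrightarrow> (\<forall>k<rank F (Suc i). diff G i (c' k) = lin (rank F i) c (dcol F i k))"
    for i and c c' :: "nat \<Rightarrow> nat \<Rightarrow> ('v, 'k) mpoly"
  have vec: "lin (rank F i) c v \<in> vectors G i (polys V)"
    if "P i c" "v \<in> vectors F i (polys V)" for i c v
    using that by (intro lin_vectors) (auto simp: P_def component_def vectors_def)
  have aug: "f * augment F v - augment G (lin (rank F 0) c v) \<in> sqfree_ideal V E"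
    if "\<And>k. k < rank F 0 \<Longrightarrow> f * aug F k - augment G (c k) \<in> sqfree_ideal V E"
      "v \<in> vectors F 0 (polys V)" for c v
  proof -
    have "f * augment F v - augment G (lin (rank F 0) c v)
        = (\<Sum>k<rank F 0. (f * aug F k - augment G (c k)) * v k)"
      unfolding augment_lin
      by (simp add: augment_def[of F] sum_distrib_left left_diff_distrib sum_subtractf mult.assoc)
    also have "\<dots> \<in> sqfree_ideal V E"
      using that by (intro sqfree_ideal_sum sqfree_ideal_mult) (auto simp: vectors_def)
    finally show ?thesis .
  qed
  have "\<exists>c. P 0 c"
  proof -
    have "\<exists>v. v \<in> component V G 0 (shift F 0 k + d) \<and> f * aug F k - augment G v \<in> sqfree_ideal V E"
      if "k < rank F 0" for k
      using res_surj_component[OF G, of "f * aug F k" "shift F 0 k + d"] res_aug[OF F that] f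
      by (metis add.commute homogeneous_mult polys_mult)
    then obtain c where c: "c k \<in> component V G 0 (shift F 0 k + d)"
        "f * aug F k - augment G (c k) \<in> sqfree_ideal V E" if "k < rank F 0" for k
      by metis
    have "lin (rank F 0) c (diff F 0 z) \<in> diff G 0 ` vectors G (Suc 0) (polys V)"
      if z: "z \<in> vectors F (Suc 0) (polys V)" for z
    proof -
      have dz: "diff F 0 z \<in> vectors F 0 (polys V)"
        using res_diff_vectors[OF F z] .
      then have "augment F (diff F 0 z) \<in> sqfree_ideal V D"
        using res_exact_0[OF F dz] z by auto
      then have "f * augment F (diff F 0 z) \<in> sqfree_ideal V E"
        by (rule mult)
      then have "augment G (lin (rank F 0) c (diff F 0 z)) \<in> sqfree_ideal V E"
        using aug[OF c(2) dz] sqfree_ideal_diff by fastforce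
      moreover have "lin (rank F 0) c (diff F 0 z) \<in> vectors G 0 (polys V)"
        using c(1) dz by (intro lin_vectors) (auto simp: component_def vectors_def)
      ultimately show ?thesis
        using res_exact_0[OF G] by simp
    qed
    then show ?thesis
      using c unfolding P_def by blast
  qed
  moreover have "\<exists>c'. P (Suc i) c' \<and> Q i c c'" if "P i c" for i c
  proof -
    have "\<exists>w. w \<in> component V G (Suc i) (shift F (Suc i) k + d) \<and>
        diff G i w = lin (rank F i) c (dcol F i k)" if k: "k < rank F (Suc i)" for k
    proof -
      have "lin (rank F i) c (dcol F i k) \<in> component V G i (shift F (Suc i) k + d)"
        using \<open>P i c\<close> unfolding P_def
        by (intro lin_component res_dcol_component[OF F k]) auto
      moreover have "diff F i (unit_vec k) = dcol F i k"
        using k by (simp add: diff_eq_lin lin_unit_vec)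
      then have "lin (rank F i) c (dcol F i k) \<in> diff G i ` vectors G (Suc i) (polys V)"
        using \<open>P i c\<close> unit_vec_vectors[OF k, of V] unfolding P_def by metis
      ultimately show ?thesis
        using res_lift_component[OF G] by metis
    qed
    then obtain c' where c': "c' k \<in> component V G (Suc i) (shift F (Suc i) k + d)"
        "diff G i (c' k) = lin (rank F i) c (dcol F i k)" if "k < rank F (Suc i)" for k
      by metis
    have "lin (rank F (Suc i)) c' (diff F (Suc i) z)
        \<in> diff G (Suc i) ` vectors G (Suc (Suc i)) (polys V)"
      if z: "z \<in> vectors F (Suc (Suc i)) (polys V)" for z
    proof -
      let ?y = "diff F (Suc i) z"
      have "diff G i (lin (rank F (Suc i)) c' ?y)
          = lin (rank F (Suc i)) (\<lambda>k. lin (rank F i) c (dcol F i k)) ?y"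
        unfolding diff_eq_lin[of G] lin_lin using c'(2)
        by (intro lin_cong) (simp add: diff_eq_lin)
      also have "\<dots> = lin (rank F i) c (diff F i ?y)"
        by (simp add: diff_eq_lin lin_lin)
      also have "\<dots> = 0"
        by (simp add: res_diff_diff[OF F z])
      finally have "diff G i (lin (rank F (Suc i)) c' ?y) = 0" .
      moreover have "lin (rank F (Suc i)) c' ?y \<in> vectors G (Suc i) (polys V)"
        using c'(1) res_diff_vectors[OF F z]
        by (intro lin_vectors) (auto simp: component_def vectors_def)
      ultimately show ?thesis
        using res_exact[OF G] by simp
    qed
    then show ?thesis
      using c' unfolding P_def Q_def by blast
  qed
  ultimately obtain c where c: "\<And>i. P i (c i)" "\<And>i. Q i (c i) (c (Suc i))"
    using dependent_nat_choice[of P Q] by metis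
  show thesis
  proof (rule that[of c])
    show "c i k \<in> component V G i (shift F i k + d)" if "k < rank F i" for i k
      using c(1)[of i] that by (simp add: P_def)
    show "f * augment F v - augment G (lin (rank F 0) (c 0) v) \<in> sqfree_ideal V E"
      if "v \<in> vectors F 0 (polys V)" for v
      using c(1)[of 0] that by (intro aug) (auto simp: P_def)
    show "diff G i (lin (rank F (Suc i)) (c (Suc i)) v) = lin (rank F i) (c i) (diff F i v)" for i v
    proof -
      have "diff G i (lin (rank F (Suc i)) (c (Suc i)) v)
          = lin (rank F (Suc i)) (\<lambda>k. lin (rank F i) (c i) (dcol F i k)) v"
        unfolding diff_eq_lin[of G] lin_lin using c(2)[of i]
        by (intro lin_cong) (simp add: diff_eq_lin Q_def)
      then show ?thesis
        by (simp add: diff_eq_lin lin_lin)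
    qed
  qed
qed

text \<open>The chain map \<open>t\<close> lifts the zero map of the quotient ring, hence is
  homotopic to zero. The homotopy carries no degrees because \<open>tor_boundaries\<close> asks for
  none in its witness \<open>w\<close>.\<close>

lemma null_homotopy_exists:
  fixes G :: "('v, 'k::field) free_complex"
  assumes G: "sqfree_res V E G"
    and t: "\<And>i k. k < rank G i \<Longrightarrow> t i k \<in> vectors G i (polys V)"
    and t0: "\<And>k. k < rank G 0 \<Longrightarrow> augment G (t 0 k) \<in> sqfree_ideal V E"
    and comm: "\<And>i v. v \<in> vectors G (Suc i) (polys V) \<Longrightarrow>
      diff G i (lin (rank G (Suc i)) (t (Suc i)) v) = lin (rank G i) (t i) (diff G i v)"
  obtains h where
    "\<And>i k. k < rank G i \<Longrightarrow> h i k \<in> vectors G (Suc i) (polys V)"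
    "\<And>v. lin (rank G 0) (t 0) v = diff G 0 (lin (rank G 0) (h 0) v)"
    "\<And>i v. lin (rank G (Suc i)) (t (Suc i)) v =
      diff G (Suc i) (lin (rank G (Suc i)) (h (Suc i)) v) + lin (rank G i) (h i) (diff G i v)"
proof -
  \<comment> \<open>Again the invariant states the liftability needed next: \<open>t\<close> minus
    the part already explained by \<open>h\<close> lands in the boundaries.\<close>
  define P where "P i h \<longleftrightarrow> (\<forall>k<rank G i. h k \<in> vectors G (Suc i) (polys V)) \<and>
      (\<forall>z\<in>vectors G (Suc i) (polys V). lin (rank G (Suc i)) (t (Suc i)) z - lin (rank G i) h (diff G i z)
         \<in> diff G (Suc i) ` vectors G (Suc (Suc i)) (polys V)) \<and>
      (i = 0 \<longrightarrow> (\<forall>k<rank G 0. t 0 k = diff G 0 (h k)))"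
    for i and h :: "nat \<Rightarrow> nat \<Rightarrow> ('v, 'k) mpoly"
  define Q where "Q i h h' \<longleftrightarrow> (\<forall>k<rank G (Suc i).
      t (Suc i) k - lin (rank G i) h (dcol G i k) = diff G (Suc i) (h' k))"
    for i and h h' :: "nat \<Rightarrow> nat \<Rightarrow> ('v, 'k) mpoly"
  have tvec: "lin (rank G i) (t i) v \<in> vectors G i (polys V)" if "v \<in> vectors G i (polys V)" for i v
    using that t by (intro lin_vectors) (auto simp: vectors_def)
  have hvec: "lin (rank G i) h v \<in> vectors G (Suc i) (polys V)"
    if "\<And>k. k < rank G i \<Longrightarrow> h k \<in> vectors G (Suc i) (polys V)" "v \<in> vectors G i (polys V)" for i h v
    using that by (intro lin_vectors) (auto simp: vectors_def)
  have "\<exists>h. P 0 h"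
  proof -
    have "\<exists>w. w \<in> vectors G 1 (polys V) \<and> t 0 k = diff G 0 w" if k: "k < rank G 0" for k
      using res_exact_0[OF G t[OF k]] t0[OF k] by blast
    then obtain h where h: "h k \<in> vectors G 1 (polys V)" "t 0 k = diff G 0 (h k)"
      if "k < rank G 0" for k
      by metis
    have "lin (rank G (Suc 0)) (t (Suc 0)) z - lin (rank G 0) h (diff G 0 z)
        \<in> diff G (Suc 0) ` vectors G (Suc (Suc 0)) (polys V)"
      if z: "z \<in> vectors G (Suc 0) (polys V)" for z
    proof -
      have dz: "diff G 0 z \<in> vectors G 0 (polys V)"
        using res_diff_vectors[OF G z] .
      have "diff G 0 (lin (rank G 0) h (diff G 0 z)) = lin (rank G 0) (t 0) (diff G 0 z)"
        unfolding diff_eq_lin[of G 0] lin_lin using h(2) by (intro lin_cong) (simp add: diff_eq_lin)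
      then have "diff G 0 (lin (rank G (Suc 0)) (t (Suc 0)) z - lin (rank G 0) h (diff G 0 z)) = 0"
        using comm[OF z] by (simp add: diff_minus)
      moreover have "lin (rank G (Suc 0)) (t (Suc 0)) z - lin (rank G 0) h (diff G 0 z)
          \<in> vectors G (Suc 0) (polys V)"
        using h(1) dz by (intro vectors_diff tvec z hvec) auto
      ultimately show ?thesis
        using res_exact[OF G] by simp
    qed
    then show ?thesis
      using h unfolding P_def by (intro exI[of _ h]) auto
  qed
  moreover have "\<exists>h'. P (Suc i) h' \<and> Q i h h'" if "P i h" for i h
  proof -
    have "\<exists>w. w \<in> vectors G (Suc (Suc i)) (polys V) \<and>
        t (Suc i) k - lin (rank G i) h (dcol G i k) = diff G (Suc i) w" if k: "k < rank G (Suc i)" for k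
    proof -
      have "diff G i (unit_vec k) = dcol G i k"
        using k by (simp add: diff_eq_lin lin_unit_vec)
      moreover have "lin (rank G (Suc i)) (t (Suc i)) (unit_vec k) = t (Suc i) k"
        using k by (simp add: lin_unit_vec)
      ultimately have "t (Suc i) k - lin (rank G i) h (dcol G i k)
          \<in> diff G (Suc i) ` vectors G (Suc (Suc i)) (polys V)"
        using \<open>P i h\<close> unit_vec_vectors[OF k, of V] unfolding P_def by metis
      then show ?thesis by blast
    qed
    then obtain h' where h': "h' k \<in> vectors G (Suc (Suc i)) (polys V)"
        "t (Suc i) k - lin (rank G i) h (dcol G i k) = diff G (Suc i) (h' k)"
      if "k < rank G (Suc i)" for k
      by metis
    have "lin (rank G (Suc (Suc i))) (t (Suc (Suc i))) z - lin (rank G (Suc i)) h' (diff G (Suc i) z)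
        \<in> diff G (Suc (Suc i)) ` vectors G (Suc (Suc (Suc i))) (polys V)"
      if z: "z \<in> vectors G (Suc (Suc i)) (polys V)" for z
    proof -
      let ?y = "diff G (Suc i) z"
      have y: "?y \<in> vectors G (Suc i) (polys V)"
        using res_diff_vectors[OF G z] .
      have "diff G (Suc i) (lin (rank G (Suc i)) h' ?y)
          = lin (rank G (Suc i)) (\<lambda>k. t (Suc i) k - lin (rank G i) h (dcol G i k)) ?y"
        unfolding diff_eq_lin[of G "Suc i"] lin_lin using h'(2)
        by (intro lin_cong) (simp add: diff_eq_lin)
      also have "\<dots> = lin (rank G (Suc i)) (t (Suc i)) ?y - lin (rank G i) h (diff G i ?y)"
        by (simp add: lin_diff_cols lin_lin diff_eq_lin)
      also have "\<dots> = lin (rank G (Suc i)) (t (Suc i)) ?y"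
        by (simp add: res_diff_diff[OF G z])
      finally have "diff G (Suc i) (lin (rank G (Suc (Suc i))) (t (Suc (Suc i))) z
          - lin (rank G (Suc i)) h' ?y) = 0"
        using comm[OF z] by (simp add: diff_minus)
      moreover have "lin (rank G (Suc (Suc i))) (t (Suc (Suc i))) z - lin (rank G (Suc i)) h' ?y
          \<in> vectors G (Suc (Suc i)) (polys V)"
        using h'(1) y by (intro vectors_diff tvec z hvec) auto
      ultimately show ?thesis
        using res_exact[OF G] by simp
    qed
    then show ?thesis
      using h' unfolding P_def Q_def by blast
  qed
  ultimately obtain h where h: "\<And>i. P i (h i)" "\<And>i. Q i (h i) (h (Suc i))"
    using dependent_nat_choice[of P Q] by metis
  show thesis
  proof (rule that[of h])
    show "h i k \<in> vectors G (Suc i) (polys V)" if "k < rank G i" for i k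
      using h(1)[of i] that by (simp add: P_def)
    show "lin (rank G 0) (t 0) v = diff G 0 (lin (rank G 0) (h 0) v)" for v
      unfolding diff_eq_lin[of G 0] lin_lin using h(1)[of 0]
      by (intro lin_cong) (simp add: diff_eq_lin P_def)
    show "lin (rank G (Suc i)) (t (Suc i)) v =
        diff G (Suc i) (lin (rank G (Suc i)) (h (Suc i)) v) + lin (rank G i) (h i) (diff G i v)" for i v
    proof -
      have "diff G (Suc i) (lin (rank G (Suc i)) (h (Suc i)) v)
          = lin (rank G (Suc i)) (\<lambda>k. t (Suc i) k - lin (rank G i) (h i) (dcol G i k)) v"
        unfolding diff_eq_lin[of G "Suc i"] lin_lin using h(2)[of i]
        by (intro lin_cong) (simp add: diff_eq_lin Q_def)
      then show ?thesis
        by (simp add: diff_eq_lin lin_lin lin_diff_cols)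
    qed
  qed
qed

section \<open>Independence of Tor from the resolution\<close>

text \<open>With comparison maps \<open>g\<close> from \<open>G\<close> to \<open>F\<close> and
  \<open>f\<close> back, a cycle \<open>v\<close> goes to a cycle of \<open>F\<close>, which is a
  boundary by \<open>sub\<close>, and \<open>f\<close> brings it back to a boundary. The difference
  between \<open>v\<close> and its image under both maps is absorbed by a homotopy.\<close>

lemma tor_cycles_subset_boundaries_transfer:
  fixes F G :: "('v, 'k::field) free_complex"
  assumes F: "sqfree_res V E F" and G: "sqfree_res V E G"
    and sub: "tor_cycles V F i j \<subseteq> tor_boundaries V F i j"
  shows "tor_cycles V G i j \<subseteq> tor_boundaries V G i j"
proof
  fix v assume v: "v \<in> tor_cycles V G i j"
  obtain f where f: "\<And>i k. k < rank F i \<Longrightarrow> f i k \<in> component V G i (shift F i k + 0)"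
    "\<And>v. v \<in> vectors F 0 (polys V) \<Longrightarrow>
      1 * augment F v - augment G (lin (rank F 0) (f 0) v) \<in> sqfree_ideal V E"
    "\<And>i v. diff G i (lin (rank F (Suc i)) (f (Suc i)) v) = lin (rank F i) (f i) (diff F i v)"
    by (rule chain_map_exists[OF F G, of 1 0]) auto
  obtain g where g: "\<And>i k. k < rank G i \<Longrightarrow> g i k \<in> component V F i (shift G i k + 0)"
    "\<And>v. v \<in> vectors G 0 (polys V) \<Longrightarrow>
      1 * augment G v - augment F (lin (rank G 0) (g 0) v) \<in> sqfree_ideal V E"
    "\<And>i v. diff F i (lin (rank G (Suc i)) (g (Suc i)) v) = lin (rank G i) (g i) (diff G i v)"
    by (rule chain_map_exists[OF G F, of 1 0]) auto
  have fvec: "lin (rank F i) (f i) w \<in> vectors G i (polys V)" if "w \<in> vectors F i (polys V)" for i w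
    using that f(1) by (intro lin_vectors) (auto simp: component_def vectors_def)
  have gvec: "lin (rank G i) (g i) w \<in> vectors F i (polys V)" if "w \<in> vectors G i (polys V)" for i w
    using that g(1) by (intro lin_vectors) (auto simp: component_def vectors_def)
  \<comment> \<open>The defect of \<open>f\<close> after \<open>g\<close> from being the identity;
    it lifts the zero map.\<close>
  define t where "t i k = lin (rank F i) (f i) (g i k) - unit_vec k" for i k
  have lin_t: "lin (rank G i) (t i) w = lin (rank F i) (f i) (lin (rank G i) (g i) w) - w"
    if "w \<in> vectors G i (polys V)" for i w
    using that unfolding t_def lin_diff_cols by (simp add: lin_lin lin_unit_cols)
  have tv: "t i k \<in> vectors G i (polys V)" if "k < rank G i" for i k
    unfolding t_def using that component_vectors[OF g(1)[OF that]]
    by (intro vectors_diff fvec unit_vec_vectors)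
  have t0: "augment G (t 0 k) \<in> sqfree_ideal V E" if k: "k < rank G 0" for k
  proof -
    have u: "unit_vec k \<in> vectors G 0 (polys V)"
      by (rule unit_vec_vectors[OF k])
    have "augment G (unit_vec k) - augment F (g 0 k) \<in> sqfree_ideal V E"
      using g(2)[OF u] by (simp add: lin_unit_vec[OF k])
    moreover have "augment F (g 0 k) - augment G (lin (rank F 0) (f 0) (g 0 k)) \<in> sqfree_ideal V E"
      using f(2)[OF component_vectors[OF g(1)[OF k]]] by simp
    ultimately have "- ((augment G (unit_vec k) - augment F (g 0 k)) +
        (augment F (g 0 k) - augment G (lin (rank F 0) (f 0) (g 0 k)))) \<in> sqfree_ideal V E"
      by (intro sqfree_ideal_uminus sqfree_ideal_add)
    then show ?thesis
      by (simp add: t_def augment_diff)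
  qed
  have comm: "diff G i (lin (rank G (Suc i)) (t (Suc i)) w) = lin (rank G i) (t i) (diff G i w)"
    if w: "w \<in> vectors G (Suc i) (polys V)" for i w
    unfolding lin_t[OF w] lin_t[OF res_diff_vectors[OF G w]]
    by (simp add: diff_minus f(3) g(3))
  obtain h where h: "\<And>i k. k < rank G i \<Longrightarrow> h i k \<in> vectors G (Suc i) (polys V)"
    "\<And>v. lin (rank G 0) (t 0) v = diff G 0 (lin (rank G 0) (h 0) v)"
    "\<And>i v. lin (rank G (Suc i)) (t (Suc i)) v =
      diff G (Suc i) (lin (rank G (Suc i)) (h (Suc i)) v) + lin (rank G i) (h i) (diff G i v)"
    by (rule null_homotopy_exists[OF G, of t]) (erule tv, erule t0, erule comm, rule that)
  have hvec: "lin (rank G i) (h i) w \<in> vectors G (Suc i) (polys V)"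
    if "w \<in> vectors G i (polys V)" for i w
    using that h(1) by (intro lin_vectors) (auto simp: vectors_def)
  have vc: "v \<in> component V G i j"
    using v by (simp add: tor_cycles_def)
  note vv = component_vectors[OF vc]
  let ?gv = "lin (rank G i) (g i) v"
  have "?gv \<in> tor_cycles V F i j"
  proof -
    have "?gv \<in> component V F i j"
      using lin_component[of G i "g i" V F i 0 v j] g(1) vc by simp
    moreover have "diff F (i - 1) ?gv \<in> vectors F (i - 1) (irrelevant V)" if i0: "i \<noteq> 0"
    proof -
      obtain i' where i': "i = Suc i'"
        using i0 not0_implies_Suc by blast
      have "diff G i' v \<in> vectors G i' (irrelevant V)"
        using v i0 by (simp add: tor_cycles_def i')
      then have "lin (rank G i') (g i') (diff G i' v) \<in> vectors F i' (irrelevant V)"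
        using g(1) by (intro lin_vectors_irrelevant) (auto simp: component_def vectors_def)
      then show ?thesis
        using g(3)[of i' v] by (simp add: i')
    qed
    ultimately show ?thesis
      by (auto simp: tor_cycles_def)
  qed
  then obtain w u where w: "w \<in> vectors F (Suc i) (polys V)" and u: "u \<in> vectors F i (irrelevant V)"
    and gv: "?gv = diff F i w + u"
    using sub unfolding tor_boundaries_def by blast
  have fu: "lin (rank F i) (f i) u \<in> vectors G i (irrelevant V)"
    using u f(1) by (intro lin_vectors_irrelevant) (auto simp: component_def vectors_def)
  \<comment> \<open>This is \<open>v = f (g v) - t v\<close> with \<open>g v\<close> replaced by a
    boundary plus \<open>u\<close>.\<close>
  have v_eq: "v = diff G i (lin (rank F (Suc i)) (f (Suc i)) w) + lin (rank F i) (f i) u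
      - lin (rank G i) (t i) v"
    unfolding lin_t[OF vv] gv lin_add by (simp add: f(3))
  let ?w = "lin (rank F (Suc i)) (f (Suc i)) w - lin (rank G i) (h i) v"
  have w': "?w \<in> vectors G (Suc i) (polys V)"
    using w vv by (intro vectors_diff fvec hvec)
  have "\<exists>u\<in>vectors G i (irrelevant V). v = diff G i ?w + u"
  proof (cases i)
    case 0
    have "v = diff G i ?w + lin (rank F i) (f i) u"
      by (rule trans[OF v_eq]) (simp add: 0 h(2) diff_minus)
    then show ?thesis
      using fu by blast
  next
    case (Suc i')
    \<comment> \<open>The homotopy contributes a boundary, moved into \<open>?w\<close>, and
      \<open>h\<close> applied to the differential of \<open>v\<close>. The latter has coefficients
      in the irrelevant ideal because \<open>v\<close> is a cycle modulo that ideal.\<close>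
    let ?u = "lin (rank F i) (f i) u - lin (rank G i') (h i') (diff G i' v)"
    have "diff G i' v \<in> vectors G i' (irrelevant V)"
      using v by (simp add: tor_cycles_def Suc)
    then have "lin (rank G i') (h i') (diff G i' v) \<in> vectors G i (irrelevant V)"
      unfolding Suc using h(1) by (intro lin_vectors_irrelevant) (auto simp: vectors_def)
    then have "?u \<in> vectors G i (irrelevant V)"
      using fu by (intro vectors_irrelevant_diff)
    moreover have "v = diff G i ?w + ?u"
      by (rule trans[OF v_eq]) (simp add: Suc h(3) diff_minus)
    ultimately show ?thesis by blast
  qed
  then show "v \<in> tor_boundaries V G i j"
    using vc w' by (auto simp: tor_boundaries_def)
qed

section \<open>Betti numbers and regularity from one resolution\<close>

text \<open>A point of \<open>B\<close> outside the subspace \<open>A\<close> is outside the span of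
  a basis of \<open>A\<close>, so that basis can be enlarged within \<open>B\<close>.
  \<open>B\<close> may be any set contained in a finitely generated span, so it can be instantiated
  with the cycles directly.\<close>

lemma (in vector_space) dim_less:
  assumes A: "subspace A" "A \<subset> B" and B: "B \<subseteq> span S" "finite S"
  shows "dim A < dim B"
proof -
  obtain X where X: "X \<subseteq> A" "independent X" "A \<subseteq> span X" "card X = dim A"
    using basis_exists by blast
  have "finite X"
    using independent_span_bound[OF B(2) X(2)] X(1) A(2) B(1) by blast
  obtain x where x: "x \<in> B" "x \<notin> A"
    using A(2) by blast
  have "span X \<subseteq> A"
    using X(1) A(1) by (simp add: span_minimal)
  then have x': "x \<notin> span X"
    using x by blast
  then have "independent (insert x X)"
    using X(2) by (simp add: independent_insertI)
  moreover have "insert x X \<subseteq> B"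
    using X(1) A(2) x by blast
  ultimately obtain Y where Y: "insert x X \<subseteq> Y" "Y \<subseteq> B" "independent Y" "B \<subseteq> span Y"
    using maximal_independent_subset_extend by blast
  have "finite Y"
    using independent_span_bound[OF B(2) Y(3)] Y(2) B(1) by blast
  then have "card (insert x X) \<le> card Y"
    using Y(1) card_mono by blast
  moreover have "x \<notin> X"
    using x' span_base by blast
  then have "card (insert x X) = Suc (dim A)"
    using \<open>finite X\<close> X(4) by simp
  moreover have "card Y = dim B"
    using basis_card_eq_dim[OF Y(2,4,3)] .
  ultimately show ?thesis by linarith
qed

section \<open>Linear structure and finite dimension of the graded pieces\<close>

lemma const_polys [simp]: "const c \<in> polys V"
  by (simp add: const_def polys_def)

lemma homogeneous_const: "homogeneous 0 (const c)"
  by (simp add: const_def homogeneous_def)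

lemma diff_vscale: "diff F i (vscale c v) = vscale c (diff F i v)"
  by (simp add: diff_def vscale_def fun_eq_iff sum_distrib_left mult.left_commute)

lemma vectors_vscale: "v \<in> vectors F i (polys V) \<Longrightarrow> vscale c v \<in> vectors F i (polys V)"
  by (simp add: vectors_def vscale_def polys_mult)

lemma vectors_irrelevant_vscale:
  "v \<in> vectors F i (irrelevant V) \<Longrightarrow> vscale c v \<in> vectors F i (irrelevant V)"
  by (simp add: vectors_def vscale_def irrelevant_mult)

lemma component_vscale: "v \<in> component V F i j \<Longrightarrow> vscale c v \<in> component V F i j"
  unfolding component_def
  using homogeneous_mult[OF homogeneous_const, of "j - shift F i _" "v _" "j - shift F i _" c]
  by (auto simp: vectors_vscale) (auto simp: vscale_def)

lemma component_add:
  "v \<in> component V F i j \<Longrightarrow> w \<in> component V F i j \<Longrightarrow> v + w \<in> component V F i j"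
  by (simp add: component_def vectors_add homogeneous_add)

lemma component_0: "0 \<in> component V F i j"
  by (simp add: component_def vectors_0)

lemma vectors_irrelevant_add:
  "v \<in> vectors F i (irrelevant V) \<Longrightarrow> w \<in> vectors F i (irrelevant V) \<Longrightarrow>
    v + w \<in> vectors F i (irrelevant V)"
  by (simp add: vectors_def irrelevant_add)

lemma subspace_tor_boundaries:
  fixes F :: "('v, 'k::field) free_complex"
  shows "module.subspace vscale (tor_boundaries V F i j)"
proof -
  interpret vector_space "vscale :: 'k \<Rightarrow> (nat \<Rightarrow> ('v, 'k) mpoly) \<Rightarrow> _" by (rule vector_space_vscale)
  show ?thesis
  proof (rule subspaceI)
    have "(0 :: nat \<Rightarrow> ('v, 'k) mpoly) \<in> vectors F i (irrelevant V)"
      by (simp add: vectors_def)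
    moreover have "0 = diff F i 0 + 0"
      by (simp add: diff_eq_lin)
    ultimately show "0 \<in> tor_boundaries V F i j"
      unfolding tor_boundaries_def using component_0 vectors_0 by blast
  next
    fix x y assume "x \<in> tor_boundaries V F i j" "y \<in> tor_boundaries V F i j"
    then obtain w u w' u' where
      *: "w \<in> vectors F (Suc i) (polys V)" "u \<in> vectors F i (irrelevant V)" "x = diff F i w + u"
         "w' \<in> vectors F (Suc i) (polys V)" "u' \<in> vectors F i (irrelevant V)" "y = diff F i w' + u'"
         "x \<in> component V F i j" "y \<in> component V F i j"
      by (auto simp: tor_boundaries_def)
    have "x + y = diff F i (w + w') + (u + u')"
      by (simp add: * diff_plus)
    then show "x + y \<in> tor_boundaries V F i j"
      unfolding tor_boundaries_def
      using component_add[OF *(7,8)] vectors_add[OF *(1,4)] vectors_irrelevant_add[OF *(2,5)] by blast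
  next
    fix c and x assume "x \<in> tor_boundaries V F i j"
    then obtain w u where
      *: "w \<in> vectors F (Suc i) (polys V)" "u \<in> vectors F i (irrelevant V)" "x = diff F i w + u"
         "x \<in> component V F i j"
      by (auto simp: tor_boundaries_def)
    have "vscale c x = diff F i (vscale c w) + vscale c u"
      by (simp add: * diff_vscale scale_right_distrib)
    then show "vscale c x \<in> tor_boundaries V F i j"
      unfolding tor_boundaries_def
      using component_vscale[OF *(4)] vectors_vscale[OF *(1)] vectors_irrelevant_vscale[OF *(2)] by blast
  qed
qed

lemma finite_monomials_of_degree:
  assumes "finite V"
  shows "finite {m :: 'v \<Rightarrow>\<^sub>0 nat. Poly_Mapping.keys m \<subseteq> V \<and> mdeg m = d}"
proof (rule finite_imageD)
  let ?M = "{m :: 'v \<Rightarrow>\<^sub>0 nat. Poly_Mapping.keys m \<subseteq> V \<and> mdeg m = d}"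
  have le: "Poly_Mapping.lookup m x \<le> mdeg m" for m :: "'v \<Rightarrow>\<^sub>0 nat" and x
    unfolding mdeg_def using member_le_sum[of x "Poly_Mapping.keys m" "Poly_Mapping.lookup m"]
    by (cases "x \<in> Poly_Mapping.keys m") (simp_all add: in_keys_iff)
  have "Poly_Mapping.lookup ` ?M \<subseteq> {f. \<forall>x. (x \<in> V \<longrightarrow> f x \<in> {..d}) \<and> (x \<notin> V \<longrightarrow> f x = 0)}"
  proof (intro image_subsetI CollectI allI conjI impI)
    fix m x assume m: "m \<in> ?M"
    show "Poly_Mapping.lookup m x \<in> {..d}"
      using m le[of m x] by simp
    show "Poly_Mapping.lookup m x = 0" if "x \<notin> V"
      using m that by (metis (mono_tags, lifting) in_keys_iff mem_Collect_eq subsetD)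
  qed
  then show "finite (Poly_Mapping.lookup ` ?M)"
    by (rule finite_subset) (rule finite_set_of_finite_funs[OF assms finite_atMost])
  show "inj_on Poly_Mapping.lookup ?M"
    by (intro inj_onI poly_mapping_eqI) (rule fun_cong)
qed

lemma component_finite_dim:
  fixes F :: "('v, 'k::field) free_complex"
  assumes "finite V"
  obtains S where "finite S" "component V F i j \<subseteq> module.span vscale S"
proof -
  interpret vector_space "vscale :: 'k \<Rightarrow> (nat \<Rightarrow> ('v, 'k) mpoly) \<Rightarrow> _" by (rule vector_space_vscale)
  define b :: "nat \<Rightarrow> ('v \<Rightarrow>\<^sub>0 nat) \<Rightarrow> nat \<Rightarrow> ('v, 'k) mpoly"
    where "b k m = (\<lambda>l. if l = k then Poly_Mapping.single m 1 else 0)" for k m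
  \<comment> \<open>For a negative degree \<open>nat\<close> gives 0 and \<open>M k\<close> holds
    the monomial 1. This is harmless: \<open>v k\<close> is then zero and the spanning set has only
    one spare element.\<close>
  define M where "M k = {m :: 'v \<Rightarrow>\<^sub>0 nat. Poly_Mapping.keys m \<subseteq> V \<and> mdeg m = nat (j - shift F i k)}" for k
  define S where "S = (\<Union>k<rank F i. b k ` M k)"
  show thesis
  proof (rule that)
    show "finite S"
      unfolding S_def M_def using finite_monomials_of_degree[OF assms] by blast
    show "component V F i j \<subseteq> span S"
    proof
      fix v assume v: "v \<in> component V F i j"
      have "v = (\<Sum>k<rank F i. \<Sum>m\<in>Poly_Mapping.keys (v k). vscale (Poly_Mapping.lookup (v k) m) (b k m))"
      proof
        fix l
        have *: "(\<Sum>x\<in>X. f x) l = (\<Sum>x\<in>X. f x l)" for f :: "'x \<Rightarrow> nat \<Rightarrow> ('v, 'k) mpoly" and X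
          by (induction X rule: infinite_finite_induct) auto
        have b: "vscale c (b k m) l = (if l = k then Poly_Mapping.single m c else 0)" for c k m
          by (simp add: vscale_def b_def const_def mult_single)
        have "(\<Sum>m\<in>Poly_Mapping.keys (v k). vscale (Poly_Mapping.lookup (v k) m) (b k m) l)
            = (if l = k then v k else 0)" for k
          by (simp add: b sum_single_lookup)
        then show "v l = (\<Sum>k<rank F i. \<Sum>m\<in>Poly_Mapping.keys (v k).
            vscale (Poly_Mapping.lookup (v k) m) (b k m)) l"
          using v by (auto simp: * component_def vectors_def not_less)
      qed
      moreover have "b k m \<in> S" if "k < rank F i" "m \<in> Poly_Mapping.keys (v k)" for k m
        using v that unfolding S_def M_def
        by (fastforce simp: component_def vectors_def polys_def homogeneous_def)
      then have "(\<Sum>k<rank F i. \<Sum>m\<in>Poly_Mapping.keys (v k).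
          vscale (Poly_Mapping.lookup (v k) m) (b k m)) \<in> span S"
        by (intro span_sum span_scale span_base) auto
      ultimately show "v \<in> span S" by metis
    qed
  qed
qed

lemma tor_boundaries_subset_cycles:
  assumes F: "sqfree_res V E F"
  shows "tor_boundaries V F i j \<subseteq> tor_cycles V F i j"
proof
  fix v assume v: "v \<in> tor_boundaries V F i j"
  show "v \<in> tor_cycles V F i j"
  proof (cases i)
    case 0
    then show ?thesis
      using v by (simp add: tor_boundaries_def tor_cycles_def)
  next
    case (Suc i')
    obtain w u where *: "w \<in> vectors F (Suc i) (polys V)" "u \<in> vectors F i (irrelevant V)"
      "v = diff F i w + u"
      using v unfolding tor_boundaries_def by blast
    have "diff F i' v = diff F i' u"
      using res_diff_diff[OF F] *(1) by (simp add: *(3) diff_plus Suc)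
    then show ?thesis
      using v res_diff_irrelevant[OF F, of u i'] *(2)
      by (simp add: tor_boundaries_def tor_cycles_def Suc)
  qed
qed

text \<open>The truncated difference is 0 exactly if the cycles have no larger dimension than the
  boundaries; as boundaries are contained in cycles and everything is finite-dimensional, this means
  equality. The existence of \<open>G\<close> ensures that \<open>SOME\<close> picks a resolution,
  and the transfer lemma, used both ways, replaces it by \<open>G\<close>.\<close>

lemma betti_eq_0_iff:
  fixes G :: "('v, 'k::field) free_complex"
  assumes V: "finite V" and G: "sqfree_res V E G"
  shows "betti V (sqfree_ideal V E :: ('v, 'k) mpoly set) i j = 0 \<longleftrightarrow>
    tor_cycles V G i j \<subseteq> tor_boundaries V G i j"
proof -
  interpret vector_space "vscale :: 'k \<Rightarrow> (nat \<Rightarrow> ('v, 'k) mpoly) \<Rightarrow> _" by (rule vector_space_vscale)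
  define F :: "('v, 'k) free_complex" where "F = (SOME F. sqfree_res V E F)"
  have F: "sqfree_res V E F"
    unfolding F_def using G by (rule someI)
  have b: "betti V (sqfree_ideal V E :: ('v, 'k) mpoly set) i j
      = dim (tor_cycles V F i j) - dim (tor_boundaries V F i j)"
    by (simp add: betti_def F_def Let_def)
  have "betti V (sqfree_ideal V E :: ('v, 'k) mpoly set) i j = 0 \<longleftrightarrow>
      tor_cycles V F i j \<subseteq> tor_boundaries V F i j"
  proof
    assume 0: "betti V (sqfree_ideal V E :: ('v, 'k) mpoly set) i j = 0"
    obtain S where S: "finite S" "component V F i j \<subseteq> span S"
      using component_finite_dim[OF V] by metis
    show "tor_cycles V F i j \<subseteq> tor_boundaries V F i j"
    proof (rule ccontr)
      assume "\<not> ?thesis"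
      then have "tor_boundaries V F i j \<subset> tor_cycles V F i j"
        using tor_boundaries_subset_cycles[OF F] by blast
      moreover have "tor_cycles V F i j \<subseteq> span S"
        using S(2) by (auto simp: tor_cycles_def)
      ultimately have "dim (tor_boundaries V F i j) < dim (tor_cycles V F i j)"
        using subspace_tor_boundaries S(1) by (intro dim_less)
      then show False using 0 b by simp
    qed
  next
    assume "tor_cycles V F i j \<subseteq> tor_boundaries V F i j"
    then have "tor_cycles V F i j = tor_boundaries V F i j"
      using tor_boundaries_subset_cycles[OF F] by blast
    then show "betti V (sqfree_ideal V E :: ('v, 'k) mpoly set) i j = 0"
      using b by simp
  qed
  then show ?thesis
    using tor_cycles_subset_boundaries_transfer[OF F G] tor_cycles_subset_boundaries_transfer[OF G F]
    by blast
qed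

text \<open>Tor in degree \<open>j\<close> vanishes unless a basis element has degree \<open>j\<close>.  A basis element of the
  last module survives, because its boundary has coefficients in the irrelevant ideal by the
  degree bound.\<close>

lemma regularity_eqI:
  fixes G :: "('v, 'k::field) free_complex"
  assumes V: "finite V" and G: "sqfree_res V E G"
    and len: "\<And>i. p < i \<Longrightarrow> rank G i = 0"
    and bound: "\<And>i k. k < rank G i \<Longrightarrow> shift G i k \<le> int i + c"
    and top: "k0 < rank G p" "shift G p k0 = int p + c"
  shows "regularity V (sqfree_ideal V E :: ('v, 'k) mpoly set) = c"
proof -
  let ?b = "betti V (sqfree_ideal V E :: ('v, 'k) mpoly set)"
  have degree: "\<exists>k<rank G i. shift G i k = j" if "?b i j \<noteq> 0" for i j
  proof (rule ccontr)
    assume no: "\<not> ?thesis"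
    have "tor_cycles V G i j \<subseteq> tor_boundaries V G i j"
    proof
      fix v assume "v \<in> tor_cycles V G i j"
      then have v: "v \<in> component V G i j"
        by (simp add: tor_cycles_def)
      have "v k \<in> irrelevant V" if "k < rank G i" for k
        using v that no by (intro homogeneous_irrelevant[of _ _ "j - shift G i k"])
          (auto simp: component_def vectors_def)
      then have "v \<in> vectors G i (irrelevant V)"
        using v by (simp add: component_def vectors_def)
      moreover have "v = diff G i 0 + v"
        by (simp add: diff_eq_lin)
      ultimately show "v \<in> tor_boundaries V G i j"
        unfolding tor_boundaries_def using v vectors_0 by blast
    qed
    then show False
      using that betti_eq_0_iff[OF V G, of i j] by simp
  qed
  have "{j - int i | i j. ?b i j \<noteq> 0} \<subseteq> (\<Union>i\<le>p. \<Union>k<rank G i. {shift G i k - int i})"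
  proof
    fix x assume "x \<in> {j - int i | i j. ?b i j \<noteq> 0}"
    then obtain i j where ij: "x = j - int i" "?b i j \<noteq> 0"
      by blast
    obtain k where k: "k < rank G i" "shift G i k = j"
      using degree[OF ij(2)] by blast
    have "i \<le> p"
      using len[of i] k(1) by (cases "i \<le> p") auto
    then show "x \<in> (\<Union>i\<le>p. \<Union>k<rank G i. {shift G i k - int i})"
      using ij(1) k by blast
  qed
  \<comment> \<open>Finiteness is what gives the \<open>Max\<close> in \<open>regularity\<close> its
    meaning.\<close>
  then have fin: "finite {j - int i | i j. ?b i j \<noteq> 0}"
    by (rule finite_subset) auto
  have "?b p (int p + c) \<noteq> 0"
  proof
    assume "?b p (int p + c) = 0"
    then have sub: "tor_cycles V G p (int p + c) \<subseteq> tor_boundaries V G p (int p + c)"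
      using betti_eq_0_iff[OF V G, of p "int p + c"] by simp
    have u: "unit_vec k0 \<in> component V G p (int p + c)"
      using unit_vec_component[OF top(1), of V] top(2) by simp
    have "diff G (p - 1) (unit_vec k0) \<in> vectors G (p - 1) (irrelevant V)" if "p \<noteq> 0"
    proof -
      obtain q where q: "p = Suc q"
        using \<open>p \<noteq> 0\<close> not0_implies_Suc by blast
      have d: "diff G q (unit_vec k0) \<in> component V G q (int p + c)"
        using u res_diff_component[OF G] q by blast
      have "diff G q (unit_vec k0) l \<in> irrelevant V" if "l < rank G q" for l
        using d that bound[OF that] q
        by (intro homogeneous_irrelevant[of _ _ "int p + c - shift G q l"])
          (auto simp: component_def vectors_def)
      then show ?thesis
        using d q by (simp add: component_def vectors_def)
    qed
    then have "unit_vec k0 \<in> tor_cycles V G p (int p + c)"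
      using u by (auto simp: tor_cycles_def)
    then have "unit_vec k0 \<in> tor_boundaries V G p (int p + c)"
      by (rule subsetD[OF sub])
    then obtain w r where r: "r \<in> vectors G p (irrelevant V)" "unit_vec k0 = diff G p w + r"
      unfolding tor_boundaries_def by blast
    \<comment> \<open>Position \<open>Suc p\<close> has rank 0, so nothing maps onto the last
      module. Then \<open>unit_vec k0\<close> would have its entry 1 in the irrelevant
      ideal.\<close>
    have "diff G p w = 0"
      using len[of "Suc p"] by (simp add: diff_def fun_eq_iff)
    then have "unit_vec k0 k0 \<in> (irrelevant V :: ('v, 'k) mpoly set)"
      using r top(1) by (simp add: vectors_def)
    then show False
      by (simp add: unit_vec_def irrelevant_eq)
  qed
  then have mem: "c \<in> {j - int i | i j. ?b i j \<noteq> 0}"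
    by (intro CollectI exI[of _ p] exI[of _ "int p + c"]) simp
  have "x \<le> c" if x: "x \<in> {j - int i | i j. ?b i j \<noteq> 0}" for x
  proof -
    obtain i j where ij: "x = j - int i" "?b i j \<noteq> 0"
      using x by blast
    obtain k where "k < rank G i" "shift G i k = j"
      using degree[OF ij(2)] by blast
    then show ?thesis
      using ij(1) bound[of k i] by simp
  qed
  then show ?thesis
    unfolding regularity_def using fin mem by (intro Max_eqI) auto
qed

section \<open>Mapping cones\<close>

text \<open>For a map of complexes \<open>c : A(-d) \<rightarrow> B\<close>, the cone has \<open>B\<^sub>i \<oplus> A\<^sub>i\<^sub>-\<^sub>1(-d)\<close> in position \<open>i\<close>.\<close>

definition cone ::
  "('v, 'k::field) free_complex \<Rightarrow> ('v, 'k) free_complex \<Rightarrow>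
    (nat \<Rightarrow> nat \<Rightarrow> nat \<Rightarrow> ('v, 'k) mpoly) \<Rightarrow> int \<Rightarrow> ('v, 'k) free_complex" where
  "cone B A c d = \<lparr>
    rank = (\<lambda>i. rank B i + (case i of 0 \<Rightarrow> 0 | Suc i' \<Rightarrow> rank A i')),
    shift = (\<lambda>i k. if k < rank B i then shift B i k else shift A (i - 1) (k - rank B i) + d),
    mat = (\<lambda>i l k.
      if k < rank B (Suc i) then if l < rank B i then mat B i l k else 0
      else if l < rank B i then c i (k - rank B (Suc i)) l
      else - mat A (i - 1) (l - rank B i) (k - rank B (Suc i))),
    aug = aug B\<rparr>"

text \<open>\<open>head\<close> and \<open>tail\<close> are the \<open>B\<close>- and
  \<open>A\<close>-coordinates of a vector of the cone, \<open>glue\<close> reassembles them.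
  \<open>head\<close> pads with zeros because \<open>vectors\<close> demands them beyond the rank;
  \<open>tail\<close> inherits them from the cone.\<close>

definition head :: "nat \<Rightarrow> (nat \<Rightarrow> 'a::zero) \<Rightarrow> nat \<Rightarrow> 'a" where
  "head n v = (\<lambda>k. if k < n then v k else 0)"

definition tail :: "nat \<Rightarrow> (nat \<Rightarrow> 'a) \<Rightarrow> nat \<Rightarrow> 'a" where
  "tail n v = (\<lambda>k. v (n + k))"

definition glue :: "nat \<Rightarrow> (nat \<Rightarrow> 'a) \<Rightarrow> (nat \<Rightarrow> 'a) \<Rightarrow> nat \<Rightarrow> 'a" where
  "glue n b a = (\<lambda>k. if k < n then b k else a (k - n))"

lemma glue_head_tail: "glue n (head n v) (tail n v) = v"
  by (auto simp: glue_def head_def tail_def fun_eq_iff)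

lemma tail_glue [simp]: "tail n (glue n b a) = a"
  by (auto simp: glue_def tail_def fun_eq_iff)

lemma head_glue: "b \<in> vectors B i A \<Longrightarrow> head (rank B i) (glue (rank B i) b a) = b"
  by (auto simp: glue_def head_def fun_eq_iff vectors_def)

lemma glue_eq_0_iff:
  assumes "b \<in> vectors B i P"
  shows "glue (rank B i) b a = 0 \<longleftrightarrow> b = 0 \<and> a = 0"
proof
  assume 0: "glue (rank B i) b a = 0"
  have "head (rank B i) 0 = (0 :: nat \<Rightarrow> ('a, 'b) mpoly)" "tail (rank B i) 0 = (0 :: nat \<Rightarrow> ('a, 'b) mpoly)"
    by (simp_all add: head_def tail_def fun_eq_iff)
  then show "b = 0 \<and> a = 0"
    using head_glue[OF assms, of a] tail_glue[of "rank B i" b a] unfolding 0 by metis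
qed (auto simp: glue_def fun_eq_iff)

lemma sum_split_lessThan: "(\<Sum>k<p + q. f k) = (\<Sum>k<p. f k) + (\<Sum>k<q. f (p + k :: nat))"
  by (induction q) (auto simp: add.assoc)

lemma cone_simps:
  "rank (cone B A c d) 0 = rank B 0"
  "rank (cone B A c d) (Suc i) = rank B (Suc i) + rank A i"
  "aug (cone B A c d) = aug B"
  by (simp_all add: cone_def)

lemma vectors_cone_0: "vectors (cone B A c d) 0 P = vectors B 0 P"
  by (simp add: vectors_def cone_simps)

lemma vectors_cone_SucD:
  assumes "v \<in> vectors (cone B A c d) (Suc i) P"
  shows "head (rank B (Suc i)) v \<in> vectors B (Suc i) P" "tail (rank B (Suc i)) v \<in> vectors A i P"
  using assms by (auto simp: vectors_def cone_simps head_def tail_def)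

lemma glue_vectors_cone:
  assumes "b \<in> vectors B (Suc i) P" "a \<in> vectors A i P"
  shows "glue (rank B (Suc i)) b a \<in> vectors (cone B A c d) (Suc i) P"
  using assms by (auto simp: vectors_def cone_simps glue_def)

context
  fixes B A :: "('v, 'k::field) free_complex" and c :: "nat \<Rightarrow> nat \<Rightarrow> nat \<Rightarrow> ('v, 'k) mpoly"
    and V :: "'v set"
  assumes c: "\<And>i k. k < rank A i \<Longrightarrow> c i k \<in> vectors B i (polys V)"
begin

lemma diff_cone_0:
  "diff (cone B A c d) 0 v =
    diff B 0 (head (rank B (Suc 0)) v) + lin (rank A 0) (c 0) (tail (rank B (Suc 0)) v)"
proof
  fix l
  show "diff (cone B A c d) 0 v l =
    (diff B 0 (head (rank B (Suc 0)) v) + lin (rank A 0) (c 0) (tail (rank B (Suc 0)) v)) l"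
  proof (cases "l < rank B 0")
    case True
    then show ?thesis
      by (simp add: diff_def cone_simps sum_split_lessThan lin_def) (simp add: cone_def head_def tail_def)
  next
    case False
    then have "c 0 k l = 0" if "k < rank A 0" for k
      using c[OF that] by (simp add: vectors_def)
    then show ?thesis
      using False by (simp add: diff_def cone_simps lin_def)
  qed
qed

lemma diff_cone_Suc:
  "diff (cone B A c d) (Suc i) v = glue (rank B (Suc i))
    (diff B (Suc i) (head (rank B (Suc (Suc i))) v)
      + lin (rank A (Suc i)) (c (Suc i)) (tail (rank B (Suc (Suc i))) v))
    (- diff A i (tail (rank B (Suc (Suc i))) v))"
proof
  fix l
  consider "l < rank B (Suc i)" | "rank B (Suc i) \<le> l" "l < rank B (Suc i) + rank A i"
    | "rank B (Suc i) + rank A i \<le> l"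
    by linarith
  then show "diff (cone B A c d) (Suc i) v l = glue (rank B (Suc i))
    (diff B (Suc i) (head (rank B (Suc (Suc i))) v)
      + lin (rank A (Suc i)) (c (Suc i)) (tail (rank B (Suc (Suc i))) v))
    (- diff A i (tail (rank B (Suc (Suc i))) v)) l"
  proof cases
    case 1
    then show ?thesis
      by (simp add: diff_def cone_simps sum_split_lessThan lin_def glue_def)
        (simp add: cone_def head_def tail_def)
  next
    case 2
    then show ?thesis
      by (simp add: diff_def cone_simps sum_split_lessThan glue_def)
        (auto simp add: cone_def tail_def sum_negf)
  next
    case 3
    then show ?thesis
      by (simp add: diff_def cone_simps glue_def)
  qed
qed

end

text \<open>The assumption \<open>colon\<close> says that \<open>D\<close> generates the colon ideal of \<open>E\<close> by the monomial \<open>x\<^sup>e\<close>, so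
  multiplication by \<open>x\<^sup>e\<close> is an injection between the quotient rings.\<close>

lemma cone_resolution:
  fixes A B :: "('v, 'k::field) free_complex"
  assumes B: "sqfree_res V E B" and A: "sqfree_res V D A"
    and e: "finite e" "e \<subseteq> V"
    and colon: "\<And>s. finite s \<Longrightarrow> s \<subseteq> V \<Longrightarrow> (\<exists>d\<in>E. d \<subseteq> s \<union> e) \<longleftrightarrow> (\<exists>d\<in>D. d \<subseteq> s)"
  obtains c where "sqfree_res V (insert e E) (cone B A c (int (card e)))"
proof -
  let ?f = "sqvar e :: ('v, 'k) mpoly" and ?d = "int (card e)"
  have f: "?f \<in> polys V" "homogeneous ?d ?f"
    using e by (simp_all add: sqvar_polys homogeneous_sqvar)
  have mult: "?f * p \<in> sqfree_ideal V E \<longleftrightarrow> p \<in> sqfree_ideal V D" if "p \<in> polys V" for p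
    using sqvar_mult_mem_iff[OF e colon that] .
  obtain c where c: "\<And>i k. k < rank A i \<Longrightarrow> c i k \<in> component V B i (shift A i k + ?d)"
    and c0: "\<And>v. v \<in> vectors A 0 (polys V) \<Longrightarrow>
      ?f * augment A v - augment B (lin (rank A 0) (c 0) v) \<in> sqfree_ideal V E"
    and c_Suc: "\<And>i v. diff B i (lin (rank A (Suc i)) (c (Suc i)) v) = lin (rank A i) (c i) (diff A i v)"
    using chain_map_exists[OF A B f] mult sqfree_ideal_polys by metis
  let ?C = "cone B A c ?d" and ?\<phi> = "\<lambda>i. lin (rank A i) (c i)"
  have cv: "c i k \<in> vectors B i (polys V)" if "k < rank A i" for i k
    using c[OF that] by (rule component_vectors)
  have \<phi>v: "?\<phi> i a \<in> vectors B i (polys V)" if "a \<in> vectors A i (polys V)" for i a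
    using that by (intro lin_vectors cv) (auto simp: vectors_def)
  have diff_0: "diff ?C 0 v = diff B 0 (head (rank B (Suc 0)) v) + ?\<phi> 0 (tail (rank B (Suc 0)) v)" for v
    by (rule diff_cone_0) (rule cv)
  have diff_Suc: "diff ?C (Suc i) v = glue (rank B (Suc i))
      (diff B (Suc i) (head (rank B (Suc (Suc i))) v) + ?\<phi> (Suc i) (tail (rank B (Suc (Suc i))) v))
      (- diff A i (tail (rank B (Suc (Suc i))) v))" for i v
    by (rule diff_cone_Suc) (rule cv)
  have sub: "sqfree_ideal V E \<subseteq> (sqfree_ideal V (insert e E) :: ('v, 'k) mpoly set)"
    by (intro sqfree_ideal_mono) blast
  have aug: "augment ?C = augment B"
    by (simp add: augment_def cone_simps fun_eq_iff)
  have mat: "mat ?C i l k \<in> polys V \<and> homogeneous (shift ?C (Suc i) k - shift ?C i l) (mat ?C i l k)"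
    if l: "l < rank ?C i" and k: "k < rank ?C (Suc i)" for i l k
  proof -
    consider "k < rank B (Suc i)" "l < rank B i" | "k < rank B (Suc i)" "rank B i \<le> l"
      | "rank B (Suc i) \<le> k" "l < rank B i" | "rank B (Suc i) \<le> k" "rank B i \<le> l"
      by linarith
    then show ?thesis
    proof cases
      case 1
      then show ?thesis
        using res_dcol_component[OF B 1(1)]
        by (auto simp: cone_def component_def vectors_def dcol_def)
    next
      case 2
      then show ?thesis
        by (simp add: cone_def)
    next
      case 3
      then have "k - rank B (Suc i) < rank A i"
        using k by (simp add: cone_simps)
      then show ?thesis
        using c[of "k - rank B (Suc i)" i] 3
        by (auto simp: cone_def component_def vectors_def)
    next
      case 4
      then obtain i' where i': "i = Suc i'" "l - rank B i < rank A i'"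
        using l by (cases i) (auto simp: cone_simps)
      have "k - rank B (Suc i) < rank A i"
        using k 4 by (simp add: cone_simps)
      then show ?thesis
        using res_dcol_component[OF A, of "k - rank B (Suc i)" i'] i' 4
        by (auto simp: cone_def component_def vectors_def dcol_def polys_uminus homogeneous_uminus)
    qed
  qed
  have exact_0: "augment ?C v \<in> sqfree_ideal V (insert e E) \<longleftrightarrow> v \<in> diff ?C 0 ` vectors ?C 1 (polys V)"
    if v: "v \<in> vectors ?C 0 (polys V)" for v
  proof
    have vB: "v \<in> vectors B 0 (polys V)"
      using v by (simp add: vectors_cone_0)
    assume "augment ?C v \<in> sqfree_ideal V (insert e E)"
    then obtain g h where gh: "g \<in> sqfree_ideal V E" "h \<in> polys V" "augment B v = g + ?f * h"
      using sqfree_ideal_insertE e(1) unfolding aug by metis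
    obtain a where a: "a \<in> vectors A 0 (polys V)" "h - augment A a \<in> sqfree_ideal V D"
      using res_surj[OF A gh(2)] .
    have "?f * (h - augment A a) \<in> sqfree_ideal V E"
      using a mult sqfree_ideal_polys by blast
    \<comment> \<open>The sum telescopes to \<open>augment B (v - ?\<phi> 0 a)\<close>: correcting
      \<open>v\<close> by the image of \<open>a\<close> removes the multiple of the new
      generator.\<close>
    then have "g + ?f * (h - augment A a) + (?f * augment A a - augment B (?\<phi> 0 a)) \<in> sqfree_ideal V E"
      using gh(1) c0[OF a(1)] by (intro sqfree_ideal_add)
    then have "augment B (v - ?\<phi> 0 a) \<in> sqfree_ideal V E"
      by (simp add: augment_diff gh(3) right_diff_distrib add_diff_eq)
    then obtain b where b: "b \<in> vectors B 1 (polys V)" "v - ?\<phi> 0 a = diff B 0 b"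
      using res_exact_0[OF B vectors_diff[OF vB \<phi>v[OF a(1)]]] by blast
    let ?w = "glue (rank B (Suc 0)) b a"
    have "?w \<in> vectors ?C 1 (polys V)"
      using glue_vectors_cone[of b B 0] a(1) b(1) by simp
    moreover have "diff ?C 0 ?w = v"
      using b by (simp add: diff_0 head_glue[of b B "Suc 0" "polys V"]) (metis diff_add_cancel)
    ultimately show "v \<in> diff ?C 0 ` vectors ?C 1 (polys V)"
      by blast
  next
    assume "v \<in> diff ?C 0 ` vectors ?C 1 (polys V)"
    then obtain w where w: "w \<in> vectors ?C (Suc 0) (polys V)" "v = diff ?C 0 w"
      by auto
    let ?b = "head (rank B (Suc 0)) w" and ?a = "tail (rank B (Suc 0)) w"
    note wv = vectors_cone_SucD[OF w(1)]
    have "augment B (diff B 0 ?b) \<in> sqfree_ideal V E"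
      using res_exact_0[OF B res_diff_vectors[OF B wv(1)]] wv(1) by simp
    then have "augment B (diff B 0 ?b) - (?f * augment A ?a - augment B (?\<phi> 0 ?a)) \<in> sqfree_ideal V E"
      using c0[OF wv(2)] by (rule sqfree_ideal_diff)
    then have "augment ?C v - ?f * augment A ?a \<in> sqfree_ideal V (insert e E)"
      using sub by (auto simp: aug w(2) diff_0 augment_add algebra_simps)
    moreover have "?f * augment A ?a \<in> sqfree_ideal V (insert e E)"
      using e res_augment_polys[OF A wv(2)]
      by (intro sqfree_ideal_mult sqvar_in_sqfree_ideal) auto
    ultimately have "augment ?C v - ?f * augment A ?a + ?f * augment A ?a \<in> sqfree_ideal V (insert e E)"
      by (rule sqfree_ideal_add)
    then show "augment ?C v \<in> sqfree_ideal V (insert e E)"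
      by simp
  qed
  have exact: "diff ?C i v = 0 \<longleftrightarrow> v \<in> diff ?C (Suc i) ` vectors ?C (Suc (Suc i)) (polys V)"
    if v: "v \<in> vectors ?C (Suc i) (polys V)" for i v
  proof
    let ?b = "head (rank B (Suc i)) v" and ?a = "tail (rank B (Suc i)) v"
    note vv = vectors_cone_SucD[OF v]
    assume "diff ?C i v = 0"
    then have b0: "diff B i ?b + ?\<phi> i ?a = 0" and a_im: "?a \<in> diff A i ` vectors A (Suc i) (polys V)"
    proof -
      have *: "diff B i ?b + ?\<phi> i ?a = 0 \<and> ?a \<in> diff A i ` vectors A (Suc i) (polys V)"
      proof (cases i)
        \<comment> \<open>The target of this differential has no \<open>A\<close>-part, so nothing
          says directly that \<open>?a\<close> is a boundary. It follows from the colon property: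
          \<open>?f\<close> times the augmentation of \<open>?a\<close> lies in the ideal of
          \<open>E\<close>, hence the augmentation itself lies in the ideal of
          \<open>D\<close>.\<close>
        case 0
        have s: "diff B 0 ?b + ?\<phi> 0 ?a = 0"
          using \<open>diff ?C i v = 0\<close> unfolding 0 diff_0 .
        have "augment B (diff B 0 ?b) \<in> sqfree_ideal V E"
          using res_exact_0[OF B res_diff_vectors[OF B vv(1)[unfolded 0]]] vv(1) by (simp add: 0)
        moreover have "augment B (diff B 0 ?b) + augment B (?\<phi> 0 ?a) = 0"
          using s by (metis augment_add augment_diff diff_self)
        ultimately have "augment B (?\<phi> 0 ?a) \<in> sqfree_ideal V E"
          using sqfree_ideal_uminus by (metis add_eq_0_iff)
        then have "?f * augment A ?a \<in> sqfree_ideal V E"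
          using sqfree_ideal_add c0[OF vv(2)[unfolded 0]] by (fastforce simp: 0)
        then have "augment A ?a \<in> sqfree_ideal V D"
          using mult res_augment_polys[OF A] vv(2) by (simp add: 0)
        then show ?thesis
          using s res_exact_0[OF A] vv(2) by (simp add: 0)
      next
        case (Suc i')
        have "diff B i ?b + ?\<phi> i ?a \<in> vectors B i (polys V)"
          using vv by (intro vectors_add \<phi>v res_diff_vectors[OF B])
        then have "diff B i ?b + ?\<phi> i ?a = 0 \<and> - diff A i' ?a = 0"
          using \<open>diff ?C i v = 0\<close> unfolding Suc diff_Suc using glue_eq_0_iff by blast
        then show ?thesis
          using res_exact[OF A, of ?a i'] vv(2) by (simp add: Suc)
      qed
      then show "diff B i ?b + ?\<phi> i ?a = 0" "?a \<in> diff A i ` vectors A (Suc i) (polys V)"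
        by blast+
    qed
    obtain a where a: "a \<in> vectors A (Suc i) (polys V)" "?a = diff A i a"
      using a_im by blast
    have "diff B i (?b + ?\<phi> (Suc i) a) = 0"
      using b0 by (simp add: diff_plus c_Suc a(2))
    moreover have "?b + ?\<phi> (Suc i) a \<in> vectors B (Suc i) (polys V)"
      using vv(1) a(1) by (intro vectors_add \<phi>v)
    ultimately obtain b where b: "b \<in> vectors B (Suc (Suc i)) (polys V)"
      "?b + ?\<phi> (Suc i) a = diff B (Suc i) b"
      using res_exact[OF B] by blast
    \<comment> \<open>The sign of \<open>a\<close> cancels the sign of the \<open>A\<close>-block in
      the differential of the cone.\<close>
    let ?w = "glue (rank B (Suc (Suc i))) b (- a)"
    have "?w \<in> vectors ?C (Suc (Suc i)) (polys V)"
      using a(1) b(1) by (intro glue_vectors_cone vectors_uminus)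
    moreover have "diff ?C (Suc i) ?w = v"
    proof -
      have "diff ?C (Suc i) ?w = glue (rank B (Suc i)) (diff B (Suc i) b + ?\<phi> (Suc i) (- a)) (- diff A i (- a))"
        by (simp add: diff_Suc head_glue[OF b(1)])
      also have "\<dots> = glue (rank B (Suc i)) ?b ?a"
        by (simp add: lin_uminus diff_eq_lin[of A] flip: b(2)) (simp add: a(2) diff_eq_lin)
      finally show ?thesis
        by (simp add: glue_head_tail)
    qed
    ultimately show "v \<in> diff ?C (Suc i) ` vectors ?C (Suc (Suc i)) (polys V)"
      by blast
  next
    assume "v \<in> diff ?C (Suc i) ` vectors ?C (Suc (Suc i)) (polys V)"
    then obtain w where w: "w \<in> vectors ?C (Suc (Suc i)) (polys V)" "v = diff ?C (Suc i) w"
      by blast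
    let ?b = "head (rank B (Suc (Suc i))) w" and ?a = "tail (rank B (Suc (Suc i))) w"
    note wv = vectors_cone_SucD[OF w(1)]
    have h: "diff B (Suc i) ?b + ?\<phi> (Suc i) ?a \<in> vectors B (Suc i) (polys V)"
      using wv by (intro vectors_add \<phi>v res_diff_vectors[OF B])
    have hd: "head (rank B (Suc i)) v = diff B (Suc i) ?b + ?\<phi> (Suc i) ?a"
      and tl: "tail (rank B (Suc i)) v = - diff A i ?a"
      by (simp_all add: w(2) diff_Suc head_glue[OF h])
    have s: "diff B i (head (rank B (Suc i)) v) + ?\<phi> i (tail (rank B (Suc i)) v) = 0"
      unfolding hd tl by (simp add: diff_plus c_Suc lin_uminus res_diff_diff[OF B wv(1)])
    show "diff ?C i v = 0"
    proof (cases i)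
      case 0
      then show ?thesis
        using s by (simp add: diff_0)
    next
      case (Suc i')
      have "diff A i' (tail (rank B (Suc i)) v) = 0"
        unfolding tl using res_diff_diff[OF A, of ?a i'] wv(2)
        by (simp add: Suc diff_eq_lin lin_uminus)
      then show ?thesis
        using s by (simp add: Suc diff_Suc) (simp add: glue_def fun_eq_iff)
    qed
  qed
  show thesis
  proof (rule that[of c])
    show "sqfree_res V (insert e E) ?C"
      unfolding graded_free_resolution_def
    proof (intro conjI allI impI ballI)
      fix p :: "('v, 'k) mpoly" assume "p \<in> polys V"
      then obtain v where "v \<in> vectors B 0 (polys V)" "p - augment B v \<in> sqfree_ideal V E"
        by (rule res_surj[OF B])
      then show "\<exists>v\<in>vectors ?C 0 (polys V). p - augment ?C v \<in> sqfree_ideal V (insert e E)"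
        using sub by (auto simp: vectors_cone_0 aug)
    next
      fix k assume "k < rank ?C 0"
      then show "aug ?C k \<in> polys V" "homogeneous (shift ?C 0 k) (aug ?C k)"
        using res_aug[OF B, of k] by (simp_all add: cone_def)
    qed (use mat exact_0 exact in blast)+
  qed
qed

section \<open>Building resolutions edge by edge\<close>

text \<open>The basis element required by \<open>t\<close> survives in Tor, so \<open>t\<close> makes \<open>c\<close> the exact regularity.\<close>

definition res_within ::
  "'k::field itself \<Rightarrow> 'v set \<Rightarrow> 'v set set \<Rightarrow> nat \<Rightarrow> int \<Rightarrow> bool \<Rightarrow> bool" where
  "res_within K V E p c t \<longleftrightarrow> (\<exists>F :: ('v, 'k) free_complex. sqfree_res V E F \<and>
     (\<forall>i>p. rank F i = 0) \<and> (\<forall>i k. k < rank F i \<longrightarrow> shift F i k \<le> int i + c) \<and>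
     (t \<longrightarrow> (\<exists>k<rank F p. shift F p k = int p + c)))"

text \<open>After the bounds are relaxed the extreme element need no longer be extreme, so the flag
  drops to \<open>False\<close>.\<close>

lemma res_within_mono:
  fixes K :: "'k::field itself" and V :: "'v set"
  assumes "res_within K V E p c t" "p \<le> P" "c \<le> C"
  shows "res_within K V E P C False"
proof -
  obtain F :: "('v, 'k) free_complex" where F: "sqfree_res V E F" "\<forall>i>p. rank F i = 0"
    "\<forall>i k. k < rank F i \<longrightarrow> shift F i k \<le> int i + c"
    using assms(1) unfolding res_within_def by blast
  have "\<forall>i>P. rank F i = 0" "\<forall>i k. k < rank F i \<longrightarrow> shift F i k \<le> int i + C"
    using F assms(2,3) by force+
  then show ?thesis
    using F(1) unfolding res_within_def by blast
qed

lemma regularity_res_within: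
  fixes K :: "'k::field itself" and V :: "'v set"
  assumes "finite V" "res_within K V E p c True"
  shows "regularity V (sqfree_ideal V E :: ('v, 'k) mpoly set) = c"
proof -
  obtain F :: "('v, 'k) free_complex" where F: "sqfree_res V E F" "\<forall>i>p. rank F i = 0"
    "\<forall>i k. k < rank F i \<longrightarrow> shift F i k \<le> int i + c" "\<exists>k<rank F p. shift F p k = int p + c"
    using assms(2) unfolding res_within_def by blast
  then show ?thesis
    using regularity_eqI[OF assms(1) F(1), of p c] by blast
qed

text \<open>\<open>S\<close> is free over itself: the start of the construction.\<close>

lemma res_within_empty:
  fixes K :: "'k::field itself" and V :: "'v set"
  shows "res_within K V {} 0 0 True"
proof -
  define F :: "('v, 'k) free_complex" where
    "F = \<lparr>rank = (\<lambda>i. if i = 0 then 1 else 0), shift = (\<lambda>_ _. 0), mat = (\<lambda>_ _ _. 0), aug = (\<lambda>_. 1)\<rparr>"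
  have rank: "rank F 0 = 1" "rank F (Suc i) = 0" for i
    by (simp_all add: F_def)
  have aug: "augment F v = v 0" for v
    by (simp add: augment_def rank) (simp add: F_def)
  have diff: "diff F i v = 0" for i v
    by (simp add: diff_def rank fun_eq_iff)
  have vec: "vectors F (Suc i) (polys V) = {0}" for i
    by (auto simp: vectors_def rank fun_eq_iff)
  have vec0: "v = 0 \<longleftrightarrow> v 0 = 0" if "v \<in> vectors F 0 (polys V)" for v
  proof
    assume "v 0 = 0"
    then have "v k = 0" for k
      using that by (cases k) (auto simp: vectors_def rank)
    then show "v = 0" by (simp add: fun_eq_iff)
  qed simp
  have "sqfree_res V {} F"
    unfolding graded_free_resolution_def
  proof (intro conjI allI ballI impI)
    fix p :: "('v, 'k) mpoly" assume "p \<in> polys V"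
    then show "\<exists>v\<in>vectors F 0 (polys V). p - augment F v \<in> sqfree_ideal V {}"
      by (intro bexI[of _ "\<lambda>k. if k = 0 then p else 0"]) (auto simp: aug vectors_def rank)
  next
    fix v :: "nat \<Rightarrow> ('v, 'k) mpoly" assume v: "v \<in> vectors F 0 (polys V)"
    show "augment F v \<in> sqfree_ideal V {} \<longleftrightarrow> v \<in> diff F 0 ` vectors F 1 (polys V)"
      using vec0[OF v] vec[of 0] by (simp add: aug sqfree_ideal_empty diff)
  qed (auto simp: F_def vec[unfolded F_def] diff[unfolded F_def])
  then show ?thesis
    unfolding res_within_def by (intro exI[of _ F]) (auto simp: F_def)
qed

text \<open>In the cone the resolution for \<open>D\<close> moves up by one position and by
  \<open>card e\<close> degrees, so its excess \<open>b\<close> becomes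
  \<open>b + card e - 1\<close>. The extreme element may come from either constituent, hence the
  disjunction in \<open>T\<close>.\<close>

lemma res_within_insert:
  fixes K :: "'k::field itself" and V :: "'v set"
  assumes B: "res_within K V E p c t" and A: "res_within K V D q b u"
    and e: "finite e" "e \<subseteq> V"
    and colon: "\<And>s. finite s \<Longrightarrow> s \<subseteq> V \<Longrightarrow> (\<exists>d\<in>E. d \<subseteq> s \<union> e) \<longleftrightarrow> (\<exists>d\<in>D. d \<subseteq> s)"
    and P: "p \<le> P" "Suc q \<le> P" and C: "c \<le> C" "b + int (card e) - 1 \<le> C"
    and T: "T \<Longrightarrow> t \<and> p = P \<and> c = C \<or> u \<and> Suc q = P \<and> b + int (card e) - 1 = C"
  shows "res_within K V (insert e E) P C T"
proof -
  obtain F :: "('v, 'k) free_complex" where F: "sqfree_res V E F" "\<forall>i>p. rank F i = 0"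
    "\<forall>i k. k < rank F i \<longrightarrow> shift F i k \<le> int i + c" "t \<longrightarrow> (\<exists>k<rank F p. shift F p k = int p + c)"
    using B unfolding res_within_def by blast
  obtain H :: "('v, 'k) free_complex" where H: "sqfree_res V D H" "\<forall>i>q. rank H i = 0"
    "\<forall>i k. k < rank H i \<longrightarrow> shift H i k \<le> int i + b" "u \<longrightarrow> (\<exists>k<rank H q. shift H q k = int q + b)"
    using A unfolding res_within_def by blast
  obtain g where g: "sqfree_res V (insert e E) (cone F H g (int (card e)))"
    using cone_resolution[OF F(1) H(1) e colon] .
  let ?Z = "cone F H g (int (card e))"
  have len: "rank ?Z i = 0" if i: "P < i" for i
  proof -
    obtain i' where i': "i = Suc i'"
      using i by (cases i) auto
    then show ?thesis
      using i P F(2) H(2) by (simp add: cone_simps)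
  qed
  have bound: "shift ?Z i k \<le> int i + C" if k: "k < rank ?Z i" for i k
  proof (cases "k < rank F i")
    case True
    then show ?thesis
      using F(3) C(1) by (force simp: cone_def)
  next
    case False
    then obtain i' where i': "i = Suc i'"
      using k by (cases i) (auto simp: cone_simps)
    have "k - rank F i < rank H i'"
      using k False by (simp add: i' cone_simps)
    then have "shift H i' (k - rank F i) \<le> int i' + b"
      using H(3) by blast
    then show ?thesis
      using False C(2) by (simp add: i' cone_def)
  qed
  have top: "\<exists>k<rank ?Z P. shift ?Z P k = int P + C" if T
    using T[OF that]
  proof
    assume "t \<and> p = P \<and> c = C"
    then obtain k where "k < rank F P" "shift F P k = int P + C"
      using F(4) by blast
    then show ?thesis
      by (intro exI[of _ k]) (simp add: cone_def)
  next
    assume *: "u \<and> Suc q = P \<and> b + int (card e) - 1 = C"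
    then obtain k where k: "k < rank H q" "shift H q k = int q + b"
      using H(4) by blast
    have C_eq: "C = b + int (card e) - 1"
      using * by simp
    have "shift ?Z (Suc q) (rank F (Suc q) + k) = int (Suc q) + C"
      using k unfolding C_eq by (simp add: cone_def)
    then show ?thesis
      using k * by (intro exI[of _ "rank F (Suc q) + k"]) (auto simp: cone_simps)
  qed
  show ?thesis
    unfolding res_within_def using g len bound top by blast
qed

text \<open>The resolution built here has the shape of the Koszul complex. A new variable leaves the
  ideal of the old ones unchanged under colon, and with \<open>card e = 1\<close> the excess stays
  0.\<close>

lemma res_within_vars:
  assumes "finite X" "X \<subseteq> V"
  shows "res_within K V ((\<lambda>x. {x}) ` X) (card X) 0 True"
  using assms
proof (induction X rule: finite_induct)
  case empty
  then show ?case by (simp add: res_within_empty)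
next
  case (insert x X)
  then have R: "res_within K V ((\<lambda>x. {x}) ` X) (card X) 0 True"
    by simp
  have "res_within K V (insert {x} ((\<lambda>x. {x}) ` X)) (card (insert x X)) 0 True"
    using insert by (intro res_within_insert[OF R R]) auto
  then show ?case by simp
qed

text \<open>As \<open>y\<close> and \<open>z\<close> avoid \<open>X\<close>, the colon ideal is
  again generated by the variables in \<open>X\<close>; the two degrees of the edge raise the excess
  from 0 to 1.\<close>

lemma res_within_vars_edge:
  assumes "finite X" "X \<subseteq> V" "y \<noteq> z" "y \<notin> X" "z \<notin> X" "y \<in> V" "z \<in> V"
  shows "res_within K V (insert {y, z} ((\<lambda>x. {x}) ` X)) (Suc (card X)) 1 True"
proof -
  have R: "res_within K V ((\<lambda>x. {x}) ` X) (card X) 0 True"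
    using res_within_vars[OF assms(1,2)] .
  show ?thesis
    using assms by (intro res_within_insert[OF R R]) auto
qed

section \<open>Graphs on an initial segment of the natural numbers\<close>

definition edges_upto :: "(nat \<Rightarrow> nat \<Rightarrow> bool) \<Rightarrow> nat \<Rightarrow> nat set set" where
  "edges_upto adj n = {{x, y} | x y. x < y \<and> y < n \<and> adj x y}"

definition nat_graph :: "(nat \<Rightarrow> nat \<Rightarrow> bool) \<Rightarrow> nat \<Rightarrow> nat graph" where
  "nat_graph adj n = \<lparr>verts = {..<n}, edges = edges_upto adj n\<rparr>"

lemma pair_in_edges_upto:
  "{x, y} \<in> edges_upto adj n \<longleftrightarrow> x < y \<and> y < n \<and> adj x y \<or> y < x \<and> x < n \<and> adj y x"
  by (auto simp: edges_upto_def doubleton_eq_iff)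

lemma edges_uptoE:
  assumes "e \<in> edges_upto adj n"
  obtains x y where "e = {x, y}" "x < y" "y < n" "adj x y"
  using assms by (auto simp: edges_upto_def)

text \<open>The edges that precede \<open>{x, y}\<close> when edges are ordered by larger endpoint
  and then by smaller endpoint.\<close>

definition edges_part :: "(nat \<Rightarrow> nat \<Rightarrow> bool) \<Rightarrow> nat \<Rightarrow> nat \<Rightarrow> nat set set" where
  "edges_part adj y x = edges_upto adj y \<union> {{u, y} | u. u < x \<and> adj u y}"

lemma edges_part_0: "edges_part adj y 0 = edges_upto adj y"
  by (simp add: edges_part_def)

lemma edges_part_Suc:
  "edges_part adj y (Suc x) = (if adj x y then insert {x, y} (edges_part adj y x) else edges_part adj y x)"
  by (auto simp: edges_part_def less_Suc_eq)

lemma edges_part_self: "edges_part adj y y = edges_upto adj (Suc y)"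
  by (auto simp: edges_part_def edges_upto_def less_Suc_eq)

text \<open>A variable enters the colon ideal by an earlier edge to \<open>x\<close> or to
  \<open>y\<close>. Edges from \<open>z\<close> to \<open>y\<close> are earlier only for
  \<open>z < x\<close>, which explains the case distinction in \<open>X\<close>. The earlier edges
  at neither \<open>x\<close> nor \<open>y\<close> are multiples of these variables, except possibly
  those in \<open>N\<close>.\<close>

lemma edges_part_colon:
  assumes X: "\<And>z. z \<in> X \<longleftrightarrow> z < y \<and> z \<noteq> x \<and> (if z < x then adj z x \<or> adj z y else adj x z)"
    and N: "N \<subseteq> edges_upto adj y"
    and cover: "\<And>u v. u < v \<Longrightarrow> v < y \<Longrightarrow> adj u v \<Longrightarrow> u \<noteq> x \<Longrightarrow> v \<noteq> x \<Longrightarrow>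
      u \<in> X \<or> v \<in> X \<or> {u, v} \<in> N"
    and x: "x < y"
  shows "(\<exists>d\<in>edges_part adj y x. d \<subseteq> s \<union> {x, y}) \<longleftrightarrow> (\<exists>d\<in>N \<union> (\<lambda>z. {z}) ` X. d \<subseteq> s)"
proof
  assume "\<exists>d\<in>edges_part adj y x. d \<subseteq> s \<union> {x, y}"
  then obtain d where d: "d \<in> edges_part adj y x" "d \<subseteq> s \<union> {x, y}"
    by blast
  have "(\<exists>z\<in>X. z \<in> s) \<or> (\<exists>d\<in>N. d \<subseteq> s)"
  proof (cases "d \<in> edges_upto adj y")
    case True
    then obtain u v where uv: "d = {u, v}" "u < v" "v < y" "adj u v"
      by (rule edges_uptoE)
    consider "u = x" | "v = x" | "u \<noteq> x" "v \<noteq> x"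
      by blast
    then show ?thesis
    proof cases
      case 1
      then have "v \<in> X" "v \<in> s"
        using X[of v] uv d(2) by auto
      then show ?thesis by blast
    next
      case 2
      then have "u \<in> X" "u \<in> s"
        using X[of u] uv d(2) by auto
      then show ?thesis by blast
    next
      case 3
      then have "u \<in> s" "v \<in> s"
        using uv d(2) by auto
      then show ?thesis
        using cover[OF uv(2-4) 3] by auto
    qed
  next
    case False
    then obtain u where u: "d = {u, y}" "u < x" "adj u y"
      using d(1) by (auto simp: edges_part_def)
    then have "u \<in> X" "u \<in> s"
      using X[of u] d(2) x by auto
    then show ?thesis by blast
  qed
  then show "\<exists>d\<in>N \<union> (\<lambda>z. {z}) ` X. d \<subseteq> s"
    by auto
next
  assume "\<exists>d\<in>N \<union> (\<lambda>z. {z}) ` X. d \<subseteq> s"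
  then consider d where "d \<in> N" "d \<subseteq> s" | z where "z \<in> X" "z \<in> s"
    by auto
  then show "\<exists>d\<in>edges_part adj y x. d \<subseteq> s \<union> {x, y}"
  proof cases
    case 1
    then show ?thesis
      using N by (auto simp: edges_part_def)
  next
    case 2
    have "{z, x} \<in> edges_part adj y x \<or> {z, y} \<in> edges_part adj y x"
      using X[of z] 2(1) x by (auto simp: edges_part_def pair_in_edges_upto split: if_splits)
    moreover have "{z, x} \<subseteq> s \<union> {x, y}" "{z, y} \<subseteq> s \<union> {x, y}"
      using 2(2) by auto
    ultimately show ?thesis by blast
  qed
qed

text \<open>The edges at \<open>y\<close> are added by increasing \<open>x\<close>. The edge from
  \<open>x0\<close> creates the extreme basis element, and later cones contain the earlier
  resolution and so keep it; hence the flag \<open>x0 < x\<close> in the induction.\<close>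

lemma res_within_add_vertex:
  assumes R: "res_within K V (edges_upto adj y) p c t" and "{..y} \<subseteq> V"
    and step: "\<And>x. x < y \<Longrightarrow> adj x y \<Longrightarrow> \<exists>D q b. res_within K V D q b (x = x0) \<and>
      (\<forall>s. (\<exists>d\<in>edges_part adj y x. d \<subseteq> s \<union> {x, y}) \<longleftrightarrow> (\<exists>d\<in>D. d \<subseteq> s)) \<and>
      Suc q \<le> p \<and> b + 1 \<le> c \<and> (x = x0 \<longrightarrow> Suc q = p \<and> b + 1 = c)"
    and x0: "x0 < y" "adj x0 y"
  shows "res_within K V (edges_upto adj (Suc y)) p c True"
proof -
  have "res_within K V (edges_part adj y x) p c (x0 < x)" if "x \<le> y" for x
    using that
  proof (induction x)
    case 0
    then show ?case
      using res_within_mono[OF R] by (simp add: edges_part_0)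
  next
    case (Suc x)
    then have IH: "res_within K V (edges_part adj y x) p c (x0 < x)"
      by simp
    show ?case
    proof (cases "adj x y")
      case True
      obtain D q b where D: "res_within K V D q b (x = x0)"
        "\<And>s. (\<exists>d\<in>edges_part adj y x. d \<subseteq> s \<union> {x, y}) \<longleftrightarrow> (\<exists>d\<in>D. d \<subseteq> s)"
        "Suc q \<le> p" "b + 1 \<le> c" "x = x0 \<longrightarrow> Suc q = p \<and> b + 1 = c"
        using step[OF _ True] Suc.prems by (auto simp: Suc_le_eq)
      have card: "card {x, y} = 2"
        using Suc.prems by simp
      have "res_within K V (insert {x, y} (edges_part adj y x)) p c (x0 < Suc x)"
      proof (rule res_within_insert[OF IH D(1)])
        show "{x, y} \<subseteq> V"
          using Suc.prems assms(2) by auto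
        show "x0 < Suc x \<Longrightarrow> x0 < x \<and> p = p \<and> c = c \<or>
            x = x0 \<and> Suc q = p \<and> b + int (card {x, y}) - 1 = c"
          using D(5) unfolding card by auto
        show "b + int (card {x, y}) - 1 \<le> c"
          using D(4) unfolding card by simp
      qed (use D(2,3) in auto)
      then show ?thesis
        using True by (simp add: edges_part_Suc)
    next
      case False
      \<comment> \<open>\<open>x0\<close> is adjacent to \<open>y\<close>, so a skipped
        \<open>x\<close> cannot be \<open>x0\<close>.\<close>
      then have "(x0 < Suc x) = (x0 < x)"
        using x0 less_Suc_eq by auto
      then show ?thesis
        using IH False by (simp add: edges_part_Suc)
    qed
  qed
  then have "res_within K V (edges_part adj y y) p c (x0 < y)"
    by simp
  then show ?thesis
    using x0(1) by (simp add: edges_part_self)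
qed

section \<open>From edge resolutions to the regularity of the two graph families\<close>

lemma simple_nat_graph: "simple_graph (nat_graph adj n)"
  by (auto simp: simple_graph_def nat_graph_def edges_upto_def)

lemma edge_reg_nat_graph:
  fixes K :: "'k::field itself"
  assumes "res_within K {..<n} (edges_upto adj n) p c True"
  shows "edge_reg K (nat_graph adj n) = c"
  using regularity_res_within[OF _ assms] edge_ideal_eq[OF simple_nat_graph[of adj n], where ?'b = 'k]
  by (simp add: edge_reg_def nat_graph_def)

text \<open>Adjacency of \<open>x < y\<close> in the join of a complete graph on \<open>a\<close> vertices with an independent set,
  and in the complement of the cycle of length \<open>N + 1\<close> in which one vertex is replaced by
  independent copies \<open>N, N + 1, \<dots>\<close> of itself.\<close>

definition split_adj :: "nat \<Rightarrow> nat \<Rightarrow> nat \<Rightarrow> bool" where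
  "split_adj a x y \<longleftrightarrow> x < a"

definition anticycle_adj :: "nat \<Rightarrow> nat \<Rightarrow> nat \<Rightarrow> bool" where
  "anticycle_adj N x y \<longleftrightarrow> (if y < N then x + 2 \<le> y else 1 \<le> x \<and> x + 1 < N)"

text \<open>Since \<open>x < a\<close>, the vertex \<open>x\<close> is adjacent to every other
  vertex below \<open>y\<close>. So each colon ideal is generated by \<open>y - 1\<close> variables,
  and the cone has length \<open>y\<close> and excess \<open>0 + 2 - 1\<close>.\<close>

lemma res_within_split:
  assumes "1 \<le> y" "{..y} \<subseteq> V" "0 < a"
  shows "res_within K V (edges_upto (split_adj a) (Suc y)) y 1 True"
proof -
  have step: "res_within K V (edges_upto (split_adj a) (Suc y)) y 1 True"
    if R: "res_within K V (edges_upto (split_adj a) y) y 1 False" and y: "1 \<le> y" "{..y} \<subseteq> V" for y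
  proof (rule res_within_add_vertex[OF R, where ?x0.0 = 0])
    fix x assume x: "x < y" "split_adj a x y"
    let ?X = "{..<y} - {x}"
    have "?X \<subseteq> V"
      by (rule subset_trans[OF _ y(2)]) auto
    moreover have "card ?X = y - 1"
      using x by simp
    ultimately have X: "?X \<subseteq> V" "card ?X = y - 1"
      by blast+
    have "\<forall>s. (\<exists>d\<in>edges_part (split_adj a) y x. d \<subseteq> s \<union> {x, y}) \<longleftrightarrow>
        (\<exists>d\<in>{} \<union> (\<lambda>z. {z}) ` ?X. d \<subseteq> s)"
      using x by (intro allI edges_part_colon) (auto simp: split_adj_def)
    moreover have "res_within K V ({} \<union> (\<lambda>z. {z}) ` ?X) (y - 1) 0 (x = 0)"
      using res_within_vars[of ?X V K] X res_within_mono[of K V _ "y - 1" 0 True "y - 1" 0]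
      by (cases "x = 0") auto
    ultimately show "\<exists>D q b. res_within K V D q b (x = 0) \<and>
      (\<forall>s. (\<exists>d\<in>edges_part (split_adj a) y x. d \<subseteq> s \<union> {x, y}) \<longleftrightarrow> (\<exists>d\<in>D. d \<subseteq> s)) \<and>
      Suc q \<le> y \<and> b + 1 \<le> 1 \<and> (x = 0 \<longrightarrow> Suc q = y \<and> b + 1 = 1)"
      using y(1) by (intro exI[of _ "{} \<union> (\<lambda>z. {z}) ` ?X"] exI[of _ "y - 1"] exI[of _ 0]) simp
  qed (use y assms(3) in \<open>auto simp: split_adj_def\<close>)
  show ?thesis
    using assms(1,2)
  proof (induction y rule: nat_induct_at_least)
    case base
    have "edges_upto (split_adj a) 1 = {}"
      by (auto simp: edges_upto_def)
    then show ?case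
      using res_within_mono[OF res_within_empty[of K V], of 1 1] base by (intro step) auto
  next
    case (Suc y)
    have "{..y} \<subseteq> V"
      using Suc.prems by auto
    then show ?case
      using res_within_mono[OF Suc.IH, of "Suc y" 1] Suc.prems by (intro step) auto
  qed
qed

text \<open>Below \<open>N\<close> the graph is the complement of a path. Vertices above
  \<open>Suc x\<close> are joined to \<open>x\<close>, those below \<open>x\<close> to
  \<open>y\<close>, so the colon ideal contains all variables below \<open>y\<close> except
  \<open>x\<close> and its successor on the path.\<close>

lemma res_within_anticycle_base:
  assumes "2 \<le> y" "y < N" "{..y} \<subseteq> V"
  shows "res_within K V (edges_upto (anticycle_adj N) (Suc y)) (y - 1) 1 True"
proof -
  have step: "res_within K V (edges_upto (anticycle_adj N) (Suc y)) (y - 1) 1 True"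
    if R: "res_within K V (edges_upto (anticycle_adj N) y) (y - 1) 1 False"
      and y: "2 \<le> y" "y < N" "{..y} \<subseteq> V" for y
  proof (rule res_within_add_vertex[OF R, where ?x0.0 = 0])
    fix x assume x: "x < y" "anticycle_adj N x y"
    then have xy: "x + 2 \<le> y"
      using y(2) by (simp add: anticycle_adj_def)
    have Suc_y: "Suc (y - 2) = y - 1"
      using y(1) by simp
    let ?X = "{..<y} - {x, Suc x}"
    have "?X \<subseteq> V"
      by (rule subset_trans[OF _ y(3)]) auto
    moreover have "card ?X = y - 2"
      using xy by (simp add: card_Diff_subset)
    ultimately have X: "?X \<subseteq> V" "card ?X = y - 2"
      by blast+
    have "\<forall>s. (\<exists>d\<in>edges_part (anticycle_adj N) y x. d \<subseteq> s \<union> {x, y}) \<longleftrightarrow>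
        (\<exists>d\<in>{} \<union> (\<lambda>z. {z}) ` ?X. d \<subseteq> s)"
      using xy y(2) by (intro allI edges_part_colon) (auto simp: anticycle_adj_def)
    moreover have "res_within K V ({} \<union> (\<lambda>z. {z}) ` ?X) (y - 2) 0 (x = 0)"
      using res_within_vars[of ?X V K] X res_within_mono[of K V _ "y - 2" 0 True "y - 2" 0]
      by (cases "x = 0") auto
    ultimately show "\<exists>D q b. res_within K V D q b (x = 0) \<and>
      (\<forall>s. (\<exists>d\<in>edges_part (anticycle_adj N) y x. d \<subseteq> s \<union> {x, y}) \<longleftrightarrow> (\<exists>d\<in>D. d \<subseteq> s)) \<and>
      Suc q \<le> y - 1 \<and> b + 1 \<le> 1 \<and> (x = 0 \<longrightarrow> Suc q = y - 1 \<and> b + 1 = 1)"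
      using Suc_y by (intro exI[of _ "{} \<union> (\<lambda>z. {z}) ` ?X"] exI[of _ "y - 2"] exI[of _ 0]) simp
  qed (use y in \<open>auto simp: anticycle_adj_def\<close>)
  show ?thesis
    using assms
  proof (induction y rule: nat_induct_at_least)
    case base
    have "edges_upto (anticycle_adj N) 2 = {}"
      using base by (auto simp: edges_upto_def anticycle_adj_def)
    then show ?case
      using res_within_mono[OF res_within_empty[of K V], of 1 1] base by (intro step) auto
  next
    case (Suc y)
    have "{..y} \<subseteq> V"
      using Suc.prems by auto
    then show ?case
      using res_within_mono[OF Suc.IH, of y 1] Suc.prems Suc.hyps by (intro step) auto
  qed
qed

text \<open>At the moment when \<open>{1, y}\<close> is added it forms a pair of 3-disjoint edges
  with \<open>{0, 2}\<close>, which brings the excess to 2. The later edges at \<open>y\<close>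
  destroy the pair, but not the basis element.\<close>

lemma res_within_anticycle:
  assumes "N \<le> y" "4 \<le> N" "{..y} \<subseteq> V"
  shows "res_within K V (edges_upto (anticycle_adj N) (Suc y)) (y - 1) 2 True"
proof -
  have step: "res_within K V (edges_upto (anticycle_adj N) (Suc y)) (y - 1) 2 True"
    if R: "res_within K V (edges_upto (anticycle_adj N) y) (y - 1) 2 False"
      and y: "N \<le> y" "{..y} \<subseteq> V" for y
  proof (rule res_within_add_vertex[OF R, where ?x0.0 = 1])
    fix x assume "x < y" "anticycle_adj N x y"
    then have x: "1 \<le> x" "x + 1 < N"
      using y(1) by (simp_all add: anticycle_adj_def)
    show "\<exists>D q b. res_within K V D q b (x = 1) \<and>
      (\<forall>s. (\<exists>d\<in>edges_part (anticycle_adj N) y x. d \<subseteq> s \<union> {x, y}) \<longleftrightarrow> (\<exists>d\<in>D. d \<subseteq> s)) \<and>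
      Suc q \<le> y - 1 \<and> b + 1 \<le> 2 \<and> (x = 1 \<longrightarrow> Suc q = y - 1 \<and> b + 1 = 2)"
    proof (cases "x = 1")
      case True
      \<comment> \<open>The vertices 0 and 2 are the cycle neighbours of 1. Neither is joined to 1,
        0 is not joined to \<open>y\<close>, and the edge from 2 to \<open>y\<close> comes later; so
        neither becomes a variable, and their edge remains as a generator.\<close>
      let ?D = "{{0, 2}} \<union> (\<lambda>z. {z}) ` {3..<y}"
      have "\<forall>s. (\<exists>d\<in>edges_part (anticycle_adj N) y x. d \<subseteq> s \<union> {x, y}) \<longleftrightarrow> (\<exists>d\<in>?D. d \<subseteq> s)"
      proof (intro allI edges_part_colon)
        show "z \<in> {3..<y} \<longleftrightarrow> z < y \<and> z \<noteq> x \<and>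
            (if z < x then anticycle_adj N z x \<or> anticycle_adj N z y else anticycle_adj N x z)" for z
          using True y(1) assms(2) by (auto simp: anticycle_adj_def)
        show "{{0, 2}} \<subseteq> edges_upto (anticycle_adj N) y"
          using y(1) assms(2) by (auto simp: pair_in_edges_upto anticycle_adj_def)
        show "u \<in> {3..<y} \<or> v \<in> {3..<y} \<or> {u, v} \<in> {{0, 2}}"
          if "u < v" "v < y" "u \<noteq> x" "v \<noteq> x" for u v
        proof (cases "v < 3")
          case True
          then have "u = 0" "v = 2"
            using that \<open>x = 1\<close> by auto
          then show ?thesis by simp
        qed (use that in auto)
        show "x < y"
          using x y(1) by simp
      qed
      moreover have "res_within K V ?D (Suc (y - 3)) 1 (x = 1)"
        using res_within_vars_edge[of "{3..<y}" V 0 2 K] True y assms(2) by (simp add: subset_iff)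
      moreover have "Suc (Suc (y - 3)) = y - 1"
        using y(1) assms(2) by simp
      ultimately show ?thesis
        by (intro exI[of _ ?D] exI[of _ "Suc (y - 3)"] exI[of _ 1]) simp
    next
      case False
      \<comment> \<open>For \<open>x\<close> at least 2, vertex 0 is adjacent to \<open>x\<close>
        and the vertices from 1 to \<open>x - 1\<close> are adjacent to \<open>y\<close>, so only
        \<open>x\<close> and \<open>Suc x\<close> are missing and no further edge is left.\<close>
      let ?X = "{..<y} - {x, Suc x}"
      have "?X \<subseteq> V"
        by (rule subset_trans[OF _ y(2)]) auto
      moreover have "card ?X = y - 2"
        using x y(1) by (simp add: card_Diff_subset)
      ultimately have X: "?X \<subseteq> V" "card ?X = y - 2"
        by blast+
      have "\<forall>s. (\<exists>d\<in>edges_part (anticycle_adj N) y x. d \<subseteq> s \<union> {x, y}) \<longleftrightarrow>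
          (\<exists>d\<in>{} \<union> (\<lambda>z. {z}) ` ?X. d \<subseteq> s)"
        using x y(1) False by (intro allI edges_part_colon) (auto simp: anticycle_adj_def)
      moreover have "res_within K V ({} \<union> (\<lambda>z. {z}) ` ?X) (y - 2) 0 False"
        using res_within_vars[of ?X V K] X res_within_mono[of K V _ "y - 2" 0 True "y - 2" 0] by auto
      moreover have "Suc (y - 2) \<le> y - 1"
        using y(1) assms(2) by simp
      ultimately show ?thesis
        using False by (intro exI[of _ "{} \<union> (\<lambda>z. {z}) ` ?X"] exI[of _ "y - 2"] exI[of _ 0]) simp
    qed
  qed (use y assms(2) in \<open>auto simp: anticycle_adj_def\<close>)
  show ?thesis
    using assms(1,3)
  proof (induction y rule: nat_induct_at_least)
    case base
    have "{..N - 1} \<subseteq> V"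
      using base by auto
    then have "res_within K V (edges_upto (anticycle_adj N) (Suc (N - 1))) (N - 1 - 1) 1 True"
      using assms(2) by (intro res_within_anticycle_base) auto
    \<comment> \<open>The complement of the path still has excess 1; adding vertex \<open>N\<close>
      attains the relaxed bound 2.\<close>
    then have "res_within K V (edges_upto (anticycle_adj N) (Suc (N - 1))) (N - 1) 2 False"
      by (rule res_within_mono) auto
    then show ?case
      using base assms(2) by (intro step) auto
  next
    case (Suc y)
    have "{..y} \<subseteq> V"
      using Suc.prems by auto
    then show ?case
      using res_within_mono[OF Suc.IH, of y 2] Suc.prems Suc.hyps by (intro step) auto
  qed
qed

lemma edge_reg_split:
  assumes "0 < a" "2 \<le> n"
  shows "edge_reg K (nat_graph (split_adj a) n) = 1"
proof -
  have "res_within K {..<n} (edges_upto (split_adj a) (Suc (n - 1))) (n - 1) 1 True"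
    using assms by (intro res_within_split) auto
  then show ?thesis
    using assms by (intro edge_reg_nat_graph) simp
qed

lemma edge_reg_anticycle:
  assumes "4 \<le> N" "N < n"
  shows "edge_reg K (nat_graph (anticycle_adj N) n) = 2"
proof -
  have "res_within K {..<n} (edges_upto (anticycle_adj N) (Suc (n - 1))) (n - 1 - 1) 2 True"
    using assms by (intro res_within_anticycle) auto
  then show ?thesis
    using assms by (intro edge_reg_nat_graph) simp
qed

section \<open>Matching numbers\<close>

context
  fixes G :: "'v graph"
  assumes G: "simple_graph G"
begin

lemma finite_edges: "finite (edges G)"
proof (rule finite_subset)
  show "edges G \<subseteq> Pow (verts G)" "finite (Pow (verts G))"
    using G by (auto simp: simple_graph_def)
qed

lemma finite_matchings: "finite {M. matching G M}" "finite {M. maximal_matching G M}"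
proof -
  have "{M. matching G M} \<subseteq> Pow (edges G)"
    by (auto simp: matching_def)
  then show fin: "finite {M. matching G M}"
    using finite_edges by (meson finite_Pow_iff finite_subset)
  have "{M. maximal_matching G M} \<subseteq> {M. matching G M}"
    by (auto simp: maximal_matching_def)
  then show "finite {M. maximal_matching G M}"
    using fin by (rule finite_subset)
qed

lemma matching_finite: "matching G M \<Longrightarrow> finite M"
  using finite_edges by (auto simp: matching_def intro: finite_subset)

lemma match_number_ge: "matching G M \<Longrightarrow> card M \<le> match_number G"
  unfolding match_number_def using finite_matchings by (intro Max_ge) auto

lemma match_number_attained: obtains M where "matching G M" "card M = match_number G"
proof -
  have "matching G {}"
    by (simp add: matching_def)
  then have "match_number G \<in> card ` {M. matching G M}"
    unfolding match_number_def using finite_matchings by (intro Max_in) auto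
  then show thesis
    using that by auto
qed

lemma maximal_matching_exists: obtains M where "maximal_matching G M" "card M = match_number G"
proof -
  obtain M where M: "matching G M" "card M = match_number G"
    by (rule match_number_attained)
  have "\<not> matching G (insert e M)" if "e \<notin> M" for e
    using match_number_ge[of "insert e M"] M(2) matching_finite[OF M(1)] that by auto
  then have "maximal_matching G M"
    using M(1) by (auto simp: maximal_matching_def)
  then show thesis
    using that M(2) by blast
qed

lemma min_match_number_le: "maximal_matching G M \<Longrightarrow> min_match_number G \<le> card M"
  unfolding min_match_number_def using finite_matchings by (intro Min_le) auto

lemma min_match_number_attained:
  obtains M where "maximal_matching G M" "card M = min_match_number G"
proof -
  obtain M where "maximal_matching G M"
    by (rule maximal_matching_exists)
  then have "min_match_number G \<in> card ` {M. maximal_matching G M}"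
    unfolding min_match_number_def using finite_matchings by (intro Min_in) auto
  then show thesis
    using that by auto
qed

lemma min_match_le_match_number: "min_match_number G \<le> match_number G"
  using maximal_matching_exists min_match_number_le by metis

lemma card_Union_matching:
  assumes "matching G M"
  shows "card (\<Union>M) = 2 * card M"
proof -
  have e: "finite e \<and> card e = 2" if "e \<in> M" for e
    using that assms G by (auto simp: matching_def simple_graph_def intro: finite_subset)
  have "card (\<Union>M) = (\<Sum>e\<in>M. card e)"
    using assms e by (intro card_Union_disjoint) (auto simp: matching_def)
  then show ?thesis
    using e by simp
qed

lemma match_number_le_half: "2 * match_number G \<le> card (verts G)"
proof -
  obtain M where M: "matching G M" "card M = match_number G"
    by (rule match_number_attained)
  have "\<Union>M \<subseteq> verts G"
    using M(1) G by (auto simp: matching_def simple_graph_def)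
  then have "card (\<Union>M) \<le> card (verts G)"
    using G by (intro card_mono) (auto simp: simple_graph_def)
  then show ?thesis
    using card_Union_matching[OF M(1)] M(2) by simp
qed

text \<open>The vertices of a maximal matching form a vertex cover. Together with the converse
  \<open>maximal_matchingI\<close> this replaces maximality by covering in all later
  estimates.\<close>

lemma maximal_matching_meets:
  assumes M: "maximal_matching G M" and e: "e \<in> edges G"
  shows "e \<inter> \<Union>M \<noteq> {}"
proof (cases "e \<in> M")
  case True
  have "e \<noteq> {}"
    using e G by (auto simp: simple_graph_def)
  then show ?thesis
    using True by blast
next
  case False
  then have "\<not> matching G (insert e M)"
    using M e by (auto simp: maximal_matching_def)
  then obtain f where "f \<in> M" "\<not> disjnt e f"
    using M e by (auto simp: maximal_matching_def matching_def pairwise_insert disjnt_sym)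
  then show ?thesis
    by (auto simp: disjnt_def)
qed

lemma maximal_matchingI:
  assumes M: "matching G M" and meets: "\<And>e. e \<in> edges G \<Longrightarrow> e \<inter> \<Union>M \<noteq> {}"
  shows "maximal_matching G M"
  unfolding maximal_matching_def
proof (intro conjI M ballI notI)
  fix e assume e: "e \<in> edges G - M" and m: "matching G (insert e M)"
  have "disjnt e f" if "f \<in> M" for f
    using m e that by (auto simp: matching_def pairwise_insert)
  then have "e \<inter> \<Union>M = {}"
    by (auto simp: disjnt_def)
  then show False
    using meets e by blast
qed

text \<open>\<open>meet\<close> forbids any two distinct edges of an induced matching, and
  \<open>e\<close> supplies a matching with one edge.\<close>

lemma ind_match_number_eq_1:
  assumes e: "e \<in> edges G"
    and meet: "\<And>e f. e \<in> edges G \<Longrightarrow> f \<in> edges G \<Longrightarrow> disjnt e f \<Longrightarrow>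
      \<exists>p\<in>e. \<exists>q\<in>f. {p, q} \<in> edges G"
  shows "ind_match_number G = 1"
  unfolding ind_match_number_def
proof (rule Max_eqI)
  have "{M. induced_matching G M} \<subseteq> Pow (edges G)"
    by (auto simp: induced_matching_def)
  then show "finite (card ` {M. induced_matching G M})"
    using finite_edges by (meson finite_Pow_iff finite_imageI finite_subset)
  have "induced_matching G {e}"
    using e by (simp add: induced_matching_def)
  then show "1 \<in> card ` {M. induced_matching G M}"
    by (intro image_eqI[of _ _ "{e}"]) auto
next
  fix k assume "k \<in> card ` {M. induced_matching G M}"
  then obtain M where M: "induced_matching G M" "k = card M"
    by auto
  have "e = f" if "e \<in> M" "f \<in> M" for e f
  proof (rule ccontr)
    assume "e \<noteq> f"
    then have "three_disjoint G e f"
      using M(1) that by (auto simp: induced_matching_def pairwise_def)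
    moreover have "e \<in> edges G" "f \<in> edges G"
      using M(1) that by (auto simp: induced_matching_def)
    ultimately obtain p q where "p \<in> e" "q \<in> f" "{p, q} \<in> edges G"
      using meet[of e f] by (auto simp: three_disjoint_def)
    then have "\<exists>g\<in>edges G. g \<inter> e \<noteq> {} \<and> g \<inter> f \<noteq> {}"
      by (intro bexI[of _ "{p, q}"]) auto
    then show False
      using \<open>three_disjoint G e f\<close> by (simp add: three_disjoint_def)
  qed
  then have "M \<subseteq> {x}" if "x \<in> M" for x
    using that by blast
  then show "k \<le> 1"
    using M(2) card_mono[of "{_}" M] by (cases "M = {}") fastforce+
qed

end

lemma connected_graphI:
  assumes "r \<in> verts G" and "\<And>v. v \<in> verts G \<Longrightarrow> (v, r) \<in> {(x, y). {x, y} \<in> edges G}\<^sup>*"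
  shows "connected_graph G"
  unfolding connected_graph_def
proof (intro conjI ballI)
  show "verts G \<noteq> {}"
    using assms(1) by blast
  fix u v assume "u \<in> verts G" "v \<in> verts G"
  have "sym {(x, y). {x, y} \<in> edges G}"
    by (auto simp: sym_def insert_commute)
  then have "(r, v) \<in> {(x, y). {x, y} \<in> edges G}\<^sup>*"
    using assms(2)[OF \<open>v \<in> verts G\<close>] sym_rtrancl symD by metis
  then show "(u, v) \<in> {(x, y). {x, y} \<in> edges G}\<^sup>*"
    using assms(2)[OF \<open>u \<in> verts G\<close>] by (rule rtrancl_trans[rotated])
qed

lemma nat_graph_simps [simp]:
  "verts (nat_graph adj n) = {..<n}" "edges (nat_graph adj n) = edges_upto adj n"
  by (simp_all add: nat_graph_def)

subsection \<open>Complete graphs joined with independent sets\<close>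

lemma connected_split:
  assumes "0 < a" "0 < n"
  shows "connected_graph (nat_graph (split_adj a) n)"
proof (rule connected_graphI[of 0])
  fix v assume "v \<in> verts (nat_graph (split_adj a) n)"
  then have "v = 0 \<or> {v, 0} \<in> edges (nat_graph (split_adj a) n)"
    using assms by (auto simp: pair_in_edges_upto split_adj_def)
  then show "(v, 0) \<in> {(x, y). {x, y} \<in> edges (nat_graph (split_adj a) n)}\<^sup>*"
    by auto
qed (use assms in simp)

lemma ind_match_split:
  assumes "0 < a" "2 \<le> n"
  shows "ind_match_number (nat_graph (split_adj a) n) = 1"
proof (rule ind_match_number_eq_1[OF simple_nat_graph])
  show "{0, 1} \<in> edges (nat_graph (split_adj a) n)"
    using assms by (simp add: pair_in_edges_upto split_adj_def)
next
  fix e f assume ef: "e \<in> edges (nat_graph (split_adj a) n)" "f \<in> edges (nat_graph (split_adj a) n)"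
    "disjnt e f"
  obtain x y where e: "e = {x, y}" "x < y" "y < n" "split_adj a x y"
    using ef(1) by (auto elim: edges_uptoE)
  obtain u v where f: "f = {u, v}" "u < v" "v < n" "split_adj a u v"
    using ef(2) by (auto elim: edges_uptoE)
  have "x \<noteq> u"
    using ef(3) e(1) f(1) by (auto simp: disjnt_def)
  then have "{x, u} \<in> edges (nat_graph (split_adj a) n)"
    using e f by (auto simp: pair_in_edges_upto split_adj_def)
  then show "\<exists>p\<in>e. \<exists>q\<in>f. {p, q} \<in> edges (nat_graph (split_adj a) n)"
    unfolding e(1) f(1) by simp
qed

text \<open>If a vertex of the complete graph is uncovered, all others are covered.\<close>

lemma min_match_split_ge:
  assumes "a < n"
  shows "a \<le> 2 * min_match_number (nat_graph (split_adj a) n)"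
proof -
  let ?G = "nat_graph (split_adj a) n"
  note G = simple_nat_graph[of "split_adj a" n]
  obtain M where M: "maximal_matching ?G M" "card M = min_match_number ?G"
    using min_match_number_attained[OF G] .
  have m: "matching ?G M"
    using M(1) by (simp add: maximal_matching_def)
  have "finite (\<Union>M)"
    using m by (intro finite_subset[of "\<Union>M" "{..<n}"]) (auto simp: matching_def elim!: edges_uptoE)
  have "a \<le> card (\<Union>M)"
  proof (cases "{..<a} \<subseteq> \<Union>M")
    case True
    then show ?thesis
      using card_mono[OF \<open>finite (\<Union>M)\<close> True] by simp
  next
    case False
    then obtain x where x: "x < a" "x \<notin> \<Union>M"
      by blast
    have "z \<in> \<Union>M" if "z < n" "z \<noteq> x" for z
    proof -
      have "{x, z} \<in> edges ?G"
        using that x(1) assms by (auto simp: pair_in_edges_upto split_adj_def)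
      then show ?thesis
        using maximal_matching_meets[OF G M(1)] x(2) by blast
    qed
    then have "card ({..<n} - {x}) \<le> card (\<Union>M)"
      using \<open>finite (\<Union>M)\<close> by (intro card_mono) auto
    then show ?thesis
      using x(1) assms by simp
  qed
  then show ?thesis
    using card_Union_matching[OF G m] M(2) by simp
qed

lemma maximal_matching_split:
  assumes "matching (nat_graph (split_adj a) n) M" "{..<a} \<subseteq> \<Union>M"
  shows "maximal_matching (nat_graph (split_adj a) n) M"
proof (rule maximal_matchingI[OF simple_nat_graph assms(1)])
  fix e assume "e \<in> edges (nat_graph (split_adj a) n)"
  then obtain x y where "e = {x, y}" "x < a"
    by (auto simp: split_adj_def elim: edges_uptoE)
  then show "e \<inter> \<Union>M \<noteq> {}"
    using assms(2) by blast
qed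

subsection \<open>Anticycles with a multiplied vertex\<close>

lemma connected_anticycle:
  assumes "4 \<le> N" "N < n"
  shows "connected_graph (nat_graph (anticycle_adj N) n)"
proof (rule connected_graphI[of 0])
  let ?R = "{(x, y). {x, y} \<in> edges (nat_graph (anticycle_adj N) n)}"
  have far: "(v, 0) \<in> ?R" if "2 \<le> v" "v < N" for v
    using that assms by (simp add: pair_in_edges_upto anticycle_adj_def)
  fix v assume "v \<in> verts (nat_graph (anticycle_adj N) n)"
  then consider "v = 0" | "v = 1" | "2 \<le> v" "v < N" | "N \<le> v" "v < n"
    by force
  then show "(v, 0) \<in> ?R\<^sup>*"
  proof cases
    case 2
    have "(1, 3) \<in> ?R"
      using assms by (simp add: pair_in_edges_upto anticycle_adj_def)
    then show ?thesis
      using far[of 3] assms 2 by (auto intro: rtrancl_trans)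
  next
    case 4
    have "(v, 2) \<in> ?R"
      using assms 4 by (simp add: pair_in_edges_upto anticycle_adj_def)
    then show ?thesis
      using far[of 2] assms 4 by (auto intro: rtrancl_trans)
  qed (use far in auto)
qed (use assms in simp)

text \<open>The delicate case for induced matchings: the smaller endpoints of the two edges are
  neighbours on the cycle, hence not adjacent, and a connecting edge has to use a larger
  endpoint.\<close>

lemma anticycle_consecutive:
  assumes N: "4 \<le> N" and xy: "x < y" "y < n" "anticycle_adj N x y"
    and uv: "u < v" "v < n" "anticycle_adj N u v" and u: "u = Suc x" "y \<noteq> u"
  shows "{x, v} \<in> edges_upto (anticycle_adj N) n \<or> {y, u} \<in> edges_upto (anticycle_adj N) n \<or>
    {y, v} \<in> edges_upto (anticycle_adj N) n"
proof -
  have "u + 1 < N"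
    using uv by (auto simp: anticycle_adj_def split: if_splits)
  have "u < y"
    using xy u by simp
  show ?thesis
  proof (cases "N \<le> y \<or> u + 2 \<le> y")
    case True
    then have "anticycle_adj N u y"
      using \<open>u + 1 < N\<close> u(1) by (auto simp: anticycle_adj_def)
    then show ?thesis
      using \<open>u < y\<close> xy by (simp add: pair_in_edges_upto)
  next
    case False
    then have y: "y = Suc u" "y < N"
      using \<open>u < y\<close> by simp_all
    show ?thesis
    proof (cases "v < N \<or> 1 \<le> x")
      case True
      then have "anticycle_adj N x v"
        using uv u(1) y by (auto simp: anticycle_adj_def split: if_splits)
      then show ?thesis
        using uv u(1) by (simp add: pair_in_edges_upto)
    next
      \<comment> \<open>What remains is \<open>x = 0\<close>, \<open>u = 1\<close>,
        \<open>y = 2\<close> with \<open>v\<close> a copy of vertex \<open>N\<close>. Vertex 2 is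
        adjacent to all copies because \<open>N\<close> is at least 4.\<close>
      case False
      then have "anticycle_adj N y v" "y < v"
        using u(1) y N by (auto simp: anticycle_adj_def)
      then show ?thesis
        using uv by (simp add: pair_in_edges_upto)
    qed
  qed
qed

lemma ind_match_anticycle:
  assumes "4 \<le> N" "N < n"
  shows "ind_match_number (nat_graph (anticycle_adj N) n) = 1"
proof (rule ind_match_number_eq_1[OF simple_nat_graph])
  let ?G = "nat_graph (anticycle_adj N) n"
  show "{0, 2} \<in> edges ?G"
    using assms by (simp add: pair_in_edges_upto anticycle_adj_def)
next
  let ?G = "nat_graph (anticycle_adj N) n"
  fix e f assume ef: "e \<in> edges ?G" "f \<in> edges ?G" "disjnt e f"
  obtain x y where e: "e = {x, y}" "x < y" "y < n" "anticycle_adj N x y"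
    using ef(1) by (auto elim: edges_uptoE)
  obtain u v where f: "f = {u, v}" "u < v" "v < n" "anticycle_adj N u v"
    using ef(2) by (auto elim: edges_uptoE)
  have ne: "x \<noteq> u" "x \<noteq> v" "y \<noteq> u" "y \<noteq> v"
    using ef(3) e(1) f(1) by (auto simp: disjnt_def)
  have "x < N" "u < N"
    using e(2,4) f(2,4) by (auto simp: anticycle_adj_def split: if_splits)
  consider "x + 2 \<le> u" | "u + 2 \<le> x" | "u = Suc x" | "x = Suc u"
    using ne(1) by linarith
  then have "{x, u} \<in> edges ?G \<or> {x, v} \<in> edges ?G \<or> {y, u} \<in> edges ?G \<or> {y, v} \<in> edges ?G"
  proof cases
    case 1
    then show ?thesis
      using \<open>u < N\<close> assms by (simp add: pair_in_edges_upto anticycle_adj_def)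
  next
    case 2
    then show ?thesis
      using \<open>x < N\<close> assms by (simp add: pair_in_edges_upto anticycle_adj_def)
  next
    case 3
    then show ?thesis
      using anticycle_consecutive[OF assms(1) e(2-4) f(2-4)] ne(3) by auto
  next
    case 4
    then show ?thesis
      using anticycle_consecutive[OF assms(1) f(2-4) e(2-4)] ne(2) by (auto simp: insert_commute)
  qed
  then show "\<exists>p\<in>e. \<exists>q\<in>f. {p, q} \<in> edges ?G"
    unfolding e(1) f(1) by auto
qed

text \<open>Two uncovered vertices below \<open>N\<close> are consecutive, so no third one is uncovered and one of
  them is adjacent to \<open>N\<close>.\<close>

lemma min_match_anticycle_ge:
  assumes "4 \<le> N" "N < n"
  shows "N \<le> 2 * min_match_number (nat_graph (anticycle_adj N) n) + 1"
proof -
  let ?G = "nat_graph (anticycle_adj N) n"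
  note G = simple_nat_graph[of "anticycle_adj N" n]
  obtain M where M: "maximal_matching ?G M" "card M = min_match_number ?G"
    using min_match_number_attained[OF G] .
  have m: "matching ?G M"
    using M(1) by (simp add: maximal_matching_def)
  have fin: "finite (\<Union>M)"
    using m by (intro finite_subset[of "\<Union>M" "{..<n}"]) (auto simp: matching_def elim!: edges_uptoE)
  have edge: "x \<in> \<Union>M \<or> y \<in> \<Union>M" if "x < y" "y < n" "anticycle_adj N x y" for x y
  proof -
    have "{x, y} \<in> edges ?G"
      using that by (simp add: pair_in_edges_upto)
    then show ?thesis
      using maximal_matching_meets[OF G M(1)] by blast
  qed
  have "N \<le> card (\<Union>M) + 1"
  proof (cases "\<exists>x. Suc x < N \<and> x \<notin> \<Union>M \<and> Suc x \<notin> \<Union>M")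
    case True
    then obtain x where x: "Suc x < N" "x \<notin> \<Union>M" "Suc x \<notin> \<Union>M"
      by blast
    have "z \<in> \<Union>M" if z: "z < N" "z \<noteq> x" "z \<noteq> Suc x" for z
    proof -
      have "z < x \<or> Suc x < z"
        using z by linarith
      then show ?thesis
        using edge[of z "Suc x"] edge[of x z] x z assms by (auto simp: anticycle_adj_def)
    qed
    moreover have "N \<in> \<Union>M"
      using edge[of x N] edge[of "Suc x" N] x assms by (cases x) (auto simp: anticycle_adj_def)
    \<comment> \<open>The covered vertex \<open>N\<close> compensates for one of the two uncovered
      vertices, which saves the bound \<open>N - 1\<close>.\<close>
    ultimately have "card (insert N ({..<N} - {x, Suc x})) \<le> card (\<Union>M)"
      by (intro card_mono fin) auto
    moreover have "card (insert N ({..<N} - {x, Suc x})) = Suc (N - 2)"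
      using x(1) by (subst card_insert_disjoint) (auto simp: card_Diff_subset)
    ultimately show ?thesis by simp
  next
    case False
    have one: "x = y" if "x < N" "x \<notin> \<Union>M" "y < N" "y \<notin> \<Union>M" for x y
    proof (rule ccontr)
      assume "x \<noteq> y"
      then consider "y = Suc x" | "x = Suc y" | "x + 2 \<le> y" | "y + 2 \<le> x"
        by linarith
      then show False
        using False that edge[of x y] edge[of y x] assms
        by cases (auto simp: anticycle_adj_def)
    qed
    have "card ({..<N} - \<Union>M) \<le> 1"
      using one by (intro card_le_Suc0_iff_eq[THEN iffD2, unfolded One_nat_def[symmetric]]) auto
    moreover have "card {..<N} \<le> card (({..<N} - \<Union>M) \<union> \<Union>M)"
      using fin by (intro card_mono) auto
    moreover have "card (({..<N} - \<Union>M) \<union> \<Union>M) \<le> card ({..<N} - \<Union>M) + card (\<Union>M)"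
      by (rule card_Un_le)
    ultimately show ?thesis by simp
  qed
  then show ?thesis
    using card_Union_matching[OF G m] M(2) by simp
qed

text \<open>The copies of vertex \<open>N\<close> are independent, so the vertices below
  \<open>N\<close> are a vertex cover.\<close>

lemma maximal_matching_anticycle:
  assumes "matching (nat_graph (anticycle_adj N) n) M" "{..<N} \<subseteq> \<Union>M"
  shows "maximal_matching (nat_graph (anticycle_adj N) n) M"
proof (rule maximal_matchingI[OF simple_nat_graph assms(1)])
  fix e assume "e \<in> edges (nat_graph (anticycle_adj N) n)"
  then obtain x y where "e = {x, y}" "x < N"
    by (auto simp: anticycle_adj_def elim!: edges_uptoE split: if_splits)
  then show "e \<inter> \<Union>M \<noteq> {}"
    using assms(2) by blast
qed

section \<open>The eight cases\<close>

text \<open>Distinct numbers of vertices rule out isomorphisms and make the family infinite.\<close>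

lemma infinitely_realizableI:
  fixes f :: "nat \<Rightarrow> nat graph"
  assumes inj: "\<And>k l. card (verts (f k)) = card (verts (f l)) \<Longrightarrow> k = l"
    and f: "\<And>k. simple_graph (f k) \<and> connected_graph (f k) \<and> satisfies K P (f k)"
  shows "realizable K P \<and> infinitely_realizable K P"
proof
  show "realizable K P"
    using f unfolding realizable_def by blast
  have "inj f"
    using inj by (intro injI) metis
  then have "infinite (range f)"
    by (simp add: finite_image_iff)
  moreover have "\<not> graph_iso (f k) (f l)" if "f k \<noteq> f l" for k l
  proof
    assume "graph_iso (f k) (f l)"
    then have "card (verts (f k)) = card (verts (f l))"
      unfolding graph_iso_def using bij_betw_same_card by blast
    then show False
      using inj that by blast
  qed
  then have "pairwise (\<lambda>G H. \<not> graph_iso G H) (range f)"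
    by (auto simp: pairwise_def)
  ultimately show "infinitely_realizable K P"
    unfolding infinitely_realizable_def using f by blast
qed

lemma satisfies_split:
  assumes "0 < a" "2 \<le> n"
    and "P 1 1 (int (min_match_number (nat_graph (split_adj a) n)))
      (int (match_number (nat_graph (split_adj a) n)))"
  shows "simple_graph (nat_graph (split_adj a) n) \<and> connected_graph (nat_graph (split_adj a) n) \<and>
    satisfies K P (nat_graph (split_adj a) n)"
  using assms
  by (simp add: satisfies_def simple_nat_graph connected_split ind_match_split edge_reg_split)

lemma satisfies_anticycle:
  assumes "4 \<le> N" "N < n"
    and "P 1 2 (int (min_match_number (nat_graph (anticycle_adj N) n)))
      (int (match_number (nat_graph (anticycle_adj N) n)))"
  shows "simple_graph (nat_graph (anticycle_adj N) n) \<and> connected_graph (nat_graph (anticycle_adj N) n) \<and>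
    satisfies K P (nat_graph (anticycle_adj N) n)"
  using assms
  by (simp add: satisfies_def simple_nat_graph connected_anticycle ind_match_anticycle edge_reg_anticycle)

section \<open>Matching numbers of the chosen graphs\<close>

lemma match_number_star: "match_number (nat_graph (split_adj 1) n) \<le> 1"
proof -
  let ?G = "nat_graph (split_adj 1) n"
  obtain M where M: "matching ?G M" "card M = match_number ?G"
    using match_number_attained[OF simple_nat_graph] .
  have 0: "0 \<in> e" if "e \<in> M" for e
    using M(1) that by (auto simp: matching_def edges_upto_def split_adj_def)
  have "e = f" if "e \<in> M" "f \<in> M" for e f
  proof -
    have "e = f \<or> disjnt e f"
      using M(1) that by (auto simp: matching_def pairwise_def)
    then show ?thesis
      using 0 that by (auto simp: disjnt_iff)
  qed
  moreover have "finite M"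
    using matching_finite[OF simple_nat_graph M(1)] .
  ultimately have "card M \<le> Suc 0"
    by (simp add: card_le_Suc0_iff_eq)
  then show ?thesis
    using M(2) by simp
qed

lemma star_match:
  assumes "2 \<le> n"
  shows "min_match_number (nat_graph (split_adj 1) n) = 1" "match_number (nat_graph (split_adj 1) n) = 1"
  using min_match_split_ge[of 1 n] match_number_star[of n]
    min_match_le_match_number[OF simple_nat_graph[of "split_adj 1" n]] assms
  by linarith+

text \<open>Vertices 0 and 1 cover every edge, so the edge joining them is maximal alone; vertices 2
  and 3 give them separate partners.\<close>

lemma double_star_match:
  assumes "4 \<le> n"
  shows "min_match_number (nat_graph (split_adj 2) n) = 1" "1 < match_number (nat_graph (split_adj 2) n)"
proof -
  let ?G = "nat_graph (split_adj 2) n"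
  have "maximal_matching ?G {{0, 1}}"
    using assms by (intro maximal_matching_split)
      (auto simp: matching_def pair_in_edges_upto split_adj_def)
  then have "min_match_number ?G \<le> 1"
    using min_match_number_le[OF simple_nat_graph] by fastforce
  then show "min_match_number ?G = 1"
    using min_match_split_ge[of 2 n] assms by linarith
  have "matching ?G {{0, 2}, {1, 3}}"
    using assms by (auto simp: matching_def pair_in_edges_upto split_adj_def pairwise_insert disjnt_def)
  then show "1 < match_number ?G"
    using match_number_ge[OF simple_nat_graph] by (fastforce simp: doubleton_eq_iff)
qed

text \<open>The bound \<open>3 \<le> 2 * q\<close> forces two edges in a maximal matching, while six
  vertices give each of 0, 1, 2 a partner of its own.\<close>

lemma triple_star_match:
  assumes "6 \<le> n"
  shows "1 < min_match_number (nat_graph (split_adj 3) n)"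
    "min_match_number (nat_graph (split_adj 3) n) < match_number (nat_graph (split_adj 3) n)"
proof -
  let ?G = "nat_graph (split_adj 3) n"
  have "maximal_matching ?G {{0, 1}, {2, 3}}"
  proof (rule maximal_matching_split)
    show "matching ?G {{0, 1}, {2, 3}}"
      using assms by (auto simp: matching_def pair_in_edges_upto split_adj_def pairwise_insert disjnt_def)
  qed auto
  then have "min_match_number ?G \<le> 2"
    using min_match_number_le[OF simple_nat_graph] by (fastforce simp: doubleton_eq_iff)
  moreover have "matching ?G {{0, 3}, {1, 4}, {2, 5}}"
    using assms by (auto simp: matching_def pair_in_edges_upto split_adj_def pairwise_insert disjnt_def)
  then have "3 \<le> match_number ?G"
    using match_number_ge[OF simple_nat_graph] by (fastforce simp: doubleton_eq_iff)
  ultimately show "1 < min_match_number ?G" "min_match_number ?G < match_number ?G"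
    using min_match_split_ge[of 3 n] assms by linarith+
qed

text \<open>With a single independent vertex the graph is complete on \<open>2 * m + 2\<close>
  vertices. The bounds \<open>2 * m + 1 \<le> 2 * q\<close> and \<open>2 * r \<le> 2 * m + 2\<close>
  meet by parity.\<close>

lemma odd_complete_match:
  shows "min_match_number (nat_graph (split_adj (2 * m + 1)) (2 * m + 2)) = m + 1"
    "match_number (nat_graph (split_adj (2 * m + 1)) (2 * m + 2)) = m + 1"
  using min_match_split_ge[of "2 * m + 1" "2 * m + 2"]
    match_number_le_half[OF simple_nat_graph[of "split_adj (2 * m + 1)" "2 * m + 2"]]
    min_match_le_match_number[OF simple_nat_graph[of "split_adj (2 * m + 1)" "2 * m + 2"]]
  by simp_all

text \<open>With one copy of vertex \<open>N\<close> this is the complement of the cycle of length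
  \<open>2 * m + 1\<close>. The bounds \<open>2 * m \<le> 2 * q + 1\<close> and
  \<open>2 * r \<le> 2 * m + 1\<close> meet by parity.\<close>

lemma odd_anticycle_match:
  assumes "2 \<le> m"
  shows "min_match_number (nat_graph (anticycle_adj (2 * m)) (2 * m + 1)) = m"
    "match_number (nat_graph (anticycle_adj (2 * m)) (2 * m + 1)) = m"
  using min_match_anticycle_ge[of "2 * m" "2 * m + 1"] assms
    match_number_le_half[OF simple_nat_graph[of "anticycle_adj (2 * m)" "2 * m + 1"]]
    min_match_le_match_number[OF simple_nat_graph[of "anticycle_adj (2 * m)" "2 * m + 1"]]
  by simp_all

text \<open>A 5-cycle, being its own complement up to isomorphism, with one vertex multiplied. Two
  edges suffice to cover 0 to 3, and two copies admit a third edge.\<close>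

lemma anticycle_5_match:
  assumes "6 \<le> n"
  shows "min_match_number (nat_graph (anticycle_adj 4) n) = 2"
    "2 < match_number (nat_graph (anticycle_adj 4) n)"
proof -
  let ?G = "nat_graph (anticycle_adj 4) n"
  have "maximal_matching ?G {{0, 2}, {1, 3}}"
  proof (rule maximal_matching_anticycle)
    show "matching ?G {{0, 2}, {1, 3}}"
      using assms by (auto simp: matching_def pair_in_edges_upto anticycle_adj_def pairwise_insert disjnt_def)
  qed auto
  then have "min_match_number ?G \<le> 2"
    using min_match_number_le[OF simple_nat_graph] by (fastforce simp: doubleton_eq_iff)
  then show "min_match_number ?G = 2"
    using min_match_anticycle_ge[of 4 n] assms by linarith
  have "matching ?G {{0, 3}, {1, 4}, {2, 5}}"
    using assms by (auto simp: matching_def pair_in_edges_upto anticycle_adj_def pairwise_insert disjnt_def)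
  then show "2 < match_number ?G"
    using match_number_ge[OF simple_nat_graph] by (fastforce simp: doubleton_eq_iff)
qed

text \<open>\<open>N = 6\<close> is the least value for which \<open>N \<le> 2 * q + 1\<close>
  forces \<open>q > 2\<close>. The two copies 6 and 7 make room for a fourth edge.\<close>

lemma anticycle_7_match:
  assumes "8 \<le> n"
  shows "2 < min_match_number (nat_graph (anticycle_adj 6) n)"
    "min_match_number (nat_graph (anticycle_adj 6) n) < match_number (nat_graph (anticycle_adj 6) n)"
proof -
  let ?G = "nat_graph (anticycle_adj 6) n"
  have "maximal_matching ?G {{0, 3}, {1, 4}, {2, 5}}"
  proof (rule maximal_matching_anticycle)
    show "matching ?G {{0, 3}, {1, 4}, {2, 5}}"
      using assms by (auto simp: matching_def pair_in_edges_upto anticycle_adj_def pairwise_insert disjnt_def)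
  qed auto
  then have "min_match_number ?G \<le> 3"
    using min_match_number_le[OF simple_nat_graph] by (fastforce simp: doubleton_eq_iff)
  moreover have "matching ?G {{1, 6}, {2, 7}, {0, 4}, {3, 5}}"
    using assms by (auto simp: matching_def pair_in_edges_upto anticycle_adj_def pairwise_insert disjnt_def)
  then have "4 \<le> match_number ?G"
    using match_number_ge[OF simple_nat_graph] by (fastforce simp: doubleton_eq_iff)
  ultimately show "2 < min_match_number ?G" "min_match_number ?G < match_number ?G"
    using min_match_anticycle_ge[of 6 n] assms by linarith+
qed

theorem theorem1p9:
  fixes K :: "'k::field itself"
  shows
    "realizable K (\<lambda>i c q r. i = c \<and> c = q \<and> q = r) \<and>
     realizable K (\<lambda>i c q r. i = c \<and> c = q \<and> q < r) \<and>
     realizable K (\<lambda>i c q r. i = c \<and> c < q \<and> q = r) \<and>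
     realizable K (\<lambda>i c q r. i = c \<and> c < q \<and> q < r) \<and>
     realizable K (\<lambda>i c q r. i < c \<and> c = q \<and> q = r) \<and>
     realizable K (\<lambda>i c q r. i < c \<and> c = q \<and> q < r) \<and>
     realizable K (\<lambda>i c q r. i < c \<and> c < q \<and> q = r) \<and>
     realizable K (\<lambda>i c q r. i < c \<and> c < q \<and> q < r) \<and>
     infinitely_realizable K (\<lambda>i c q r. i = c \<and> c = q \<and> q = r) \<and>
     infinitely_realizable K (\<lambda>i c q r. i = c \<and> c = q \<and> q < r) \<and>
     infinitely_realizable K (\<lambda>i c q r. i = c \<and> c < q \<and> q = r) \<and>
     infinitely_realizable K (\<lambda>i c q r. i = c \<and> c < q \<and> q < r) \<and>
     infinitely_realizable K (\<lambda>i c q r. i < c \<and> c = q \<and> q < r) \<and>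
     infinitely_realizable K (\<lambda>i c q r. i < c \<and> c < q \<and> q = r) \<and>
     infinitely_realizable K (\<lambda>i c q r. i < c \<and> c < q \<and> q < r)"
proof -
  have "realizable K (\<lambda>i c q r. i = c \<and> c = q \<and> q = r) \<and>
      infinitely_realizable K (\<lambda>i c q r. i = c \<and> c = q \<and> q = r)"
    by (rule infinitely_realizableI[of "\<lambda>k. nat_graph (split_adj 1) (k + 2)"], simp)
      (rule satisfies_split, simp_all add: star_match[unfolded One_nat_def])
  moreover have "realizable K (\<lambda>i c q r. i = c \<and> c = q \<and> q < r) \<and>
      infinitely_realizable K (\<lambda>i c q r. i = c \<and> c = q \<and> q < r)"
    by (rule infinitely_realizableI[of "\<lambda>k. nat_graph (split_adj 2) (k + 4)"], simp)
      (rule satisfies_split, use double_star_match[of "_ + 4"] in simp_all)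
  moreover have "realizable K (\<lambda>i c q r. i = c \<and> c < q \<and> q = r) \<and>
      infinitely_realizable K (\<lambda>i c q r. i = c \<and> c < q \<and> q = r)"
    by (rule infinitely_realizableI[of "\<lambda>k. nat_graph (split_adj (2 * (k + 1) + 1)) (2 * (k + 1) + 2)"], simp)
      (rule satisfies_split, simp, simp, simp only: odd_complete_match, simp)
  moreover have "realizable K (\<lambda>i c q r. i = c \<and> c < q \<and> q < r) \<and>
      infinitely_realizable K (\<lambda>i c q r. i = c \<and> c < q \<and> q < r)"
    by (rule infinitely_realizableI[of "\<lambda>k. nat_graph (split_adj 3) (k + 6)"], simp)
      (rule satisfies_split, use triple_star_match[of "_ + 6"] in simp_all)
  \<comment> \<open>The graph is the 5-cycle.\<close>
  moreover have "realizable K (\<lambda>i c q r. i < c \<and> c = q \<and> q = r)"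
    unfolding realizable_def
    by (rule exI[of _ "nat_graph (anticycle_adj (2 * 2)) (2 * 2 + 1)"])
      (rule satisfies_anticycle, use odd_anticycle_match[of 2] in simp_all)
  moreover have "realizable K (\<lambda>i c q r. i < c \<and> c = q \<and> q < r) \<and>
      infinitely_realizable K (\<lambda>i c q r. i < c \<and> c = q \<and> q < r)"
    by (rule infinitely_realizableI[of "\<lambda>k. nat_graph (anticycle_adj 4) (k + 6)"], simp)
      (rule satisfies_anticycle, use anticycle_5_match[of "_ + 6"] in simp_all)
  \<comment> \<open>Here \<open>q\<close> and \<open>r\<close> both equal \<open>k + 3\<close>,
    which exceeds the regularity 2 for every \<open>k\<close>.\<close>
  moreover have "realizable K (\<lambda>i c q r. i < c \<and> c < q \<and> q = r) \<and>
      infinitely_realizable K (\<lambda>i c q r. i < c \<and> c < q \<and> q = r)"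
    by (rule infinitely_realizableI[of "\<lambda>k. nat_graph (anticycle_adj (2 * (k + 3))) (2 * (k + 3) + 1)"], simp)
      (rule satisfies_anticycle, simp, simp, simp only: odd_anticycle_match, simp)
  moreover have "realizable K (\<lambda>i c q r. i < c \<and> c < q \<and> q < r) \<and>
      infinitely_realizable K (\<lambda>i c q r. i < c \<and> c < q \<and> q < r)"
    by (rule infinitely_realizableI[of "\<lambda>k. nat_graph (anticycle_adj 6) (k + 8)"], simp)
      (rule satisfies_anticycle, use anticycle_7_match[of "_ + 8"] in simp_all)
  ultimately show ?thesis by blast
qed

end
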